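(* Let $d>4$ and, with the constant $c_4>0$ fixed in the context, let $\beta_*=\beta_*(r)=\beta_c-c_4r^{-d/2}$. For $\beta>0$ let $S_r=r^{-d}\sum_{x\in\mathbb T_r}\sigma_x$ and $$g^{\mathbb T_r}(\beta)=-\frac{\langle S_r^4\rangle_\beta^{\mathbb T_r}-3\big(\langle S_r^2\rangle_\beta^{\mathbb T_r}\big)^2}{\big(\langle S_r^2\rangle_\beta^{\mathbb T_r}\big)^2}.$$ There are a constant $c_g>0$ and an $r_0$ such that for all integers $r\ge r_0$, $$0<c_g\le g^{\mathbb T_r}(\beta_* )\le 2.$$
   Context: Ising model. For a finite graph $\mathcal G=(V,E)$ and $\beta>0$, the Ising expectation of a function $F$ of $\sigma\in\{-1,+1\}^V$ is $\langle F\rangle^{\mathcal G}_\beta=\frac{1}{Z}\sum_\sigma F(\sigma)\exp\big(\beta\sum_{xy\in E}\sigma_x\sigma_y\big)$ with $Z$ the normalising constant. For an integer $r\ge3$, $\Lambda_r=[-r/2,r/2)^d\cap\mathbb Z^d$ is the graph with nearest-neighbour edges, and $\mathbb T_r=(\mathbb Z/r\mathbb Z)^d$ is the discrete torus with nearest-neighbour edges. A point of $\mathbb T_r$ is identified with its representative in $\Lambda_r$; in particular $\|x\|_\infty$ and $\tau_\beta(0,x)$ for $x\in\mathbb T_r$ are evaluated at that representative. $\tau_\beta^{\mathcal G}(x,y)=\langle\sigma_x\sigma_y\rangle_\beta^{\mathcal G}$ for $\mathcal G=\Lambda_r,\mathbb T_r$; $\tau_\beta(x,y)=\lim_{r\to\infty}\tau_\beta^{\Lambda_r}(x,y)$;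 $\chi(\beta)=\sum_{x\in\mathbb Z^d}\tau_\beta(0,x)\in[0,\infty]$; $\beta_c=\sup\{\beta>0:\chi(\beta)<\infty\}$. Known inputs for $d>4$: $\chi(\beta)$ is bounded above and below by positive multiples of $(\beta_c-\beta)^{-1}$ for $\beta<\beta_c$; and there are positive constants $c_0,C_0$, which we fix, such that for all $\beta\le\beta_c$: $\tau_\beta(0,x)\le \frac{C_0}{\max(1,\|x\|_\infty)^{d-2}}e^{-c_0(\beta_c-\beta)^{1/2}\|x\|_\infty}$ for all $x\in\mathbb Z^d$, and $\tau_\beta(0,x)\ge\frac{c_0}{\max(1,\|x\|_\infty)^{d-2}}$ whenever $\|x\|_\infty\le c_0(\beta_c-\beta)^{-1/2}$. Constants $c_1,\dots,c_5$: these are fixed positive constants depending only on $d$, with $c_3=\frac49c_0^2$, for which the following holds (their existence is a theorem of the same paper): $\tau_\beta^{\mathbb T_r}(0,x)\le \tau_\beta(0,x)+c_1\chi(\beta)r^{-d}$ for all $r\ge3$, $\beta\in(0,\beta_c)$, $x\in\mathbb T_r$; and $\tau_\beta^{\mathbb T_r}(0,x)\ge \tau_\beta(0,x)+c_2\chi(\beta)r^{-d}$ for all $r\ge3$, $\beta\in[\beta_c-c_3r^{-2},\beta_c-c_4r^{-d/2}]$ and $x\in\mathbb T_r$ with $\|x\|_\infty\ge c_5$. *)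

theory Defs
  imports "HOL-Analysis.Analysis" "HOL-Number_Theory.Cong"
begin

type_synonym 'v graph = "'v set \<times> 'v set set"

text \<open>Edges are two-element sets, so \<open>\<Prod>x\<in>e. \<sigma> x\<close> is the product of the spins at the two
  ends of \<open>e\<close>. Configurations are extensional functions, so that there are finitely many.\<close>

definition ising_configs :: "'v graph \<Rightarrow> ('v \<Rightarrow> real) set" where
  "ising_configs G = fst G \<rightarrow>\<^sub>E {-1, 1}"

definition ising_weight :: "'v graph \<Rightarrow> real \<Rightarrow> ('v \<Rightarrow> real) \<Rightarrow> real" where
  "ising_weight G \<beta> \<sigma> = exp (\<beta> * (\<Sum>e\<in>snd G. \<Prod>x\<in>e. \<sigma> x))"

definition ising_expectation :: "'v graph \<Rightarrow> real \<Rightarrow> (('v \<Rightarrow> real) \<Rightarrow> real) \<Rightarrow> real" where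
  "ising_expectation G \<beta> F =
     (\<Sum>\<sigma>\<in>ising_configs G. F \<sigma> * ising_weight G \<beta> \<sigma>) / (\<Sum>\<sigma>\<in>ising_configs G. ising_weight G \<beta> \<sigma>)"

definition two_point :: "'v graph \<Rightarrow> real \<Rightarrow> 'v \<Rightarrow> 'v \<Rightarrow> real" where
  "two_point G \<beta> x y = ising_expectation G \<beta> (\<lambda>\<sigma>. \<sigma> x * \<sigma> y)"

text \<open>The lattice \<open>\<int>\<^sup>d\<close> is \<open>int ^ 'd\<close> with \<open>d = CARD('d)\<close>.\<close>

definition nearest_neighbours :: "int ^ 'd::finite \<Rightarrow> int ^ 'd \<Rightarrow> bool" where
  "nearest_neighbours x y \<longleftrightarrow> (\<Sum>i\<in>UNIV. \<bar>x $ i - y $ i\<bar>) = 1"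

definition sup_norm :: "int ^ 'd::finite \<Rightarrow> real" where
  "sup_norm x = (MAX i. \<bar>real_of_int (x $ i)\<bar>)"

definition box_points :: "nat \<Rightarrow> (int ^ 'd::finite) set" where
  "box_points r = {x. \<forall>i. - (real r / 2) \<le> real_of_int (x $ i) \<and> real_of_int (x $ i) < real r / 2}"

definition box :: "nat \<Rightarrow> (int ^ 'd::finite) graph" where
  "box r = (box_points r,
     {{x, y} | x y. x \<in> box_points r \<and> y \<in> box_points r \<and> nearest_neighbours x y})"

text \<open>The vertices of \<open>(\<int>/r\<int>)\<^sup>d\<close> are represented by their representatives in the box;
  two classes are adjacent if they have representatives in \<open>\<int>\<^sup>d\<close> that are nearest neighbours.\<close>

definition torus :: "nat \<Rightarrow> (int ^ 'd::finite) graph" where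
  "torus r = (box_points r,
     {{x, y} | x y. x \<in> box_points r \<and> y \<in> box_points r \<and>
        (\<exists>z. nearest_neighbours x z \<and> (\<forall>i. [z $ i = y $ i] (mod int r)))})"

text \<open>For the finitely many \<open>r\<close> with \<open>x\<close> or \<open>y\<close> outside the box the term of the sequence is a
  junk value, which does not affect the limit.\<close>

definition tau :: "real \<Rightarrow> int ^ 'd::finite \<Rightarrow> int ^ 'd \<Rightarrow> real" where
  "tau \<beta> x y = lim (\<lambda>r. two_point (box r) \<beta> x y)"

definition chi :: "'d::finite itself \<Rightarrow> real \<Rightarrow> ennreal" where
  "chi (D :: 'd itself) \<beta> = (\<Sum>\<^sub>\<infinity>x\<in>(UNIV :: (int ^ 'd) set). ennreal (tau \<beta> 0 x))"

text \<open>The supremum is taken in \<open>[0, \<infinity>]\<close>, as a real supremum would be unspecified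
  if the set were empty or unbounded.\<close>

definition critical_point :: "'d::finite itself \<Rightarrow> ennreal" where
  "critical_point D = (SUP \<beta>\<in>{\<beta>. 0 < \<beta> \<and> chi D \<beta> < \<infinity>}. ennreal \<beta>)"

definition beta_c :: "'d::finite itself \<Rightarrow> real" where
  "beta_c D = enn2real (critical_point D)"

definition magnetization :: "nat \<Rightarrow> (int ^ 'd::finite \<Rightarrow> real) \<Rightarrow> real" where
  "magnetization r \<sigma> = (\<Sum>x\<in>fst (torus r). \<sigma> x) / real r ^ CARD('d)"

definition magnetization_moment :: "'d::finite itself \<Rightarrow> nat \<Rightarrow> real \<Rightarrow> nat \<Rightarrow> real" where
  "magnetization_moment (D :: 'd itself) r \<beta> k =
     ising_expectation (torus r :: (int ^ 'd) graph) \<beta> (\<lambda>\<sigma>. magnetization r \<sigma> ^ k)"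

definition renormalized_coupling :: "'d::finite itself \<Rightarrow> nat \<Rightarrow> real \<Rightarrow> real" where
  "renormalized_coupling D r \<beta> =
     - ((magnetization_moment D r \<beta> 4 - 3 * (magnetization_moment D r \<beta> 2)\<^sup>2)
        / (magnetization_moment D r \<beta> 2)\<^sup>2)"

definition beta_star :: "'d::finite itself \<Rightarrow> real \<Rightarrow> nat \<Rightarrow> real" where
  "beta_star (D :: 'd itself) c r = beta_c D - c * real r powr (- (real CARD('d) / 2))"

text \<open>The bound on the susceptibility is stated in \<open>[0, \<infinity>]\<close>. Together with
  \<open>\<tau>\<^sub>\<beta>(0, 0) = 1\<close>, its upper half makes the critical point finite.\<close>

definition susceptibility_bounds :: "'d::finite itself \<Rightarrow> bool" where
  "susceptibility_bounds D \<longleftrightarrow>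
     (\<exists>a>0. \<exists>A>0. \<forall>\<beta>>0. ennreal \<beta> < critical_point D \<longrightarrow>
        ennreal a / (critical_point D - ennreal \<beta>) \<le> chi D \<beta> \<and>
        chi D \<beta> \<le> ennreal A / (critical_point D - ennreal \<beta>))"

definition tau_upper_bound :: "'d::finite itself \<Rightarrow> real \<Rightarrow> real \<Rightarrow> bool" where
  "tau_upper_bound (D :: 'd itself) c\<^sub>0 C\<^sub>0 \<longleftrightarrow>
     (\<forall>\<beta> (x :: int ^ 'd). 0 < \<beta> \<and> \<beta> \<le> beta_c D \<longrightarrow>
        tau \<beta> 0 x \<le> C\<^sub>0 / max 1 (sup_norm x) ^ (CARD('d) - 2)
                      * exp (- c\<^sub>0 * sqrt (beta_c D - \<beta>) * sup_norm x))"

text \<open>The condition \<open>\<parallel>x\<parallel> \<le> c\<^sub>0 (\<beta>\<^sub>c - \<beta>)\<^sup>-\<^sup>1\<^sup>/\<^sup>2\<close> is multiplied out, because at \<open>\<beta> = \<beta>\<^sub>c\<close> its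
  right-hand side is to be read as \<open>\<infinity>\<close>.\<close>

definition tau_lower_bound :: "'d::finite itself \<Rightarrow> real \<Rightarrow> bool" where
  "tau_lower_bound (D :: 'd itself) c\<^sub>0 \<longleftrightarrow>
     (\<forall>\<beta> (x :: int ^ 'd). 0 < \<beta> \<and> \<beta> \<le> beta_c D \<and> sup_norm x * sqrt (beta_c D - \<beta>) \<le> c\<^sub>0 \<longrightarrow>
        c\<^sub>0 / max 1 (sup_norm x) ^ (CARD('d) - 2) \<le> tau \<beta> 0 x)"

definition torus_upper_bound :: "'d::finite itself \<Rightarrow> real \<Rightarrow> bool" where
  "torus_upper_bound (D :: 'd itself) c\<^sub>1 \<longleftrightarrow>
     (\<forall>r\<ge>3. \<forall>\<beta>. 0 < \<beta> \<and> \<beta> < beta_c D \<longrightarrow>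
        (\<forall>x\<in>fst (torus r :: (int ^ 'd) graph).
           two_point (torus r) \<beta> 0 x \<le> tau \<beta> 0 x + c\<^sub>1 * enn2real (chi D \<beta>) / real r ^ CARD('d)))"

definition torus_lower_bound ::
    "'d::finite itself \<Rightarrow> real \<Rightarrow> real \<Rightarrow> real \<Rightarrow> real \<Rightarrow> bool" where
  "torus_lower_bound (D :: 'd itself) c\<^sub>2 c\<^sub>3 c\<^sub>4 c\<^sub>5 \<longleftrightarrow>
     (\<forall>r\<ge>3. \<forall>\<beta>. 0 < \<beta> \<and> beta_c D - c\<^sub>3 / (real r)\<^sup>2 \<le> \<beta> \<and> \<beta> \<le> beta_star D c\<^sub>4 r \<longrightarrow>
        (\<forall>x\<in>fst (torus r :: (int ^ 'd) graph). c\<^sub>5 \<le> sup_norm x \<longrightarrow>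
           tau \<beta> 0 x + c\<^sub>2 * enn2real (chi D \<beta>) / real r ^ CARD('d) \<le> two_point (torus r) \<beta> 0 x))"

end

theory Submission imports Defs
begin

text \<open>The upper bound is \<open>\<langle>S\<^sup>2\<rangle>\<^sup>2 \<le> \<langle>S\<^sup>4\<rangle>\<close>. For the lower bound write
  \<open>U(x, y, z, w)\<close> for the Ursell function. Expanding \<open>exp (\<beta> \<sigma>\<^sub>e) = 1 + (exp (\<beta> \<sigma>\<^sub>e) - 1)\<close> on each
  edge \<open>e\<close> gives a random edge set (the trace of a random current). Superposing two such
  sets, \<open>- U(x, y, z, w)\<close> is at least twice the weight of the event that the cluster of \<open>x\<close> in the
  first set, with sources \<open>x, y\<close>, meets the cluster of \<open>z\<close> in the second, with sources \<open>z, w\<close>; this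
  event is estimated by the second moment method, applied to the number of common vertices and
  summed over \<open>x, y, z, w\<close>. The second moment is controlled by
  \<open>\<langle>\<sigma>\<^sub>u \<sigma>\<^sub>v\<rangle> (\<langle>\<sigma>\<^sub>x \<sigma>\<^sub>u\<rangle> \<langle>\<sigma>\<^sub>v \<sigma>\<^sub>y\<rangle> + \<langle>\<sigma>\<^sub>x \<sigma>\<^sub>v\<rangle> \<langle>\<sigma>\<^sub>u \<sigma>\<^sub>y\<rangle>)\<close>, hence by the bubble diagram, which is bounded for
  \<open>d > 4\<close> in spite of the plateau. For the first moment, the probability that the cluster passes
  through \<open>u\<close> is compared, by a local modification between \<open>u\<close> and a vertex \<open>v\<close> at a fixed distance, with
  the truncated correlation of \<open>\<sigma>\<^sub>x \<sigma>\<^sub>y\<close> and \<open>\<sigma>\<^sub>u \<sigma>\<^sub>v\<close>. After summation over \<open>x\<close> and \<open>y\<close> the latter is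
  at least \<open>\<chi>(\<beta>) \<chi>(\<beta>') (1 - \<Sum>\<^sub>w \<langle>\<sigma>\<^sub>u \<sigma>\<^sub>w\<rangle>\<^sub>\<beta> \<langle>\<sigma>\<^sub>w \<sigma>\<^sub>v\<rangle>\<^sub>\<beta>\<^sub>')\<close> for every \<open>\<beta>' \<le> \<beta>\<close>. With
  \<open>\<beta>' = \<beta>\<^sub>c - K c\<^sub>4 r\<^sup>-\<^sup>d\<^sup>/\<^sup>2\<close> and \<open>K\<close> and the distance of \<open>u\<close> and \<open>v\<close> large, the sum is at most \<open>1/2\<close>,
  while \<open>\<chi>(\<beta>')\<close> is still of order \<open>r\<^sup>d\<^sup>/\<^sup>2\<close>. This gives \<open>- \<Sum> U \<ge> c r\<^sup>3\<^sup>d\<close>.\<close>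

text \<open>The bound for \<open>- U\<close> concerns two separate traces, and only their
  independence turns the moments of the number of common vertices into sums of squares. The exact
  switching identities hold instead for the union of two traces, whose clusters are larger than
  those of one trace. For upper bounds (two visited vertices) a sourceless trace may be added at no
  cost; for the lower bound (one visited vertex) this goes in the wrong direction, and the local
  modification takes its place. The second obstacle is the plateau, of height of order r^(-d/2).
  With \<beta>' = \<beta> the subtracted sum over w would contain r^d times the square of this
  height, a constant that no distance between u and v makes small. Lowering one of the temperatures
  reduces the bound on this constant by the factor K, while the susceptibility stays of the same
  order in r. Infinite sums over currents do not occur: an edge set with its
  \<open>trace_weight\<close> stands for all currents with this trace, and the parity of sources
  becomes oddness under flipping all spins of a cluster. The target r^(3d) is the order of (r^d
  \<chi>)^2, the squared second moment of the total spin.\<close>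

section \<open>Ising model on a finite graph with edge-dependent couplings\<close>

locale ising_graph =
  fixes V :: "'v set" and E :: "'v set set"
  assumes finite_V: "finite V"
    and edge: "e \<in> E \<Longrightarrow> e \<subseteq> V \<and> card e = 2"
begin

abbreviation conf :: "('v \<Rightarrow> real) set" where
  "conf \<equiv> ising_configs (V, E)"

text \<open>Couplings vary from edge to edge so that deleting edges or vertices, weakening the
  interaction and twisting it by signs all stay on one graph with one set of configurations.\<close>

definition part :: "('v set \<Rightarrow> real) \<Rightarrow> (('v \<Rightarrow> real) \<Rightarrow> real) \<Rightarrow> real" where
  "part J f = (\<Sum>\<sigma>\<in>conf. f \<sigma> * exp (\<Sum>e\<in>E. J e * prod \<sigma> e))"

abbreviation Z :: "('v set \<Rightarrow> real) \<Rightarrow> real" where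
  "Z J \<equiv> part J (\<lambda>_. 1)"

definition ev :: "('v set \<Rightarrow> real) \<Rightarrow> (('v \<Rightarrow> real) \<Rightarrow> real) \<Rightarrow> real" where
  "ev J f = part J f / Z J"

abbreviation tp :: "('v set \<Rightarrow> real) \<Rightarrow> 'v \<Rightarrow> 'v \<Rightarrow> real" where
  "tp J x y \<equiv> ev J (\<lambda>\<sigma>. \<sigma> x * \<sigma> y)"

abbreviation fp :: "('v set \<Rightarrow> real) \<Rightarrow> 'v \<Rightarrow> 'v \<Rightarrow> 'v \<Rightarrow> 'v \<Rightarrow> real" where
  "fp J x y z w \<equiv> ev J (\<lambda>\<sigma>. \<sigma> x * \<sigma> y * \<sigma> z * \<sigma> w)"

lemma conf_def: "conf = V \<rightarrow>\<^sub>E {-1, 1}"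
  by (simp add: ising_configs_def)

lemma finite_E: "finite E"
  by (rule finite_subset[of _ "Pow V"]) (use edge finite_V in auto)

lemma finite_conf: "finite conf"
  unfolding conf_def by (intro finite_PiE finite_V) auto

lemma conf_values: "\<sigma> \<in> conf \<Longrightarrow> x \<in> V \<Longrightarrow> \<sigma> x = -1 \<or> \<sigma> x = 1"
  unfolding conf_def by auto

lemma spin_square: "\<sigma> \<in> conf \<Longrightarrow> x \<in> V \<Longrightarrow> \<sigma> x * \<sigma> x = 1"
  using conf_values by fastforce

lemma spin_square_left: "\<sigma> \<in> conf \<Longrightarrow> x \<in> V \<Longrightarrow> \<sigma> x * (\<sigma> x * c) = c"
  by (metis mult.assoc mult_1 spin_square)

lemma conf_nonempty: "conf \<noteq> {}"
  unfolding conf_def by (auto simp: PiE_eq_empty_iff)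

lemma edge_cases:
  assumes "e \<in> E"
  obtains a b where "a \<in> V" "b \<in> V" "a \<noteq> b" "e = {a, b}"
proof -
  from edge[OF assms] obtain a b where "e = {a, b}" "a \<noteq> b" "e \<subseteq> V"
    by (auto simp: card_2_iff)
  then show thesis by (intro that[of a b]) auto
qed

lemma edge_values:
  assumes "\<sigma> \<in> conf" "e \<in> E"
  shows "prod \<sigma> e = -1 \<or> prod \<sigma> e = 1"
proof -
  obtain a b where "a \<in> V" "b \<in> V" "a \<noteq> b" "e = {a, b}"
    using assms(2) by (rule edge_cases)
  then show ?thesis
    using conf_values[OF assms(1), of a] conf_values[OF assms(1), of b] by auto
qed

lemma exp_edge:
  assumes "\<sigma> \<in> conf" "e \<in> E"
  shows "exp (a * prod \<sigma> e) = cosh a + sinh a * prod \<sigma> e"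
  using edge_values[OF assms] by (auto simp: cosh_plus_sinh cosh_minus_sinh)

lemma exp_edges:
  assumes "\<sigma> \<in> conf" "F \<subseteq> E"
  shows "exp (\<Sum>e\<in>F. J e * prod \<sigma> e) = (\<Prod>e\<in>F. cosh (J e) + sinh (J e) * prod \<sigma> e)"
  using assms finite_subset[OF assms(2) finite_E]
  by (simp add: exp_sum) (intro prod.cong refl exp_edge, auto)

subsection \<open>Griffiths inequalities\<close>

text \<open>All monomials are tested, not only the constant, so that multiplying by a spin, which
  shifts an exponent, preserves the property.\<close>

definition nonneg_moments :: "(('v \<Rightarrow> real) \<Rightarrow> real) \<Rightarrow> bool" where
  "nonneg_moments f \<longleftrightarrow> (\<forall>k :: 'v \<Rightarrow> nat. 0 \<le> (\<Sum>\<sigma>\<in>conf. f \<sigma> * (\<Prod>x\<in>V. \<sigma> x ^ k x)))"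

text \<open>A function is positive if it is a polynomial with nonnegative coefficients in the spins;
  phrasing this as a multiplier property makes the closure properties immediate.\<close>

definition positive :: "(('v \<Rightarrow> real) \<Rightarrow> real) \<Rightarrow> bool" where
  "positive f \<longleftrightarrow> (\<forall>h. nonneg_moments h \<longrightarrow> nonneg_moments (\<lambda>\<sigma>. f \<sigma> * h \<sigma>))"

lemma nonneg_moments_cong:
  "(\<And>\<sigma>. \<sigma> \<in> conf \<Longrightarrow> f \<sigma> = g \<sigma>) \<Longrightarrow> nonneg_moments f = nonneg_moments g"
  unfolding nonneg_moments_def by (simp cong: sum.cong)

lemma positive_cong:
  assumes "\<And>\<sigma>. \<sigma> \<in> conf \<Longrightarrow> f \<sigma> = g \<sigma>"
  shows "positive f = positive g"
proof -
  have "nonneg_moments (\<lambda>\<sigma>. f \<sigma> * h \<sigma>) = nonneg_moments (\<lambda>\<sigma>. g \<sigma> * h \<sigma>)" for h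
    by (rule nonneg_moments_cong) (simp add: assms)
  then show ?thesis by (simp add: positive_def)
qed

lemma nonneg_moments_1: "nonneg_moments (\<lambda>_. 1)"
proof -
  have "0 \<le> (\<Sum>\<sigma>\<in>conf. 1 * (\<Prod>x\<in>V. \<sigma> x ^ k x))" for k :: "'v \<Rightarrow> nat"
  proof -
    have "(\<Sum>\<sigma>\<in>conf. 1 * (\<Prod>x\<in>V. \<sigma> x ^ k x)) = (\<Prod>x\<in>V. \<Sum>s\<in>{-1, 1::real}. s ^ k x)"
      unfolding conf_def by (subst prod_sum_PiE) (use finite_V in auto)
    also have "\<dots> \<ge> 0"
    proof (intro prod_nonneg ballI)
      fix x show "0 \<le> (\<Sum>s\<in>{-1, 1::real}. s ^ k x)"
        by (cases "even (k x)") auto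
    qed
    finally show ?thesis .
  qed
  then show ?thesis by (simp add: nonneg_moments_def)
qed

lemma positive_sum_nonneg:
  assumes "positive f"
  shows "0 \<le> (\<Sum>\<sigma>\<in>conf. f \<sigma>)"
proof -
  have "nonneg_moments (\<lambda>\<sigma>. f \<sigma> * 1)"
    using assms nonneg_moments_1 by (simp only: positive_def)
  from this[unfolded nonneg_moments_def, rule_format, of "\<lambda>_. 0"] show ?thesis by simp
qed

lemma positive_const: "0 \<le> c \<Longrightarrow> positive (\<lambda>_. c)"
  by (simp add: positive_def nonneg_moments_def mult.assoc flip: sum_distrib_left)

lemma positive_spin:
  assumes "x \<in> V" shows "positive (\<lambda>\<sigma>. \<sigma> x)"
  unfolding positive_def nonneg_moments_def
proof (intro allI impI)
  fix h and k :: "'v \<Rightarrow> nat"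
  assume h: "\<forall>k. 0 \<le> (\<Sum>\<sigma>\<in>conf. h \<sigma> * (\<Prod>x\<in>V. \<sigma> x ^ k x))"
  have "\<sigma> x * h \<sigma> * (\<Prod>y\<in>V. \<sigma> y ^ k y) = h \<sigma> * (\<Prod>y\<in>V. \<sigma> y ^ (k(x := Suc (k x))) y)"
    for \<sigma> :: "'v \<Rightarrow> real"
  proof -
    have "(\<Prod>y\<in>V - {x}. \<sigma> y ^ (k(x := Suc (k x))) y) = (\<Prod>y\<in>V - {x}. \<sigma> y ^ k y)"
      by (rule prod.cong) auto
    then show ?thesis
      using assms finite_V by (simp add: prod.remove[of V x])
  qed
  then show "0 \<le> (\<Sum>\<sigma>\<in>conf. \<sigma> x * h \<sigma> * (\<Prod>x\<in>V. \<sigma> x ^ k x))"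
    using h[rule_format, of "k(x := Suc (k x))"] by (simp only:)
qed

lemma positive_add: "positive f \<Longrightarrow> positive g \<Longrightarrow> positive (\<lambda>\<sigma>. f \<sigma> + g \<sigma>)"
  by (simp add: positive_def nonneg_moments_def distrib_right sum.distrib)

lemma positive_mult: "positive f \<Longrightarrow> positive g \<Longrightarrow> positive (\<lambda>\<sigma>. f \<sigma> * g \<sigma>)"
  by (simp add: positive_def mult.assoc)

lemma positive_prod:
  "finite I \<Longrightarrow> (\<And>i. i \<in> I \<Longrightarrow> positive (f i)) \<Longrightarrow> positive (\<lambda>\<sigma>. \<Prod>i\<in>I. f i \<sigma>)"
  by (induction rule: finite_induct) (auto intro: positive_mult positive_const)

lemma positive_edge:
  assumes "e \<in> E" shows "positive (\<lambda>\<sigma>. prod \<sigma> e)"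
  using assms by (elim edge_cases) (simp add: positive_mult positive_spin)

lemma positive_affine_edge:
  "e \<in> E \<Longrightarrow> 0 \<le> a \<Longrightarrow> 0 \<le> b \<Longrightarrow> positive (\<lambda>\<sigma>. a + b * prod \<sigma> e)"
  by (intro positive_add positive_mult positive_const positive_edge)

lemma positive_weight:
  assumes "\<And>e. e \<in> E \<Longrightarrow> 0 \<le> J e"
  shows "positive (\<lambda>\<sigma>. exp (\<Sum>e\<in>E. J e * prod \<sigma> e))"
proof -
  have "positive (\<lambda>\<sigma>. \<Prod>e\<in>E. cosh (J e) + sinh (J e) * prod \<sigma> e)"
    by (intro positive_prod finite_E positive_affine_edge) (use assms in auto)
  then show ?thesis by (subst positive_cong[OF exp_edges]) auto
qed

lemma part_nonneg: "positive f \<Longrightarrow> (\<And>e. e \<in> E \<Longrightarrow> 0 \<le> J e) \<Longrightarrow> 0 \<le> part J f"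
  unfolding part_def by (intro positive_sum_nonneg positive_mult positive_weight)

lemma Z_pos: "0 < Z J"
  unfolding part_def by (simp add: finite_conf conf_nonempty sum_pos)

lemma ev_nonneg: "positive f \<Longrightarrow> (\<And>e. e \<in> E \<Longrightarrow> 0 \<le> J e) \<Longrightarrow> 0 \<le> ev J f"
  unfolding ev_def by (intro divide_nonneg_pos part_nonneg Z_pos)

lemma tp_nonneg: "x \<in> V \<Longrightarrow> y \<in> V \<Longrightarrow> (\<And>e. e \<in> E \<Longrightarrow> 0 \<le> J e) \<Longrightarrow> 0 \<le> tp J x y"
  by (intro ev_nonneg positive_mult positive_spin)

lemma ev_mono:
  assumes "\<And>\<sigma>. \<sigma> \<in> conf \<Longrightarrow> f \<sigma> \<le> g \<sigma>"
  shows "ev J f \<le> ev J g"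
  unfolding ev_def part_def
  by (intro divide_right_mono sum_mono mult_right_mono sum_nonneg) (use assms in auto)

lemma ev_cong: "(\<And>\<sigma>. \<sigma> \<in> conf \<Longrightarrow> f \<sigma> = g \<sigma>) \<Longrightarrow> ev J f = ev J g"
  unfolding ev_def part_def by (simp cong: sum.cong)

lemma ev_const: "ev J (\<lambda>_. c) = c"
  using Z_pos[of J] unfolding ev_def part_def by (simp flip: sum_distrib_left)

lemma tp_le_1:
  assumes "x \<in> V" "y \<in> V"
  shows "tp J x y \<le> 1"
proof -
  have "tp J x y \<le> ev J (\<lambda>_. 1)"
  proof (rule ev_mono)
    fix \<sigma> assume "\<sigma> \<in> conf"
    then show "\<sigma> x * \<sigma> y \<le> 1"
      using conf_values[of \<sigma> x] conf_values[of \<sigma> y] assms by auto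
  qed
  then show ?thesis by (simp add: ev_const)
qed

lemma tp_same: "x \<in> V \<Longrightarrow> tp J x x = 1"
  using ev_cong[of "\<lambda>\<sigma>. \<sigma> x * \<sigma> x" "\<lambda>_. 1" J] spin_square by (simp add: ev_const)

lemma tp_commute: "tp J x y = tp J y x"
  by (simp add: mult.commute)

lemma part_add: "part J (\<lambda>\<sigma>. f \<sigma> + g \<sigma>) = part J f + part J g"
  unfolding part_def by (simp add: distrib_right sum.distrib)

lemma part_cmult: "part J (\<lambda>\<sigma>. c * f \<sigma>) = c * part J f"
  unfolding part_def by (simp add: mult.assoc sum_distrib_left)

lemma part_sum: "part J (\<lambda>\<sigma>. \<Sum>i\<in>I. f i \<sigma>) = (\<Sum>i\<in>I. part J (f i))"
  unfolding part_def by (simp add: sum_distrib_right) (rule sum.swap)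

lemma ev_cmult: "ev J (\<lambda>\<sigma>. c * f \<sigma>) = c * ev J f"
  by (simp add: ev_def part_cmult)

lemma ev_sum: "ev J (\<lambda>\<sigma>. \<Sum>i\<in>I. f i \<sigma>) = (\<Sum>i\<in>I. ev J (f i))"
  by (simp add: ev_def part_sum sum_divide_distrib)

definition pmult :: "('v \<Rightarrow> real) \<Rightarrow> ('v \<Rightarrow> real) \<Rightarrow> 'v \<Rightarrow> real" where
  "pmult \<sigma> \<theta> = (\<lambda>x\<in>V. \<sigma> x * \<theta> x)"

lemma pmult_apply: "x \<in> V \<Longrightarrow> pmult \<sigma> \<theta> x = \<sigma> x * \<theta> x"
  by (simp add: pmult_def)

lemma pmult_conf:
  assumes "\<sigma> \<in> conf" "\<theta> \<in> conf"
  shows "pmult \<sigma> \<theta> \<in> conf"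
proof -
  have "\<sigma> x * \<theta> x \<in> {-1, 1}" if "x \<in> V" for x
    using conf_values[OF assms(1) that] conf_values[OF assms(2) that] by auto
  then show ?thesis
    unfolding conf_def pmult_def by (simp add: restrict_PiE_iff)
qed

lemma pmult_edge: "e \<in> E \<Longrightarrow> prod (pmult \<sigma> \<theta>) e = prod \<sigma> e * prod \<theta> e"
  by (elim edge_cases) (simp add: pmult_apply)

lemma pmult_cancel:
  assumes "\<sigma> \<in> conf" "\<theta> \<in> conf"
  shows "pmult \<sigma> (pmult \<sigma> \<theta>) = \<theta>"
proof
  fix x
  show "pmult \<sigma> (pmult \<sigma> \<theta>) x = \<theta> x"
  proof (cases "x \<in> V")
    case True
    then show ?thesis using spin_square_left[OF assms(1)] by (simp add: pmult_apply)
  next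
    case False
    then show ?thesis using assms(2) by (simp add: pmult_def conf_def PiE_def extensional_def)
  qed
qed

lemma sum_pair_pmult:
  "(\<Sum>s\<in>conf. \<Sum>t\<in>conf. F s t) = (\<Sum>\<theta>\<in>conf. \<Sum>s\<in>conf. F s (pmult s \<theta>))"
proof -
  have "(\<Sum>s\<in>conf. \<Sum>t\<in>conf. F s t) = (\<Sum>s\<in>conf. \<Sum>\<theta>\<in>conf. F s (pmult s \<theta>))"
  proof (rule sum.cong[OF refl])
    fix s assume "s \<in> conf"
    then show "(\<Sum>t\<in>conf. F s t) = (\<Sum>\<theta>\<in>conf. F s (pmult s \<theta>))"
      by (intro sum.reindex_bij_witness[of _ "pmult s" "pmult s"]) (auto simp: pmult_conf pmult_cancel)
  qed
  also have "\<dots> = (\<Sum>\<theta>\<in>conf. \<Sum>s\<in>conf. F s (pmult s \<theta>))"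
    by (rule sum.swap)
  finally show ?thesis .
qed

text \<open>Ginibre's argument: with \<open>t = s \<theta>\<close> the couplings of \<open>s\<close> become \<open>J' + J \<theta> \<ge> 0\<close> for fixed
  \<open>\<theta>\<close>, so the first inequality applies to each \<open>\<theta>\<close> separately.\<close>

lemma tp_mono:
  assumes "x \<in> V" "y \<in> V" "\<And>e. e \<in> E \<Longrightarrow> 0 \<le> J e" "\<And>e. e \<in> E \<Longrightarrow> J e \<le> J' e"
  shows "tp J x y \<le> tp J' x y"
proof -
  have "0 \<le> (\<Sum>s\<in>conf. (s x * s y - pmult s \<theta> x * pmult s \<theta> y) *
      exp (\<Sum>e\<in>E. J' e * prod s e) * exp (\<Sum>e\<in>E. J e * prod (pmult s \<theta>) e))"
    if \<theta>: "\<theta> \<in> conf" for \<theta>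
  proof -
    have K: "0 \<le> J' e + J e * prod \<theta> e" if "e \<in> E" for e
      using edge_values[OF \<theta> that] assms(3,4)[OF that] by auto
    have c: "0 \<le> 1 - \<theta> x * \<theta> y"
      using conf_values[OF \<theta> assms(1)] conf_values[OF \<theta> assms(2)] by auto
    have "0 \<le> (\<Sum>s\<in>conf. (1 - \<theta> x * \<theta> y) * (s x * s y) *
        exp (\<Sum>e\<in>E. (J' e + J e * prod \<theta> e) * prod s e))"
      by (rule positive_sum_nonneg)
        (intro positive_mult positive_const[OF c] positive_spin assms(1,2) positive_weight; erule K)
    also have "\<dots> = (\<Sum>s\<in>conf. (s x * s y - pmult s \<theta> x * pmult s \<theta> y) *
      exp (\<Sum>e\<in>E. J' e * prod s e) * exp (\<Sum>e\<in>E. J e * prod (pmult s \<theta>) e))"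
    proof (intro sum.cong refl)
      fix s
      have "(\<Sum>e\<in>E. (J' e + J e * prod \<theta> e) * prod s e) =
          (\<Sum>e\<in>E. J' e * prod s e) + (\<Sum>e\<in>E. J e * prod (pmult s \<theta>) e)"
        unfolding sum.distrib[symmetric]
        by (intro sum.cong refl) (simp add: pmult_edge algebra_simps)
      then show "(1 - \<theta> x * \<theta> y) * (s x * s y) * exp (\<Sum>e\<in>E. (J' e + J e * prod \<theta> e) * prod s e) =
          (s x * s y - pmult s \<theta> x * pmult s \<theta> y) *
          exp (\<Sum>e\<in>E. J' e * prod s e) * exp (\<Sum>e\<in>E. J e * prod (pmult s \<theta>) e)"
        using assms(1,2) by (simp add: exp_add pmult_apply algebra_simps)
    qed
    finally show ?thesis .
  qed
  then have "0 \<le> (\<Sum>s\<in>conf. \<Sum>t\<in>conf. (s x * s y - t x * t y) *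
      exp (\<Sum>e\<in>E. J' e * prod s e) * exp (\<Sum>e\<in>E. J e * prod t e))"
    by (subst sum_pair_pmult) (rule sum_nonneg)
  also have "\<dots> = part J' (\<lambda>\<sigma>. \<sigma> x * \<sigma> y) * Z J - Z J' * part J (\<lambda>\<sigma>. \<sigma> x * \<sigma> y)"
    by (simp only: part_def sum_product flip: sum_subtractf)
      (intro sum.cong refl, simp add: algebra_simps)
  finally show ?thesis
    using Z_pos[of J] Z_pos[of J'] unfolding ev_def by (simp add: field_simps)
qed

section \<open>Domination of coefficients and monotonicity of the partition function\<close>

text \<open>Read as a bound on the coefficients of \<open>f\<close> in absolute value by those of
  \<open>g\<close>, this compares weights whose couplings may be negative.\<close>

definition dominated :: "(('v \<Rightarrow> real) \<Rightarrow> real) \<Rightarrow> (('v \<Rightarrow> real) \<Rightarrow> real) \<Rightarrow> bool" where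
  "dominated f g \<longleftrightarrow> positive (\<lambda>\<sigma>. g \<sigma> - f \<sigma>) \<and> positive (\<lambda>\<sigma>. g \<sigma> + f \<sigma>)"

text \<open>Twice gg' - ff' is (g - f)(g' + f') + (g + f)(g' - f'), and twice gg' + ff' is (g -
  f)(g' - f') + (g + f)(g' + f').\<close>

lemma dominated_mult:
  assumes "dominated f g" "dominated f' g'"
  shows "dominated (\<lambda>\<sigma>. f \<sigma> * f' \<sigma>) (\<lambda>\<sigma>. g \<sigma> * g' \<sigma>)"
proof -
  note p = assms(1)[unfolded dominated_def] and q = assms(2)[unfolded dominated_def]
  note prods = positive_mult[OF p[THEN conjunct1] q[THEN conjunct1]]
    positive_mult[OF p[THEN conjunct1] q[THEN conjunct2]]
    positive_mult[OF p[THEN conjunct2] q[THEN conjunct1]]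
    positive_mult[OF p[THEN conjunct2] q[THEN conjunct2]]
  have half: "positive (\<lambda>_. 1 / 2)" by (simp add: positive_const)
  show ?thesis
    using positive_mult[OF half positive_add[OF prods(2,3)]] positive_mult[OF half positive_add[OF prods(1,4)]]
    unfolding dominated_def by (simp add: algebra_simps)
qed

lemma dominated_prod:
  "finite I \<Longrightarrow> (\<And>i. i \<in> I \<Longrightarrow> dominated (f i) (g i)) \<Longrightarrow>
    dominated (\<lambda>\<sigma>. \<Prod>i\<in>I. f i \<sigma>) (\<lambda>\<sigma>. \<Prod>i\<in>I. g i \<sigma>)"
proof (induction rule: finite_induct)
  case empty
  then show ?case by (simp add: dominated_def positive_const)
next
  case (insert i I)
  then show ?case by (simp add: dominated_mult)
qed

lemma dominated_affine_edge:
  assumes "e \<in> E" "\<bar>a\<bar> \<le> a'" "\<bar>b\<bar> \<le> b'"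
  shows "dominated (\<lambda>\<sigma>. a + b * prod \<sigma> e) (\<lambda>\<sigma>. a' + b' * prod \<sigma> e)"
proof -
  have "positive (\<lambda>\<sigma>. (a' - a) + (b' - b) * prod \<sigma> e)" "positive (\<lambda>\<sigma>. (a' + a) + (b' + b) * prod \<sigma> e)"
    by (rule positive_affine_edge; use assms in linarith)+
  then show ?thesis by (simp add: dominated_def algebra_simps)
qed

text \<open>Each factor is cosh J + sinh J times the edge spin, and |J| \<le> J' gives cosh J \<le>
  cosh J' and |sinh J| \<le> sinh J'.\<close>

lemma dominated_weight:
  assumes "\<And>e. e \<in> E \<Longrightarrow> \<bar>J e\<bar> \<le> J' e"
  shows "dominated (\<lambda>\<sigma>. exp (\<Sum>e\<in>E. J e * prod \<sigma> e)) (\<lambda>\<sigma>. exp (\<Sum>e\<in>E. J' e * prod \<sigma> e))"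
proof -
  have *: "cosh (J e) \<le> cosh (J' e) \<and> \<bar>sinh (J e)\<bar> \<le> sinh (J' e)" if "e \<in> E" for e
    using assms[OF that] cosh_real_nonneg_le_iff[of "\<bar>J e\<bar>" "J' e"] sinh_real_le_iff[of "\<bar>J e\<bar>" "J' e"]
    by (simp add: cosh_real_abs sinh_real_abs)
  have "dominated (\<lambda>\<sigma>. \<Prod>e\<in>E. cosh (J e) + sinh (J e) * prod \<sigma> e)
      (\<lambda>\<sigma>. \<Prod>e\<in>E. cosh (J' e) + sinh (J' e) * prod \<sigma> e)"
    by (intro dominated_prod finite_E dominated_affine_edge) (use * in auto)
  then show ?thesis
    unfolding dominated_def by (subst (asm) (1 2) positive_cong[OF arg_cong2[OF exp_edges exp_edges], symmetric]) auto
qed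

lemma Z_mono:
  assumes "\<And>e. e \<in> E \<Longrightarrow> \<bar>J e\<bar> \<le> J' e"
  shows "Z J \<le> Z J'"
  using positive_sum_nonneg[OF dominated_weight[OF assms, unfolded dominated_def, THEN conjunct1]]
  by (simp add: part_def sum_subtractf)

text \<open>Equivalently, the ratio of the partition functions with and without \<open>D\<close>
  increases with \<open>J\<close>. In the duplicated system with t = s \<theta> the difference of
  the two factors with \<open>D\<close> is a positive function of s, because the couplings D
  \<theta> are dominated by D; the remaining couplings J' + J \<theta> are nonnegative.\<close>

lemma Z_supermodular:
  assumes "\<And>e. e \<in> E \<Longrightarrow> 0 \<le> J e" "\<And>e. e \<in> E \<Longrightarrow> J e \<le> J' e" "\<And>e. e \<in> E \<Longrightarrow> 0 \<le> D e"
  shows "Z (\<lambda>e. J e + D e) * Z J' \<le> Z (\<lambda>e. J' e + D e) * Z J"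
proof -
  have "0 \<le> (\<Sum>s\<in>conf. exp (\<Sum>e\<in>E. J' e * prod s e) * exp (\<Sum>e\<in>E. J e * prod (pmult s \<theta>) e) *
      (exp (\<Sum>e\<in>E. D e * prod s e) - exp (\<Sum>e\<in>E. D e * prod (pmult s \<theta>) e)))"
    if \<theta>: "\<theta> \<in> conf" for \<theta>
  proof -
    have K: "0 \<le> J' e + J e * prod \<theta> e" if "e \<in> E" for e
      using edge_values[OF \<theta> that] assms(1,2)[OF that] by auto
    have D: "dominated (\<lambda>s. exp (\<Sum>e\<in>E. D e * prod \<theta> e * prod s e)) (\<lambda>s. exp (\<Sum>e\<in>E. D e * prod s e))"
      by (rule dominated_weight) (use edge_values[OF \<theta>] assms(3) in force)
    have "0 \<le> (\<Sum>s\<in>conf. exp (\<Sum>e\<in>E. (J' e + J e * prod \<theta> e) * prod s e) *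
      (exp (\<Sum>e\<in>E. D e * prod s e) - exp (\<Sum>e\<in>E. D e * prod \<theta> e * prod s e)))"
      by (rule positive_sum_nonneg)
        (intro positive_mult D[unfolded dominated_def, THEN conjunct1] positive_weight; erule K)
    also have "\<dots> = (\<Sum>s\<in>conf. exp (\<Sum>e\<in>E. J' e * prod s e) * exp (\<Sum>e\<in>E. J e * prod (pmult s \<theta>) e) *
      (exp (\<Sum>e\<in>E. D e * prod s e) - exp (\<Sum>e\<in>E. D e * prod (pmult s \<theta>) e)))"
    proof (intro sum.cong refl)
      fix s
      have "(\<Sum>e\<in>E. (J' e + J e * prod \<theta> e) * prod s e) =
          (\<Sum>e\<in>E. J' e * prod s e) + (\<Sum>e\<in>E. J e * prod (pmult s \<theta>) e)"
        unfolding sum.distrib[symmetric]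
        by (intro sum.cong refl) (simp add: pmult_edge algebra_simps)
      moreover have "(\<Sum>e\<in>E. D e * prod \<theta> e * prod s e) = (\<Sum>e\<in>E. D e * prod (pmult s \<theta>) e)"
        by (intro sum.cong refl) (simp add: pmult_edge algebra_simps)
      ultimately show "exp (\<Sum>e\<in>E. (J' e + J e * prod \<theta> e) * prod s e) *
          (exp (\<Sum>e\<in>E. D e * prod s e) - exp (\<Sum>e\<in>E. D e * prod \<theta> e * prod s e)) =
          exp (\<Sum>e\<in>E. J' e * prod s e) * exp (\<Sum>e\<in>E. J e * prod (pmult s \<theta>) e) *
          (exp (\<Sum>e\<in>E. D e * prod s e) - exp (\<Sum>e\<in>E. D e * prod (pmult s \<theta>) e))"
        by (simp add: exp_add)
    qed
    finally show ?thesis .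
  qed
  then have "0 \<le> (\<Sum>s\<in>conf. \<Sum>t\<in>conf. exp (\<Sum>e\<in>E. J' e * prod s e) * exp (\<Sum>e\<in>E. J e * prod t e) *
      (exp (\<Sum>e\<in>E. D e * prod s e) - exp (\<Sum>e\<in>E. D e * prod t e)))"
    by (subst sum_pair_pmult) (rule sum_nonneg)
  also have "\<dots> = Z (\<lambda>e. J' e + D e) * Z J - Z J' * Z (\<lambda>e. J e + D e)"
    by (simp only: part_def sum_product flip: sum_subtractf)
      (intro sum.cong refl, simp add: distrib_right sum.distrib exp_add algebra_simps)
  finally show ?thesis by (simp add: mult.commute)
qed

end

section \<open>Superposition of two edge sets, and clusters\<close>

lemma sum_Pow_insert:
  fixes F :: "'a set \<Rightarrow> real"
  assumes "finite A" "x \<notin> A"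
  shows "(\<Sum>X\<in>Pow (insert x A). F X) = (\<Sum>X\<in>Pow A. F X) + (\<Sum>X\<in>Pow A. F (insert x X))"
proof -
  have "inj_on (insert x) (Pow A)"
    using assms(2) by (intro inj_onI) (metis PowD insert_ident subsetD)
  moreover have "Pow A \<inter> insert x ` Pow A = {}"
    using assms(2) by auto
  ultimately show ?thesis
    using assms(1) by (simp add: Pow_insert sum.union_disjoint sum.reindex)
qed

text \<open>The factor of an edge expands to \<open>a e + b e + a e * b e\<close>: an edge of the
  union belongs to the first set only, to the second only, or to both.\<close>

lemma sum_union_weights:
  fixes a b :: "'a \<Rightarrow> real" and c :: "'a set \<Rightarrow> real"
  assumes "finite A"
  shows "(\<Sum>X\<in>Pow A. c X * (\<Prod>e\<in>X. (1 + a e) * (1 + b e) - 1)) =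
    (\<Sum>X\<in>Pow A. \<Sum>Y\<in>Pow A. c (X \<union> Y) * (prod a X * prod b Y))"
  using assms
proof (induction arbitrary: c rule: finite_induct)
  case empty
  then show ?case by simp
next
  case (insert e A)
  let ?g = "\<lambda>e. (1 + a e) * (1 + b e) - 1"
  let ?S = "\<lambda>c. \<Sum>X\<in>Pow A. c X * (\<Prod>e\<in>X. ?g e)"
  let ?R = "\<lambda>c :: 'a set \<Rightarrow> real. \<Sum>X\<in>Pow A. \<Sum>Y\<in>Pow A. c (X \<union> Y) * (prod a X * prod b Y)"
  let ?c' = "\<lambda>X. c (insert e X)"
  have p: "prod f (insert e X) = f e * prod f X" if "X \<subseteq> A" for X and f :: "'a \<Rightarrow> real"
  proof -
    have "e \<notin> X" "finite X"
      using that insert.hyps finite_subset[of X A] by auto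
    then show ?thesis by simp
  qed
  have "(\<Sum>X\<in>Pow (insert e A). c X * (\<Prod>e\<in>X. ?g e)) = ?S c + ?g e * ?S ?c'"
    unfolding sum_Pow_insert[OF insert.hyps] sum_distrib_left
    by (intro arg_cong2[where f = "(+)"] refl sum.cong) (simp add: p mult_ac)
  also have "\<dots> = ?R c + (a e + b e + a e * b e) * ?R ?c'"
    by (simp only: insert.IH[of c] insert.IH[of ?c']) (simp add: algebra_simps)
  also have "\<dots> = (\<Sum>X\<in>Pow A. \<Sum>Y\<in>Pow A. c (X \<union> Y) * (prod a X * prod b Y)
      + a e * (?c' (X \<union> Y) * (prod a X * prod b Y)) + b e * (?c' (X \<union> Y) * (prod a X * prod b Y))
      + a e * b e * (?c' (X \<union> Y) * (prod a X * prod b Y)))"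
    by (simp add: sum.distrib sum_distrib_left algebra_simps)
  also have "\<dots> = (\<Sum>X\<in>Pow A. \<Sum>Y\<in>Pow A. c (X \<union> Y) * (prod a X * prod b Y)
      + c (insert e X \<union> Y) * (prod a (insert e X) * prod b Y)
      + c (X \<union> insert e Y) * (prod a X * prod b (insert e Y))
      + c (insert e X \<union> insert e Y) * (prod a (insert e X) * prod b (insert e Y)))"
    by (intro sum.cong refl) (simp add: p algebra_simps)
  also have "\<dots> = (\<Sum>X\<in>Pow (insert e A). \<Sum>Y\<in>Pow (insert e A). c (X \<union> Y) * (prod a X * prod b Y))"
    by (simp add: sum_Pow_insert[OF insert.hyps] sum.distrib)
  finally show ?case .
qed

definition cluster :: "'v set set \<Rightarrow> 'v \<Rightarrow> 'v set" where
  "cluster \<omega> x = {y. (\<lambda>a b. {a, b} \<in> \<omega>)\<^sup>*\<^sup>* x y}"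

lemma cluster_refl: "x \<in> cluster \<omega> x"
  by (simp add: cluster_def)

lemma cluster_sym: "y \<in> cluster \<omega> x \<Longrightarrow> x \<in> cluster \<omega> y"
proof -
  have "symp (\<lambda>a b. {a, b} \<in> \<omega>)" by (auto intro: sympI simp: insert_commute)
  then have "symp (\<lambda>a b. {a, b} \<in> \<omega>)\<^sup>*\<^sup>*" by (rule symp_rtranclp)
  then show "y \<in> cluster \<omega> x \<Longrightarrow> x \<in> cluster \<omega> y" by (auto simp: cluster_def dest: sympD)
qed

lemma cluster_trans: "y \<in> cluster \<omega> x \<Longrightarrow> z \<in> cluster \<omega> y \<Longrightarrow> z \<in> cluster \<omega> x"
  by (auto simp: cluster_def)

lemma cluster_eq: "y \<in> cluster \<omega> x \<Longrightarrow> cluster \<omega> y = cluster \<omega> x"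
  using cluster_trans[of y \<omega> x] cluster_trans[of x \<omega> y] cluster_sym[of y \<omega> x] by auto

lemma cluster_mono: "\<omega> \<subseteq> \<omega>' \<Longrightarrow> cluster \<omega> x \<subseteq> cluster \<omega>' x"
  unfolding cluster_def by (auto elim: rtranclp_mono[THEN predicate2D, rotated])

lemma cluster_edge: "{a, b} \<in> \<omega> \<Longrightarrow> b \<in> cluster \<omega> a"
  by (auto simp: cluster_def)

context ising_graph
begin

subsection \<open>Expansion in traces of currents\<close>

text \<open>For a product \<open>f\<close> of spins, expanding each factor in powers of
  \<open>J e\<close> gives 2^|V| times the total weight of the currents that are positive exactly on
  \<omega> and have the spins of \<open>f\<close>, counted modulo 2, as sources.\<close>

definition trace_weight :: "('v set \<Rightarrow> real) \<Rightarrow> (('v \<Rightarrow> real) \<Rightarrow> real) \<Rightarrow> 'v set set \<Rightarrow> real" where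
  "trace_weight J f \<omega> = (\<Sum>\<sigma>\<in>conf. f \<sigma> * (\<Prod>e\<in>\<omega>. exp (J e * prod \<sigma> e) - 1))"

text \<open>Here \<omega> is the trace of the sum of two currents, one for each spin configuration;
  the factor of an edge also covers the case that only one of the two currents uses it.\<close>

definition double_weight ::
    "('v set \<Rightarrow> real) \<Rightarrow> (('v \<Rightarrow> real) \<Rightarrow> ('v \<Rightarrow> real) \<Rightarrow> real) \<Rightarrow> 'v set set \<Rightarrow> real" where
  "double_weight J f \<omega> =
     (\<Sum>s\<in>conf. \<Sum>t\<in>conf. f s t * (\<Prod>e\<in>\<omega>. exp (J e * (prod s e + prod t e)) - 1))"

lemma exp_sum_traces:
  fixes h :: "'v set \<Rightarrow> real"
  shows "exp (\<Sum>e\<in>E. h e) = (\<Sum>\<omega>\<in>Pow E. \<Prod>e\<in>\<omega>. exp (h e) - 1)"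
  using prod_add[OF finite_E, of "\<lambda>e. exp (h e) - 1" "\<lambda>_. 1"] finite_E by (simp add: exp_sum)

lemma part_traces: "part J f = (\<Sum>\<omega>\<in>Pow E. trace_weight J f \<omega>)"
  unfolding part_def trace_weight_def exp_sum_traces sum_distrib_left by (rule sum.swap)

lemma sum_double_weight:
  "(\<Sum>\<omega>\<in>Pow E. double_weight J f \<omega>) =
    (\<Sum>s\<in>conf. \<Sum>t\<in>conf. f s t * exp (\<Sum>e\<in>E. J e * (prod s e + prod t e)))"
  unfolding exp_sum_traces double_weight_def sum_distrib_left
  by (subst sum.swap) (intro sum.cong refl sum.swap)

lemma part_mult_traces:
  "part J f * part J h = (\<Sum>\<omega>\<in>Pow E. double_weight J (\<lambda>s t. f s * h t) \<omega>)"
  unfolding sum_double_weight part_def sum_product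
  by (intro sum.cong refl) (simp add: exp_add distrib_left sum.distrib mult_ac)

text \<open>Sums over the union of two independent traces become sums over a single edge set, to
  which cluster flips and switching apply.\<close>

lemma sum_double_weight_traces:
  "(\<Sum>\<omega>\<in>Pow E. c \<omega> * double_weight J (\<lambda>s t. f s * h t) \<omega>) =
    (\<Sum>\<omega>\<in>Pow E. \<Sum>\<omega>'\<in>Pow E. c (\<omega> \<union> \<omega>') * (trace_weight J f \<omega> * trace_weight J h \<omega>'))"
proof -
  let ?b = "\<lambda>\<sigma> e. exp (J e * prod \<sigma> e) - 1"
  have g: "exp (J e * (prod s e + prod t e)) - 1 = (1 + ?b s e) * (1 + ?b t e) - 1" for s t e
    by (simp add: distrib_left exp_add)
  have "(\<Sum>\<omega>\<in>Pow E. c \<omega> * double_weight J (\<lambda>s t. f s * h t) \<omega>) =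
    (\<Sum>s\<in>conf. \<Sum>t\<in>conf. f s * h t * (\<Sum>\<omega>\<in>Pow E. c \<omega> * (\<Prod>e\<in>\<omega>. exp (J e * (prod s e + prod t e)) - 1)))"
    unfolding double_weight_def sum_distrib_left
    by (subst sum.swap, intro sum.cong refl, subst sum.swap, intro sum.cong refl) (simp add: mult_ac)
  also have "\<dots> = (\<Sum>s\<in>conf. \<Sum>t\<in>conf. f s * h t * (\<Sum>\<omega>\<in>Pow E. \<Sum>\<omega>'\<in>Pow E.
      c (\<omega> \<union> \<omega>') * (prod (?b s) \<omega> * prod (?b t) \<omega>')))"
    unfolding g sum_union_weights[OF finite_E] ..
  also have "\<dots> = (\<Sum>s\<in>conf. \<Sum>t\<in>conf. \<Sum>\<omega>\<in>Pow E. \<Sum>\<omega>'\<in>Pow E.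
      c (\<omega> \<union> \<omega>') * ((f s * prod (?b s) \<omega>) * (h t * prod (?b t) \<omega>')))"
    unfolding sum_distrib_left by (intro sum.cong refl) (simp add: mult_ac)
  also have "\<dots> = (\<Sum>s\<in>conf. \<Sum>\<omega>\<in>Pow E. \<Sum>t\<in>conf. \<Sum>\<omega>'\<in>Pow E.
      c (\<omega> \<union> \<omega>') * ((f s * prod (?b s) \<omega>) * (h t * prod (?b t) \<omega>')))"
    by (intro sum.cong refl sum.swap)
  also have "\<dots> = (\<Sum>\<omega>\<in>Pow E. \<Sum>s\<in>conf. \<Sum>\<omega>'\<in>Pow E. \<Sum>t\<in>conf.
      c (\<omega> \<union> \<omega>') * ((f s * prod (?b s) \<omega>) * (h t * prod (?b t) \<omega>')))"
    by (subst sum.swap) (intro sum.cong refl sum.swap)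
  also have "\<dots> = (\<Sum>\<omega>\<in>Pow E. \<Sum>\<omega>'\<in>Pow E. \<Sum>s\<in>conf. \<Sum>t\<in>conf.
      c (\<omega> \<union> \<omega>') * ((f s * prod (?b s) \<omega>) * (h t * prod (?b t) \<omega>')))"
    by (intro sum.cong refl sum.swap)
  also have "\<dots> = (\<Sum>\<omega>\<in>Pow E. \<Sum>\<omega>'\<in>Pow E. c (\<omega> \<union> \<omega>') * (trace_weight J f \<omega> * trace_weight J h \<omega>'))"
    by (simp only: trace_weight_def sum_product) (simp only: sum_distrib_left)
  finally show ?thesis .
qed

lemma trace_weight_nonneg:
  assumes "positive f" "\<And>e. e \<in> E \<Longrightarrow> 0 \<le> J e" "\<omega> \<subseteq> E"
  shows "0 \<le> trace_weight J f \<omega>"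
proof -
  have "positive (\<lambda>\<sigma>. exp (J e * prod \<sigma> e) - 1)" if "e \<in> E" for e
  proof -
    have "positive (\<lambda>\<sigma>. (cosh (J e) - 1) + sinh (J e) * prod \<sigma> e)"
      by (rule positive_affine_edge) (use that assms(2) cosh_real_ge_1[of "J e"] in auto)
    then show ?thesis
      by (subst positive_cong[where g = "\<lambda>\<sigma>. (cosh (J e) - 1) + sinh (J e) * prod \<sigma> e"])
        (simp_all add: exp_edge that)
  qed
  then show ?thesis
    unfolding trace_weight_def
    by (intro positive_sum_nonneg positive_mult positive_prod assms(1) finite_subset[OF assms(3) finite_E])
      (use assms(3) in auto)
qed

lemma double_weight_nonneg:
  assumes "positive f" "positive h" "\<And>e. e \<in> E \<Longrightarrow> 0 \<le> J e" "\<omega> \<subseteq> E"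
  shows "0 \<le> double_weight J (\<lambda>s t. f s * h t) \<omega>"
proof -
  have "double_weight J (\<lambda>s t. f s * h t) \<omega> =
      (\<Sum>\<omega>'\<in>Pow E. (if \<omega>' = \<omega> then 1 else 0) * double_weight J (\<lambda>s t. f s * h t) \<omega>')"
    using assms(4) finite_E by (simp add: if_distrib[where f = "\<lambda>x. x * _"] sum.delta cong: if_cong)
  also have "\<dots> \<ge> 0"
    unfolding sum_double_weight_traces
    by (intro sum_nonneg mult_nonneg_nonneg trace_weight_nonneg assms) auto
  finally show ?thesis .
qed

text \<open>With p = cosh (J e) - 1 and q = sinh (J e) the factor of e is p + q \<sigma>_e. If e
  lies in \<omega>, multiplication by \<sigma>_e exchanges p and q; otherwise \<sigma>_e itself is
  compared with p + q \<sigma>_e. The conditions on C bound the coefficients in both cases.\<close>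

lemma trace_weight_insert:
  assumes "positive f" "\<And>e. e \<in> E \<Longrightarrow> 0 \<le> J e" "\<omega> \<subseteq> E" "e \<in> E"
    and C: "sinh (J e) \<le> C * (cosh (J e) - 1)" "cosh (J e) - 1 \<le> C * sinh (J e)" "1 \<le> C * sinh (J e)"
  shows "trace_weight J (\<lambda>\<sigma>. f \<sigma> * prod \<sigma> e) \<omega> \<le> C * trace_weight J f (insert e \<omega>)"
proof -
  let ?b = "\<lambda>\<sigma> e. exp (J e * prod \<sigma> e) - 1"
  have fin: "finite \<omega>" using finite_subset[OF assms(3) finite_E] .
  have pos: "positive (\<lambda>\<sigma>. ?b \<sigma> e)" if "e \<in> E" for e
  proof -
    have "positive (\<lambda>\<sigma>. (cosh (J e) - 1) + sinh (J e) * prod \<sigma> e)"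
      by (rule positive_affine_edge) (use that assms(2) cosh_real_ge_1[of "J e"] in auto)
    then show ?thesis
      by (subst positive_cong[where g = "\<lambda>\<sigma>. (cosh (J e) - 1) + sinh (J e) * prod \<sigma> e"])
        (simp_all add: exp_edge that)
  qed
  define r where "r = (\<lambda>\<sigma>. f \<sigma> * (\<Prod>e\<in>\<omega> - {e}. ?b \<sigma> e))"
  have r: "positive r"
    unfolding r_def using fin assms(3) by (intro positive_mult assms(1) positive_prod pos) auto
  have ins: "trace_weight J f (insert e \<omega>) = (\<Sum>\<sigma>\<in>conf. r \<sigma> * ?b \<sigma> e)"
    unfolding trace_weight_def r_def
    by (subst prod.insert_remove[OF fin]) (simp add: mult_ac)
  have C0: "0 \<le> C * (cosh (J e) - 1)"
    using C(1) assms(2)[OF assms(4)] by (meson order_trans sinh_real_nonneg_iff)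
  show ?thesis
  proof (cases "e \<in> \<omega>")
    case True
    then have "trace_weight J (\<lambda>\<sigma>. f \<sigma> * prod \<sigma> e) \<omega> = (\<Sum>\<sigma>\<in>conf. r \<sigma> * (prod \<sigma> e * ?b \<sigma> e))"
      unfolding trace_weight_def r_def by (subst prod.remove[OF fin True]) (simp add: mult_ac)
    moreover have "0 \<le> (\<Sum>\<sigma>\<in>conf. r \<sigma> * ((C * (cosh (J e) - 1) - sinh (J e)) + (C * sinh (J e) - (cosh (J e) - 1)) * prod \<sigma> e))"
      using C by (intro positive_sum_nonneg positive_mult r positive_affine_edge assms(4)) auto
    moreover have "\<dots> = (\<Sum>\<sigma>\<in>conf. r \<sigma> * (C * ?b \<sigma> e - prod \<sigma> e * ?b \<sigma> e))"
    proof (intro sum.cong refl)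
      fix \<sigma> assume \<sigma>: "\<sigma> \<in> conf"
      then have "prod \<sigma> e * prod \<sigma> e = 1" using edge_values[OF \<sigma> assms(4)] by auto
      then show "r \<sigma> * ((C * (cosh (J e) - 1) - sinh (J e)) + (C * sinh (J e) - (cosh (J e) - 1)) * prod \<sigma> e)
          = r \<sigma> * (C * ?b \<sigma> e - prod \<sigma> e * ?b \<sigma> e)"
        by (simp add: exp_edge[OF \<sigma> assms(4)] algebra_simps)
    qed
    ultimately show ?thesis
      unfolding ins by (simp add: right_diff_distrib sum_subtractf sum_distrib_left mult_ac)
  next
    case False
    then have "trace_weight J (\<lambda>\<sigma>. f \<sigma> * prod \<sigma> e) \<omega> = (\<Sum>\<sigma>\<in>conf. r \<sigma> * prod \<sigma> e)"
      unfolding trace_weight_def r_def by (simp add: mult_ac)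
    moreover have "0 \<le> (\<Sum>\<sigma>\<in>conf. r \<sigma> * (C * (cosh (J e) - 1) + (C * sinh (J e) - 1) * prod \<sigma> e))"
      using C C0 by (intro positive_sum_nonneg positive_mult r positive_affine_edge assms(4)) auto
    moreover have "\<dots> = (\<Sum>\<sigma>\<in>conf. r \<sigma> * (C * ?b \<sigma> e - prod \<sigma> e))"
      by (intro sum.cong refl) (simp add: exp_edge[OF _ assms(4)] algebra_simps)
    ultimately show ?thesis
      unfolding ins by (simp add: right_diff_distrib sum_subtractf sum_distrib_left mult_ac)
  qed
qed

lemma cluster_subset: "\<omega> \<subseteq> E \<Longrightarrow> x \<in> V \<Longrightarrow> cluster \<omega> x \<subseteq> V"
proof
  fix y assume "\<omega> \<subseteq> E" "x \<in> V" "y \<in> cluster \<omega> x"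
  then have "(\<lambda>a b. {a, b} \<in> \<omega>)\<^sup>*\<^sup>* x y" by (simp add: cluster_def)
  then show "y \<in> V"
    by (induction rule: rtranclp_induct) (use \<open>x \<in> V\<close> \<open>\<omega> \<subseteq> E\<close> edge in blast)+
qed

lemma cluster_closed:
  assumes "\<omega> \<subseteq> E" "e \<in> \<omega>"
  shows "e \<subseteq> cluster \<omega> x \<or> e \<inter> cluster \<omega> x = {}"
proof -
  obtain a b where e: "e = {a, b}" using assms edge_cases by (metis subsetD)
  have "b \<in> cluster \<omega> a" using assms(2) cluster_edge unfolding e by metis
  then have "a \<in> cluster \<omega> x \<longleftrightarrow> b \<in> cluster \<omega> x"
    using cluster_trans[of a \<omega> x b] cluster_trans[of b \<omega> x a] cluster_sym[of b \<omega> a] by metis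
  then show ?thesis unfolding e by auto
qed

section \<open>Cluster flips and switching\<close>

definition flip :: "'v set \<Rightarrow> ('v \<Rightarrow> real) \<Rightarrow> 'v \<Rightarrow> real" where
  "flip D \<sigma> = (\<lambda>v\<in>V. if v \<in> D then - \<sigma> v else \<sigma> v)"

lemma flip_apply: "v \<in> V \<Longrightarrow> flip D \<sigma> v = (if v \<in> D then - \<sigma> v else \<sigma> v)"
  by (simp add: flip_def)

lemma flip_conf:
  assumes "\<sigma> \<in> conf" shows "flip D \<sigma> \<in> conf"
proof -
  have "(if v \<in> D then - \<sigma> v else \<sigma> v) \<in> {-1, 1}" if "v \<in> V" for v
    using conf_values[OF assms that] by auto
  then show ?thesis unfolding conf_def flip_def by (simp add: restrict_PiE_iff)
qed

lemma flip_flip: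
  assumes "\<sigma> \<in> conf" shows "flip D (flip D \<sigma>) = \<sigma>"
proof
  fix v show "flip D (flip D \<sigma>) v = \<sigma> v"
    using assms by (cases "v \<in> V") (auto simp: flip_def conf_def PiE_def extensional_def)
qed

lemma sum_flip: "(\<Sum>\<sigma>\<in>conf. F \<sigma>) = (\<Sum>\<sigma>\<in>conf. F (flip D \<sigma>))"
  by (intro sum.reindex_bij_witness[of _ "flip D" "flip D"]) (simp_all add: flip_conf flip_flip)

lemma flip_edge: "e \<in> E \<Longrightarrow> e \<subseteq> D \<or> e \<inter> D = {} \<Longrightarrow> prod (flip D \<sigma>) e = prod \<sigma> e"
  by (elim edge_cases) (auto simp: flip_apply)

text \<open>Every edge of \<omega> has both ends in the cluster or neither, so the flip does not
  change its product of spins.\<close>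

lemma trace_weight_flip:
  assumes "\<omega> \<subseteq> E"
  shows "trace_weight J f \<omega> = trace_weight J (\<lambda>\<sigma>. f (flip (cluster \<omega> x) \<sigma>)) \<omega>"
proof -
  have inv: "prod (flip (cluster \<omega> x) \<sigma>) e = prod \<sigma> e" if "e \<in> \<omega>" for e \<sigma>
    using that assms cluster_closed[OF assms that] by (intro flip_edge) auto
  show ?thesis
    unfolding trace_weight_def
    by (subst sum_flip[where D = "cluster \<omega> x"]) (simp add: inv cong: prod.cong)
qed

lemma double_weight_flip_right:
  assumes "\<omega> \<subseteq> E"
  shows "double_weight J f \<omega> = double_weight J (\<lambda>s t. f s (flip (cluster \<omega> x) t)) \<omega>"
proof -
  have inv: "prod (flip (cluster \<omega> x) \<sigma>) e = prod \<sigma> e" if "e \<in> \<omega>" for e \<sigma>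
    using that assms cluster_closed[OF assms that] by (intro flip_edge) auto
  show ?thesis
    unfolding double_weight_def
    by (rule sum.cong[OF refl], subst sum_flip[where D = "cluster \<omega> x"]) (simp add: inv cong: prod.cong)
qed

lemma double_weight_flip:
  assumes "\<omega> \<subseteq> E"
  shows "double_weight J f \<omega> =
    double_weight J (\<lambda>s t. f (flip (cluster \<omega> x) s) (flip (cluster \<omega> x) t)) \<omega>"
proof -
  have inv: "prod (flip (cluster \<omega> x) \<sigma>) e = prod \<sigma> e" if "e \<in> \<omega>" for e \<sigma>
    using that assms cluster_closed[OF assms that] by (intro flip_edge) auto
  have "double_weight J (\<lambda>s t. f (flip (cluster \<omega> x) s) t) \<omega> = double_weight J f \<omega>"
    unfolding double_weight_def
    using sum_flip[where D = "cluster \<omega> x" and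
        F = "\<lambda>s. \<Sum>t\<in>conf. f s t * (\<Prod>e\<in>\<omega>. exp (J e * (prod s e + prod t e)) - 1)"]
    by (simp add: inv cong: prod.cong)
  then show ?thesis
    using double_weight_flip_right[OF assms, of J "\<lambda>s t. f (flip (cluster \<omega> x) s) t" x] by simp
qed

lemma double_weight_add:
  "double_weight J (\<lambda>s t. f s t + g s t) \<omega> = double_weight J f \<omega> + double_weight J g \<omega>"
  by (simp add: double_weight_def distrib_right sum.distrib)

lemma double_weight_uminus: "double_weight J (\<lambda>s t. - f s t) \<omega> = - double_weight J f \<omega>"
  by (simp add: double_weight_def sum_negf)

text \<open>The weight of an edge vanishes unless \<open>\<theta> = s t\<close> agrees at its two ends, so only
  pairs with \<open>\<theta>\<close> constant on clusters contribute.\<close>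

lemma double_weight_cong:
  assumes "\<omega> \<subseteq> E"
    and eq: "\<And>s t. s \<in> conf \<Longrightarrow> t \<in> conf \<Longrightarrow> (\<And>a b. a \<in> V \<Longrightarrow> b \<in> cluster \<omega> a \<Longrightarrow> s a * t a = s b * t b) \<Longrightarrow>
      f s t = g s t"
  shows "double_weight J f \<omega> = double_weight J g \<omega>"
  unfolding double_weight_def
proof (intro sum.cong refl)
  fix s t assume st: "s \<in> conf" "t \<in> conf"
  let ?P = "\<Prod>e\<in>\<omega>. exp (J e * (prod s e + prod t e)) - 1"
  show "f s t * ?P = g s t * ?P"
  proof (cases "?P = 0")
    case False
    have step: "s a * t a = s b * t b" if "{a, b} \<in> \<omega>" for a b
    proof -
      have e: "{a, b} \<in> E" using that assms(1) by auto
      then have ab: "a \<in> V" "b \<in> V" "a \<noteq> b" using edge[OF e] by auto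
      have "prod s {a, b} + prod t {a, b} \<noteq> 0"
        using False that finite_subset[OF assms(1) finite_E] by (auto simp: prod_zero_iff)
      then show ?thesis
        using ab conf_values[OF st(1) ab(1)] conf_values[OF st(1) ab(2)]
          conf_values[OF st(2) ab(1)] conf_values[OF st(2) ab(2)] by auto
    qed
    have "s a * t a = s b * t b" if "b \<in> cluster \<omega> a" for a b
    proof -
      have "(\<lambda>a b. {a, b} \<in> \<omega>)\<^sup>*\<^sup>* a b" using that by (simp add: cluster_def)
      then show ?thesis by (induction rule: rtranclp_induct) (simp_all add: step)
    qed
    then show ?thesis using eq[OF st] by simp
  qed simp
qed


text \<open>This replaces the source constraint for currents: the weight vanishes if some cluster
  contains an odd number of sources of the two copies together.\<close>

lemma double_weight_odd:
  assumes "\<omega> \<subseteq> E"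
    and "\<And>s t. f (flip (cluster \<omega> a) s) (flip (cluster \<omega> a) t) = - f s t"
  shows "double_weight J f \<omega> = 0"
  using double_weight_flip[OF assms(1), of J f a] double_weight_uminus[of J f \<omega>] assms(2) by simp

lemma double_weight_odd_right:
  assumes "\<omega> \<subseteq> E" and "\<And>s t. f s (flip (cluster \<omega> a) t) = - f s t"
  shows "double_weight J f \<omega> = 0"
  using double_weight_flip_right[OF assms(1), of J f a] double_weight_uminus[of J f \<omega>] assms(2) by simp

lemma trace_weight_odd:
  assumes "\<omega> \<subseteq> E" and "\<And>\<sigma>. f (flip (cluster \<omega> a) \<sigma>) = - f \<sigma>"
  shows "trace_weight J f \<omega> = 0"
proof -
  have "trace_weight J (\<lambda>\<sigma>. - f \<sigma>) \<omega> = - trace_weight J f \<omega>"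
    by (simp add: trace_weight_def sum_negf)
  then show ?thesis
    using trace_weight_flip[OF assms(1), of J f a] assms(2) by simp
qed

text \<open>If x, u and y share a cluster, s t takes the same value at u and y, which turns s_u t_u
  t_y into s_y. In the other cases a flip of the cluster of x in both copies, or of the cluster of u
  in \<open>t\<close> alone, shows that what remains vanishes.\<close>

lemma switch_left:
  assumes \<omega>: "\<omega> \<subseteq> E" and V: "x \<in> V" "y \<in> V" "u \<in> V"
  shows "double_weight J (\<lambda>s t. s x * s u * (t u * t y)) \<omega> =
    (if u \<in> cluster \<omega> x then double_weight J (\<lambda>s t. s x * s y) \<omega> else 0)"
proof (cases "u \<in> cluster \<omega> x")
  case True
  show ?thesis
  proof (cases "y \<in> cluster \<omega> x")
    case y: True
    have "double_weight J (\<lambda>s t. s x * s u * (t u * t y)) \<omega> = double_weight J (\<lambda>s t. s x * s y) \<omega>"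
    proof (rule double_weight_cong[OF \<omega>])
      fix s t assume st: "s \<in> conf" "t \<in> conf"
        and c: "\<And>a b. a \<in> V \<Longrightarrow> b \<in> cluster \<omega> a \<Longrightarrow> s a * t a = s b * t b"
      have "y \<in> cluster \<omega> u" using True y cluster_eq by metis
      then have "s u * t u = s y * t y" using c V by simp
      then have "s x * s u * (t u * t y) = s x * (s y * (t y * t y))" by simp
      then show "s x * s u * (t u * t y) = s x * s y" using spin_square[OF st(2) V(2)] by simp
    qed
    then show ?thesis using True by simp
  next
    case y: False
    have "double_weight J (\<lambda>s t. s x * s u * (t u * t y)) \<omega> = 0"
      by (rule double_weight_odd[OF \<omega>, of _ x]) (use True y V in \<open>simp add: flip_apply cluster_refl\<close>)
    moreover have "double_weight J (\<lambda>s t. s x * s y) \<omega> = 0"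
      by (rule double_weight_odd[OF \<omega>, of _ x]) (use y V in \<open>simp add: flip_apply cluster_refl\<close>)
    ultimately show ?thesis by simp
  qed
next
  case False
  show ?thesis
  proof (cases "y \<in> cluster \<omega> u")
    case True
    then have "y \<notin> cluster \<omega> x" using False by (metis cluster_eq cluster_refl)
    then have "double_weight J (\<lambda>s t. s x * s u * (t u * t y)) \<omega> = 0"
      by (intro double_weight_odd[OF \<omega>, of _ x]) (use False V in \<open>simp add: flip_apply cluster_refl\<close>)
    then show ?thesis using False by simp
  next
    case y: False
    have "double_weight J (\<lambda>s t. s x * s u * (t u * t y)) \<omega> = 0"
      by (rule double_weight_odd_right[OF \<omega>, of _ u]) (use y V in \<open>simp add: flip_apply cluster_refl\<close>)
    then show ?thesis using False by simp
  qed
qed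

text \<open>If u and v share a cluster, s_u t_u = s_v t_v means t_u t_v = s_u s_v, so these sources
  can be moved to the first copy. If they are separated, flipping \<open>t\<close> on the cluster of
  u changes the sign.\<close>

lemma switch_right:
  assumes \<omega>: "\<omega> \<subseteq> E" and V: "x \<in> V" "y \<in> V" "u \<in> V" "v \<in> V"
  shows "double_weight J (\<lambda>s t. s x * s y * (t u * t v)) \<omega> =
    (if v \<in> cluster \<omega> u then double_weight J (\<lambda>s t. s x * s y * s u * s v) \<omega> else 0)"
proof (cases "v \<in> cluster \<omega> u")
  case True
  have "double_weight J (\<lambda>s t. s x * s y * (t u * t v)) \<omega> = double_weight J (\<lambda>s t. s x * s y * s u * s v) \<omega>"
  proof (rule double_weight_cong[OF \<omega>])
    fix s t assume st: "s \<in> conf" "t \<in> conf"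
      and c: "\<And>a b. a \<in> V \<Longrightarrow> b \<in> cluster \<omega> a \<Longrightarrow> s a * t a = s b * t b"
    have "s u * t u = s v * t v" using c True V by simp
    then have "t u * t v = s u * s v"
      using conf_values[OF st(1) V(3)] conf_values[OF st(1) V(4)]
        conf_values[OF st(2) V(3)] conf_values[OF st(2) V(4)] by auto
    then show "s x * s y * (t u * t v) = s x * s y * s u * s v" by simp
  qed
  then show ?thesis using True by simp
next
  case False
  have "double_weight J (\<lambda>s t. s x * s y * (t u * t v)) \<omega> = 0"
    by (rule double_weight_odd_right[OF \<omega>, of _ u]) (use False V in \<open>simp add: flip_apply cluster_refl\<close>)
  then show ?thesis using False by simp
qed

section \<open>The Ursell function and intersecting clusters\<close>

text \<open>The second term has the opposite sign to the one in the Ursell function, so this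
  represents U + 2<xy><zw>. With this sign and nonnegative couplings every edge set has nonnegative
  weight, and weight zero unless y is joined to x and to neither z nor w.\<close>

abbreviation ursell_obs :: "'v \<Rightarrow> 'v \<Rightarrow> 'v \<Rightarrow> 'v \<Rightarrow> ('v \<Rightarrow> real) \<Rightarrow> ('v \<Rightarrow> real) \<Rightarrow> real" where
  "ursell_obs x y z w \<equiv> \<lambda>s t. s x * s y * s z * s w + s x * s y * (t z * t w)
     + - (s x * s z * (t y * t w)) + - (s x * s w * (t y * t z))"

lemma part_ursell_obs:
  "(Z J)\<^sup>2 * (fp J x y z w + tp J x y * tp J z w - tp J x z * tp J y w - tp J x w * tp J y z) =
    (\<Sum>\<omega>\<in>Pow E. double_weight J (ursell_obs x y z w) \<omega>)"
proof -
  have "(Z J)\<^sup>2 * (fp J x y z w + tp J x y * tp J z w - tp J x z * tp J y w - tp J x w * tp J y z) =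
    part J (\<lambda>\<sigma>. \<sigma> x * \<sigma> y * \<sigma> z * \<sigma> w) * part J (\<lambda>_. 1) +
    part J (\<lambda>\<sigma>. \<sigma> x * \<sigma> y) * part J (\<lambda>\<sigma>. \<sigma> z * \<sigma> w) -
    part J (\<lambda>\<sigma>. \<sigma> x * \<sigma> z) * part J (\<lambda>\<sigma>. \<sigma> y * \<sigma> w) -
    part J (\<lambda>\<sigma>. \<sigma> x * \<sigma> w) * part J (\<lambda>\<sigma>. \<sigma> y * \<sigma> z)"
    using Z_pos[of J] unfolding ev_def by (simp add: field_simps power2_eq_square)
  also have "\<dots> = (\<Sum>\<omega>\<in>Pow E. double_weight J (ursell_obs x y z w) \<omega>)"
    unfolding part_mult_traces double_weight_add double_weight_uminus sum.distrib sum_negf by simp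
  finally show ?thesis .
qed

text \<open>On configurations with \<open>\<theta> = s t\<close> constant on clusters the observable is
  \<open>s\<^sub>x s\<^sub>y s\<^sub>z s\<^sub>w (1 - \<theta>\<^sub>y \<theta>\<^sub>z) (1 - \<theta>\<^sub>y \<theta>\<^sub>w)\<close>.\<close>

lemma ursell_obs_connected:
  assumes \<omega>: "\<omega> \<subseteq> E" and V: "x \<in> V" "y \<in> V" "z \<in> V" "w \<in> V"
    and "z \<in> cluster \<omega> y \<or> w \<in> cluster \<omega> y"
  shows "double_weight J (ursell_obs x y z w) \<omega> = 0"
proof -
  have "double_weight J (ursell_obs x y z w) \<omega> = double_weight J (\<lambda>s t. 0) \<omega>"
  proof (rule double_weight_cong[OF \<omega>])
    fix s t assume st: "s \<in> conf" "t \<in> conf"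
      and c: "\<And>a b. a \<in> V \<Longrightarrow> b \<in> cluster \<omega> a \<Longrightarrow> s a * t a = s b * t b"
    have "s y * t y = s z * t z \<or> s y * t y = s w * t w" using c V assms(6) by auto
    moreover have "s y * s z * s w + s y * (t z * t w) - s z * (t y * t w) - s w * (t y * t z) =
        s y * s z * s w * (1 - s y * t y * (s z * t z)) * (1 - s y * t y * (s w * t w))"
      using spin_square[OF st(1) V(2)] spin_square[OF st(1) V(3)] spin_square[OF st(1) V(4)]
        spin_square[OF st(2) V(2)] by algebra
    moreover have "s y * t y * (s y * t y) = 1"
      using spin_square[OF st(1) V(2)] spin_square[OF st(2) V(2)] by algebra
    ultimately have "s y * s z * s w + s y * (t z * t w) - s z * (t y * t w) - s w * (t y * t z) = 0"
      by auto
    moreover have "ursell_obs x y z w s t =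
        s x * (s y * s z * s w + s y * (t z * t w) - s z * (t y * t w) - s w * (t y * t z))"
      by (simp add: algebra_simps)
    ultimately show "ursell_obs x y z w s t = 0" by simp
  qed
  then show ?thesis by (simp add: double_weight_def)
qed

text \<open>Flipping \<open>t\<close> on the cluster of y removes the two mixed pairings. The other
  two terms both vanish if y is separated from x; if it is not, they agree by
  \<open>switch_right\<close> when z and w are joined, and both vanish otherwise.\<close>

lemma ursell_obs_disconnected:
  assumes \<omega>: "\<omega> \<subseteq> E" and V: "x \<in> V" "y \<in> V" "z \<in> V" "w \<in> V"
    and "z \<notin> cluster \<omega> y" "w \<notin> cluster \<omega> y"
  shows "double_weight J (ursell_obs x y z w) \<omega> =
    (if y \<in> cluster \<omega> x then 2 * double_weight J (\<lambda>s t. s x * s y * (t z * t w)) \<omega> else 0)"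
proof -
  have "double_weight J (\<lambda>s t. s x * s z * (t y * t w)) \<omega> = 0"
    "double_weight J (\<lambda>s t. s x * s w * (t y * t z)) \<omega> = 0"
    by (rule double_weight_odd_right[OF \<omega>, of _ y]; use assms in \<open>simp add: flip_apply cluster_refl\<close>)+
  then have eq: "double_weight J (ursell_obs x y z w) \<omega> =
      double_weight J (\<lambda>s t. s x * s y * s z * s w) \<omega> + double_weight J (\<lambda>s t. s x * s y * (t z * t w)) \<omega>"
    unfolding double_weight_add double_weight_uminus by simp
  show ?thesis
  proof (cases "y \<in> cluster \<omega> x")
    case False
    then have x: "x \<notin> cluster \<omega> y" using cluster_sym[of x \<omega> y] by auto
    have "double_weight J (\<lambda>s t. s x * s y * s z * s w) \<omega> = 0"
      "double_weight J (\<lambda>s t. s x * s y * (t z * t w)) \<omega> = 0"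
      by (rule double_weight_odd[OF \<omega>, of _ y]; use assms x in \<open>simp add: flip_apply cluster_refl\<close>)+
    then show ?thesis using eq False by simp
  next
    case True
    show ?thesis
    proof (cases "w \<in> cluster \<omega> z")
      case w: True
      then show ?thesis using eq True switch_right[OF \<omega> V] by simp
    next
      case w: False
      have "y \<notin> cluster \<omega> z" using assms(6) cluster_sym[of y \<omega> z] by auto
      moreover from this have "x \<notin> cluster \<omega> z" using True cluster_trans[of x \<omega> z y] by auto
      ultimately have "double_weight J (\<lambda>s t. s x * s y * s z * s w) \<omega> = 0"
        by (intro double_weight_odd[OF \<omega>, of _ z]) (use w V in \<open>simp add: flip_apply cluster_refl\<close>)
      then show ?thesis using eq True w switch_right[OF \<omega> V] by simp
    qed
  qed
qed

definition ursell :: "('v set \<Rightarrow> real) \<Rightarrow> 'v \<Rightarrow> 'v \<Rightarrow> 'v \<Rightarrow> 'v \<Rightarrow> real" where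
  "ursell J x y z w = fp J x y z w - tp J x y * tp J z w - tp J x z * tp J y w - tp J x w * tp J y z"

lemma positive_two: "x \<in> V \<Longrightarrow> y \<in> V \<Longrightarrow> positive (\<lambda>\<sigma>. \<sigma> x * \<sigma> y)"
  by (intro positive_mult positive_spin)

text \<open>Up to the factor \<open>(Z J)\<^sup>2\<close>, U + 2<xy><zw> is at most twice the weight
  of the pairs of traces with disjoint clusters, while <xy><zw> is the weight of all pairs. The
  difference is left with the pairs whose clusters meet.\<close>

lemma ursell_bound:
  assumes J: "\<And>e. e \<in> E \<Longrightarrow> 0 \<le> J e" and V: "x \<in> V" "y \<in> V" "z \<in> V" "w \<in> V"
  shows "2 * (\<Sum>\<omega>\<in>Pow E. \<Sum>\<omega>'\<in>Pow E. of_bool (cluster \<omega> x \<inter> cluster \<omega>' z \<noteq> {}) *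
      (trace_weight J (\<lambda>\<sigma>. \<sigma> x * \<sigma> y) \<omega> * trace_weight J (\<lambda>\<sigma>. \<sigma> z * \<sigma> w) \<omega>'))
    \<le> - ursell J x y z w * (Z J)\<^sup>2"
proof -
  let ?T = "\<lambda>\<omega> \<omega>'. trace_weight J (\<lambda>\<sigma>. \<sigma> x * \<sigma> y) \<omega> * trace_weight J (\<lambda>\<sigma>. \<sigma> z * \<sigma> w) \<omega>'"
  let ?d = "double_weight J (\<lambda>s t. s x * s y * (t z * t w))"
  have T: "0 \<le> ?T \<omega> \<omega>'" if "\<omega> \<in> Pow E" "\<omega>' \<in> Pow E" for \<omega> \<omega>'
    using that by (intro mult_nonneg_nonneg trace_weight_nonneg positive_two V J) auto
  have "(Z J)\<^sup>2 * (fp J x y z w + tp J x y * tp J z w - tp J x z * tp J y w - tp J x w * tp J y z)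
      = (\<Sum>\<omega>\<in>Pow E. double_weight J (ursell_obs x y z w) \<omega>)"
    by (rule part_ursell_obs)
  also have "\<dots> \<le> (\<Sum>\<omega>\<in>Pow E. 2 * (of_bool (z \<notin> cluster \<omega> x) * ?d \<omega>))"
  proof (rule sum_mono)
    fix \<omega> assume "\<omega> \<in> Pow E"
    then have \<omega>: "\<omega> \<subseteq> E" by simp
    have d: "0 \<le> ?d \<omega>" by (intro double_weight_nonneg positive_two V J \<omega>)
    show "double_weight J (ursell_obs x y z w) \<omega> \<le> 2 * (of_bool (z \<notin> cluster \<omega> x) * ?d \<omega>)"
    proof (cases "z \<in> cluster \<omega> y \<or> w \<in> cluster \<omega> y")
      case True
      then show ?thesis using ursell_obs_connected[OF \<omega> V, of J] d by simp
    next
      case False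
      then have "double_weight J (ursell_obs x y z w) \<omega> = (if y \<in> cluster \<omega> x then 2 * ?d \<omega> else 0)"
        using ursell_obs_disconnected[OF \<omega> V, of J] by blast
      moreover have "z \<notin> cluster \<omega> x" if "y \<in> cluster \<omega> x"
        using that False cluster_trans[of z \<omega> y x] cluster_sym[of y \<omega> x] cluster_trans[of x \<omega> y z] by auto
      ultimately show ?thesis using d by auto
    qed
  qed
  also have "\<dots> = 2 * (\<Sum>\<omega>\<in>Pow E. \<Sum>\<omega>'\<in>Pow E. of_bool (z \<notin> cluster (\<omega> \<union> \<omega>') x) * ?T \<omega> \<omega>')"
    unfolding sum_distrib_left[symmetric]
    by (subst sum_double_weight_traces[where c = "\<lambda>\<omega>. of_bool (z \<notin> cluster \<omega> x)"]) simp
  also have "\<dots> \<le> 2 * (\<Sum>\<omega>\<in>Pow E. \<Sum>\<omega>'\<in>Pow E. of_bool (cluster \<omega> x \<inter> cluster \<omega>' z = {}) * ?T \<omega> \<omega>')"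
  proof (intro mult_left_mono sum_mono mult_right_mono T)
    fix \<omega> \<omega>'
    \<comment> \<open>A common vertex of the two clusters joins x to z in the union, so separation
      in the union forces the clusters to be disjoint.\<close>
    have "z \<in> cluster (\<omega> \<union> \<omega>') x" if "a \<in> cluster \<omega> x" "a \<in> cluster \<omega>' z" for a
      using that cluster_mono[of \<omega> "\<omega> \<union> \<omega>'" x] cluster_mono[of \<omega>' "\<omega> \<union> \<omega>'" z]
        cluster_trans[of a "\<omega> \<union> \<omega>'" x z] cluster_sym[of a "\<omega> \<union> \<omega>'" z] by auto
    then show "of_bool (z \<notin> cluster (\<omega> \<union> \<omega>') x) \<le> (of_bool (cluster \<omega> x \<inter> cluster \<omega>' z = {}) :: real)"
      by auto
  qed auto
  finally have *: "(Z J)\<^sup>2 * (fp J x y z w + tp J x y * tp J z w - tp J x z * tp J y w - tp J x w * tp J y z)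
    \<le> 2 * (\<Sum>\<omega>\<in>Pow E. \<Sum>\<omega>'\<in>Pow E. of_bool (cluster \<omega> x \<inter> cluster \<omega>' z = {}) * ?T \<omega> \<omega>')" .
  have "(\<Sum>\<omega>\<in>Pow E. \<Sum>\<omega>'\<in>Pow E. of_bool (cluster \<omega> x \<inter> cluster \<omega>' z = {}) * ?T \<omega> \<omega>') +
      (\<Sum>\<omega>\<in>Pow E. \<Sum>\<omega>'\<in>Pow E. of_bool (cluster \<omega> x \<inter> cluster \<omega>' z \<noteq> {}) * ?T \<omega> \<omega>') =
      (\<Sum>\<omega>\<in>Pow E. \<Sum>\<omega>'\<in>Pow E. ?T \<omega> \<omega>')"
    unfolding sum.distrib[symmetric] by (intro sum.cong refl) auto
  also have "\<dots> = (Z J)\<^sup>2 * (tp J x y * tp J z w)"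
    using Z_pos[of J] unfolding ev_def
    by (simp add: part_traces[of J "\<lambda>\<sigma>. \<sigma> x * \<sigma> y"] part_traces[of J "\<lambda>\<sigma>. \<sigma> z * \<sigma> w"]
        sum_product power2_eq_square)
  finally show ?thesis
    using * unfolding ursell_def by (simp add: algebra_simps)
qed

section \<open>Traces that pass through a given vertex\<close>

definition through :: "('v set \<Rightarrow> real) \<Rightarrow> 'v \<Rightarrow> 'v \<Rightarrow> 'v \<Rightarrow> real" where
  "through J x y u = (\<Sum>\<omega>\<in>Pow E. of_bool (u \<in> cluster \<omega> x) * trace_weight J (\<lambda>\<sigma>. \<sigma> x * \<sigma> y) \<omega>) / Z J"

text \<open>By \<open>switch_right\<close> the product <xy><uv> cancels exactly the edge sets that
  join u to v. In the others u and v are separated in the union of two traces, hence in the first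
  trace, and the second one is summed out.\<close>

lemma truncated_bound:
  assumes J: "\<And>e. e \<in> E \<Longrightarrow> 0 \<le> J e" and V: "x \<in> V" "y \<in> V" "u \<in> V" "v \<in> V"
  shows "Z J * (fp J x y u v - tp J x y * tp J u v) \<le>
    (\<Sum>\<omega>\<in>Pow E. of_bool (v \<notin> cluster \<omega> u) * trace_weight J (\<lambda>\<sigma>. \<sigma> x * \<sigma> y * \<sigma> u * \<sigma> v) \<omega>)"
proof -
  let ?f = "\<lambda>\<sigma>. \<sigma> x * \<sigma> y * \<sigma> u * \<sigma> v"
  have pos: "positive ?f" by (intro positive_mult positive_spin V)
  have "(Z J)\<^sup>2 * (fp J x y u v - tp J x y * tp J u v) =
      part J ?f * part J (\<lambda>_. 1) - part J (\<lambda>\<sigma>. \<sigma> x * \<sigma> y) * part J (\<lambda>\<sigma>. \<sigma> u * \<sigma> v)"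
    using Z_pos[of J] unfolding ev_def by (simp add: field_simps power2_eq_square)
  also have "\<dots> = (\<Sum>\<omega>\<in>Pow E. of_bool (v \<notin> cluster \<omega> u) * double_weight J (\<lambda>s t. ?f s * 1) \<omega>)"
    unfolding part_mult_traces sum_subtractf[symmetric]
    by (intro sum.cong refl) (simp add: switch_right V)
  also have "\<dots> = (\<Sum>\<omega>\<in>Pow E. \<Sum>\<omega>'\<in>Pow E. of_bool (v \<notin> cluster (\<omega> \<union> \<omega>') u) *
      (trace_weight J ?f \<omega> * trace_weight J (\<lambda>_. 1) \<omega>'))"
    by (rule sum_double_weight_traces)
  also have "\<dots> \<le> (\<Sum>\<omega>\<in>Pow E. \<Sum>\<omega>'\<in>Pow E. of_bool (v \<notin> cluster \<omega> u) *
      (trace_weight J ?f \<omega> * trace_weight J (\<lambda>_. 1) \<omega>'))"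
  proof (intro sum_mono mult_right_mono mult_nonneg_nonneg trace_weight_nonneg pos positive_const J)
    fix \<omega> \<omega>'
    show "of_bool (v \<notin> cluster (\<omega> \<union> \<omega>') u) \<le> (of_bool (v \<notin> cluster \<omega> u) :: real)"
      using cluster_mono[of \<omega> "\<omega> \<union> \<omega>'" u] by auto
  qed auto
  also have "\<dots> = (\<Sum>\<omega>\<in>Pow E. of_bool (v \<notin> cluster \<omega> u) * trace_weight J ?f \<omega>) * Z J"
    unfolding part_traces[of J "\<lambda>_. 1"] sum_product by (simp add: mult_ac)
  finally show ?thesis
    using Z_pos[of J] by (simp add: power2_eq_square)
qed

text \<open>\<sigma>_u \<sigma>_v is the product of the edge spins along the walk, and each of them
  costs a factor \<open>C\<close> and the insertion of its edge. \<open>P\<close> is chosen before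
  \<omega>, so that adding it has bounded multiplicity in sums over \<omega>.\<close>

lemma walk_trace:
  assumes J: "\<And>e. e \<in> E \<Longrightarrow> 0 \<le> J e" and "0 \<le> C"
    and C: "\<And>e. e \<in> E \<Longrightarrow> sinh (J e) \<le> C * (cosh (J e) - 1)"
      "\<And>e. e \<in> E \<Longrightarrow> cosh (J e) - 1 \<le> C * sinh (J e)" "\<And>e. e \<in> E \<Longrightarrow> 1 \<le> C * sinh (J e)"
    and walk: "((\<lambda>a b. {a, b} \<in> E) ^^ l) u v" and "u \<in> V"
  shows "\<exists>P\<subseteq>E. card P \<le> l \<and> v \<in> cluster P u \<and> (\<forall>f \<omega>. positive f \<longrightarrow> \<omega> \<subseteq> E \<longrightarrow>
    trace_weight J (\<lambda>\<sigma>. f \<sigma> * (\<sigma> u * \<sigma> v)) \<omega> \<le> C ^ l * trace_weight J f (\<omega> \<union> P))"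
  using walk
proof (induction l arbitrary: v)
  case 0
  then have "v = u" by simp
  moreover have "trace_weight J (\<lambda>\<sigma>. f \<sigma> * (\<sigma> u * \<sigma> u)) \<omega> = trace_weight J f \<omega>" for f \<omega>
    unfolding trace_weight_def using spin_square \<open>u \<in> V\<close> by (intro sum.cong refl) simp
  ultimately show ?case by (intro exI[of _ "{}"]) (simp add: cluster_refl)
next
  case (Suc l)
  then obtain b where b: "((\<lambda>a b. {a, b} \<in> E) ^^ l) u b" and e: "{b, v} \<in> E" by auto
  from Suc.IH[OF b] obtain P where P: "P \<subseteq> E" "card P \<le> l" "b \<in> cluster P u"
    and step: "\<And>f \<omega>. positive f \<Longrightarrow> \<omega> \<subseteq> E \<Longrightarrow>
      trace_weight J (\<lambda>\<sigma>. f \<sigma> * (\<sigma> u * \<sigma> b)) \<omega> \<le> C ^ l * trace_weight J f (\<omega> \<union> P)" by blast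
  have bv: "b \<in> V" "v \<in> V" "b \<noteq> v" using edge[OF e] by auto
  have "trace_weight J (\<lambda>\<sigma>. f \<sigma> * (\<sigma> u * \<sigma> v)) \<omega> \<le> C ^ Suc l * trace_weight J f (\<omega> \<union> insert {b, v} P)"
    if f: "positive f" and \<omega>: "\<omega> \<subseteq> E" for f \<omega>
  proof -
    have "trace_weight J (\<lambda>\<sigma>. f \<sigma> * (\<sigma> u * \<sigma> v)) \<omega> =
        trace_weight J (\<lambda>\<sigma>. f \<sigma> * prod \<sigma> {b, v} * (\<sigma> u * \<sigma> b)) \<omega>"
      unfolding trace_weight_def
      by (intro sum.cong refl) (use bv spin_square_left in \<open>simp add: mult_ac\<close>)
    also have "\<dots> \<le> C ^ l * trace_weight J (\<lambda>\<sigma>. f \<sigma> * prod \<sigma> {b, v}) (\<omega> \<union> P)"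
      by (intro step positive_mult f positive_edge e \<omega>)
    also have "\<dots> \<le> C ^ l * (C * trace_weight J f (insert {b, v} (\<omega> \<union> P)))"
      by (intro mult_left_mono trace_weight_insert f J C e) (use \<omega> P \<open>0 \<le> C\<close> in auto)
    finally show ?thesis by (simp add: mult_ac)
  qed
  moreover have "card (insert {b, v} P) \<le> Suc l"
    using P(2) card_insert_le_m1[of "Suc l" P "{b, v}"] by simp
  moreover have "v \<in> cluster (insert {b, v} P) u"
    using P(3) cluster_mono[of P "insert {b, v} P" u] cluster_edge[of b v "insert {b, v} P"]
    by (auto intro: cluster_trans)
  ultimately show ?case using P(1) e by (intro exI[of _ "insert {b, v} P"]) simp
qed

end

text \<open>A set can be written as X \<union> P for at most 2^|P| sets X.\<close>

lemma sum_Pow_Un_le: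
  fixes g :: "'a set \<Rightarrow> real"
  assumes "finite A" "\<And>X. X \<subseteq> A \<Longrightarrow> 0 \<le> g X" "P \<subseteq> A"
  shows "(\<Sum>X\<in>Pow A. g (X \<union> P)) \<le> 2 ^ card P * (\<Sum>X\<in>Pow A. g X)"
proof -
  have ins: "(\<Sum>X\<in>Pow A. h (insert e X)) \<le> 2 * (\<Sum>X\<in>Pow A. h X)"
    if h: "\<And>X. X \<subseteq> A \<Longrightarrow> 0 \<le> h X" and e: "e \<in> A" for h :: "'a set \<Rightarrow> real" and e
  proof -
    define B where "B = A - {e}"
    have B: "finite B" "e \<notin> B" "A = insert e B" using e assms(1) by (auto simp: B_def)
    have "0 \<le> (\<Sum>X\<in>Pow B. h X)" using h B by (intro sum_nonneg) auto
    then show ?thesis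
      unfolding B(3) sum_Pow_insert[OF B(1,2)] by simp
  qed
  have "finite P" using assms finite_subset by blast
  then show ?thesis
    using assms(2,3)
  proof (induction arbitrary: g rule: finite_induct)
    case empty
    then show ?case by simp
  next
    case (insert e P)
    have "(\<Sum>X\<in>Pow A. g (X \<union> insert e P)) = (\<Sum>X\<in>Pow A. (\<lambda>Y. g (insert e Y)) (X \<union> P))" by simp
    also have "\<dots> \<le> 2 ^ card P * (\<Sum>X\<in>Pow A. g (insert e X))"
      using insert.prems by (intro insert.IH) auto
    also have "\<dots> \<le> 2 ^ card P * (2 * (\<Sum>X\<in>Pow A. g X))"
      using insert.prems by (intro mult_left_mono ins) auto
    finally show ?case using insert.hyps by simp
  qed
qed

context ising_graph
begin

text \<open>Local modification: adding the edges of a short walk from \<open>u\<close> to \<open>v\<close> turns a trace in which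
  \<open>u\<close> and \<open>v\<close> are sources into one that passes through \<open>u\<close>.\<close>

lemma through_lower:
  assumes J: "\<And>e. e \<in> E \<Longrightarrow> 0 \<le> J e" and "0 \<le> C"
    and C: "\<And>e. e \<in> E \<Longrightarrow> sinh (J e) \<le> C * (cosh (J e) - 1)"
      "\<And>e. e \<in> E \<Longrightarrow> cosh (J e) - 1 \<le> C * sinh (J e)" "\<And>e. e \<in> E \<Longrightarrow> 1 \<le> C * sinh (J e)"
    and walk: "((\<lambda>a b. {a, b} \<in> E) ^^ l) u v"
    and V: "x \<in> V" "y \<in> V" "u \<in> V" "v \<in> V"
  shows "fp J x y u v - tp J x y * tp J u v \<le> (2 * C) ^ l * through J x y u"
proof -
  let ?f = "\<lambda>\<sigma>. \<sigma> x * \<sigma> y * \<sigma> u * \<sigma> v"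
  let ?t = "trace_weight J (\<lambda>\<sigma>. \<sigma> x * \<sigma> y)"
  let ?g = "\<lambda>\<omega>. of_bool (u \<in> cluster \<omega> x) * ?t \<omega>"
  obtain P where P: "P \<subseteq> E" "card P \<le> l" "v \<in> cluster P u"
    and step: "\<forall>f \<omega>. positive f \<longrightarrow> \<omega> \<subseteq> E \<longrightarrow>
      trace_weight J (\<lambda>\<sigma>. f \<sigma> * (\<sigma> u * \<sigma> v)) \<omega> \<le> C ^ l * trace_weight J f (\<omega> \<union> P)"
  proof -
    have "\<exists>P\<subseteq>E. card P \<le> l \<and> v \<in> cluster P u \<and> (\<forall>f \<omega>. positive f \<longrightarrow> \<omega> \<subseteq> E \<longrightarrow>
        trace_weight J (\<lambda>\<sigma>. f \<sigma> * (\<sigma> u * \<sigma> v)) \<omega> \<le> C ^ l * trace_weight J f (\<omega> \<union> P))"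
      by (rule walk_trace[OF _ assms(2) _ _ _ walk V(3)]) (simp_all add: J C)
    then show thesis by (elim exE conjE) (rule that)
  qed
  have t: "0 \<le> ?t \<omega>" if "\<omega> \<subseteq> E" for \<omega>
    using that by (intro trace_weight_nonneg positive_two V J)
  have "Z J * (fp J x y u v - tp J x y * tp J u v) \<le>
      (\<Sum>\<omega>\<in>Pow E. of_bool (v \<notin> cluster \<omega> u) * trace_weight J ?f \<omega>)"
    by (rule truncated_bound[OF J V])
  also have "\<dots> \<le> (\<Sum>\<omega>\<in>Pow E. C ^ l * ?g (\<omega> \<union> P))"
  proof (rule sum_mono)
    fix \<omega> assume "\<omega> \<in> Pow E"
    then have \<omega>: "\<omega> \<subseteq> E" by simp
    have "0 \<le> C ^ l * ?g (\<omega> \<union> P)"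
      using \<open>0 \<le> C\<close> \<omega> P by (intro mult_nonneg_nonneg t) auto
    moreover have "trace_weight J ?f \<omega> \<le> C ^ l * ?t (\<omega> \<union> P)"
      using step[rule_format, OF positive_two[OF V(1,2)] \<omega>] by (simp add: mult.assoc)
    \<comment> \<open>Parity: every cluster contains an even number of the sources x, y, u, v. Here
      u and v are separated in \<omega> and x is joined to neither, so y can accompany only one of
      them and the other is left alone.\<close>
    moreover have "trace_weight J ?f \<omega> = 0"
      if v: "v \<notin> cluster \<omega> u" and u: "u \<notin> cluster (\<omega> \<union> P) x"
    proof -
      have "v \<in> cluster (\<omega> \<union> P) u" using P(3) cluster_mono[of P "\<omega> \<union> P" u] by auto
      then have "v \<notin> cluster (\<omega> \<union> P) x"
        using u cluster_trans[of v "\<omega> \<union> P" x u] cluster_sym[of v "\<omega> \<union> P" u] by auto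
      then have x: "x \<notin> cluster \<omega> u" "x \<notin> cluster \<omega> v"
        using u cluster_mono[of \<omega> "\<omega> \<union> P" x] cluster_sym[of x \<omega> u] cluster_sym[of x \<omega> v] by auto
      show ?thesis
      proof (cases "y \<in> cluster \<omega> u")
        case True
        then have "y \<notin> cluster \<omega> v" "u \<notin> cluster \<omega> v"
          using v True cluster_trans[of y \<omega> u v] cluster_sym[of y \<omega> v] cluster_sym[of u \<omega> v] by auto
        then show ?thesis
          by (intro trace_weight_odd[OF \<omega>, of _ v]) (use x V in \<open>simp add: flip_apply cluster_refl\<close>)
      next
        case False
        then show ?thesis
          by (intro trace_weight_odd[OF \<omega>, of _ u]) (use x v V in \<open>simp add: flip_apply cluster_refl\<close>)
      qed
    qed
    ultimately show "of_bool (v \<notin> cluster \<omega> u) * trace_weight J ?f \<omega> \<le> C ^ l * ?g (\<omega> \<union> P)"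
      by (cases "v \<in> cluster \<omega> u"; cases "u \<in> cluster (\<omega> \<union> P) x") auto
  qed
  also have "\<dots> \<le> C ^ l * (2 ^ card P * (\<Sum>\<omega>\<in>Pow E. ?g \<omega>))"
    unfolding sum_distrib_left[symmetric]
    by (intro mult_left_mono sum_Pow_Un_le finite_E P(1) mult_nonneg_nonneg t) (use \<open>0 \<le> C\<close> in auto)
  also have "\<dots> \<le> C ^ l * (2 ^ l * (\<Sum>\<omega>\<in>Pow E. ?g \<omega>))"
    using \<open>0 \<le> C\<close> P(2)
    by (intro mult_left_mono mult_right_mono power_increasing sum_nonneg mult_nonneg_nonneg t) auto
  also have "\<dots> = Z J * ((2 * C) ^ l * through J x y u)"
    using Z_pos[of J] unfolding through_def by (simp add: power_mult_distrib)
  finally show ?thesis using Z_pos[of J] by simp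
qed

end

lemma cluster_Un_disjoint:
  assumes "\<And>e. e \<in> \<omega>' \<Longrightarrow> e \<inter> cluster \<omega> x = {}"
  shows "cluster (\<omega> \<union> \<omega>') x = cluster \<omega> x"
proof
  show "cluster (\<omega> \<union> \<omega>') x \<subseteq> cluster \<omega> x"
  proof
    fix y assume "y \<in> cluster (\<omega> \<union> \<omega>') x"
    then have "(\<lambda>a b. {a, b} \<in> \<omega> \<union> \<omega>')\<^sup>*\<^sup>* x y" by (simp add: cluster_def)
    then show "y \<in> cluster \<omega> x"
    proof (induction rule: rtranclp_induct)
      case base
      show ?case by (rule cluster_refl)
    next
      case (step a b)
      then have "{a, b} \<in> \<omega>" using assms[of "{a, b}"] by auto
      then show ?case using step.IH cluster_edge[of a b \<omega>] by (blast intro: cluster_trans)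
    qed
  qed
qed (rule cluster_mono, simp)

lemma cluster_restrict: "cluster {e \<in> \<omega>. e \<subseteq> cluster \<omega> x} x = cluster \<omega> x"
proof
  show "cluster \<omega> x \<subseteq> cluster {e \<in> \<omega>. e \<subseteq> cluster \<omega> x} x"
  proof
    fix y assume "y \<in> cluster \<omega> x"
    then have "(\<lambda>a b. {a, b} \<in> \<omega>)\<^sup>*\<^sup>* x y" by (simp add: cluster_def)
    then show "y \<in> cluster {e \<in> \<omega>. e \<subseteq> cluster \<omega> x} x"
    proof (induction rule: rtranclp_induct)
      case base
      show ?case by (rule cluster_refl)
    next
      case (step a b)
      have a: "a \<in> cluster \<omega> x" using step.hyps(1) by (simp add: cluster_def)
      then have "b \<in> cluster \<omega> x" using step.hyps(2) cluster_edge[of a b \<omega>] by (blast intro: cluster_trans)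
      then have "b \<in> cluster {e \<in> \<omega>. e \<subseteq> cluster \<omega> x} a"
        using a step.hyps(2) by (intro cluster_edge) auto
      then show ?case using step.IH by (blast intro: cluster_trans)
    qed
  qed
qed (rule cluster_mono, auto)

context ising_graph
begin

subsection \<open>Decomposition according to a cluster\<close>

abbreviation avoiding :: "'v set \<Rightarrow> 'v set set" where
  "avoiding C \<equiv> {e \<in> E. e \<inter> C = {}}"

abbreviation spanning :: "'v \<Rightarrow> 'v set \<Rightarrow> 'v set set set" where
  "spanning x C \<equiv> {\<omega>. \<omega> \<subseteq> {e \<in> E. e \<subseteq> C} \<and> cluster \<omega> x = C}"

text \<open>An edge between C and its complement would enlarge the cluster. Hence \<omega> splits
  into edges inside C, which have to span it, and edges avoiding C, which are free and resum to a
  product.\<close>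

lemma sum_fixed_cluster:
  fixes g :: "'v set \<Rightarrow> real"
  shows "(\<Sum>\<omega> | \<omega> \<subseteq> E \<and> cluster \<omega> x = C. \<Prod>e\<in>\<omega>. g e) =
    (\<Sum>\<omega>\<in>spanning x C. \<Prod>e\<in>\<omega>. g e) * (\<Prod>e\<in>avoiding C. 1 + g e)"
proof -
  have fin: "finite \<omega>" if "\<omega> \<subseteq> E" for \<omega> using that finite_E finite_subset by blast
  have "(\<Prod>e\<in>avoiding C. 1 + g e) = (\<Sum>\<omega>\<in>Pow (avoiding C). \<Prod>e\<in>\<omega>. g e)"
    using prod_add[of "avoiding C" g "\<lambda>_. 1"] finite_E by (simp add: add.commute)
  then have "(\<Sum>\<omega>\<in>spanning x C. \<Prod>e\<in>\<omega>. g e) * (\<Prod>e\<in>avoiding C. 1 + g e) =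
      (\<Sum>(\<omega>, \<omega>')\<in>spanning x C \<times> Pow (avoiding C). prod g \<omega> * prod g \<omega>')"
    by (simp add: sum_product sum.cartesian_product)
  also have "\<dots> = (\<Sum>\<omega> | \<omega> \<subseteq> E \<and> cluster \<omega> x = C. \<Prod>e\<in>\<omega>. g e)"
  proof (rule sum.reindex_bij_witness[where i = "\<lambda>\<omega>. ({e \<in> \<omega>. e \<subseteq> C}, {e \<in> \<omega>. e \<inter> C = {}})"
        and j = "\<lambda>(\<omega>, \<omega>'). \<omega> \<union> \<omega>'"])
    fix p assume p: "p \<in> spanning x C \<times> Pow (avoiding C)"
    obtain \<omega> \<omega>' where eq: "p = (\<omega>, \<omega>')" by (cases p)
    have \<omega>: "\<omega> \<subseteq> E" "\<And>e. e \<in> \<omega> \<Longrightarrow> e \<subseteq> C" "cluster \<omega> x = C" and \<omega>': "\<omega>' \<subseteq> E" "\<And>e. e \<in> \<omega>' \<Longrightarrow> e \<inter> C = {}"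
      using p eq by auto
    have ne: "e \<noteq> {}" if "e \<in> E" for e using edge[OF that] by auto
    have dis: "\<omega> \<inter> \<omega>' = {}"
    proof -
      have False if "e \<in> \<omega>" "e \<in> \<omega>'" for e
        using \<omega>(2)[OF that(1)] \<omega>'(2)[OF that(2)] ne[of e] \<omega>(1) that by auto
      then show ?thesis by auto
    qed
    have "{e \<in> \<omega> \<union> \<omega>'. e \<subseteq> C} = \<omega>"
    proof -
      have False if "e \<in> \<omega>'" "e \<subseteq> C" for e using that \<omega>'(2)[OF that(1)] ne[of e] \<omega>'(1) by auto
      then show ?thesis using \<omega>(2) by auto
    qed
    moreover have "{e \<in> \<omega> \<union> \<omega>'. e \<inter> C = {}} = \<omega>'"
    proof -
      have False if "e \<in> \<omega>" "e \<inter> C = {}" for e using that \<omega>(2)[OF that(1)] ne[of e] \<omega>(1) by auto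
      then show ?thesis using \<omega>'(2) by auto
    qed
    ultimately show "({e \<in> (case p of (\<omega>, \<omega>') \<Rightarrow> \<omega> \<union> \<omega>'). e \<subseteq> C}, {e \<in> (case p of (\<omega>, \<omega>') \<Rightarrow> \<omega> \<union> \<omega>'). e \<inter> C = {}}) = p"
      by (simp add: eq)
    have "cluster (\<omega> \<union> \<omega>') x = cluster \<omega> x" by (rule cluster_Un_disjoint) (simp add: \<omega>(3) \<omega>'(2))
    then show "(case p of (\<omega>, \<omega>') \<Rightarrow> \<omega> \<union> \<omega>') \<in> {\<omega>. \<omega> \<subseteq> E \<and> cluster \<omega> x = C}"
      using \<omega> \<omega>' by (simp add: eq)
    show "prod g (case p of (\<omega>, \<omega>') \<Rightarrow> \<omega> \<union> \<omega>') = (case p of (\<omega>, \<omega>') \<Rightarrow> prod g \<omega> * prod g \<omega>')"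
      using prod.union_disjoint[OF fin[OF \<omega>(1)] fin[OF \<omega>'(1)] dis, of g] by (simp add: eq)
  next
    fix \<omega> assume "\<omega> \<in> {\<omega>. \<omega> \<subseteq> E \<and> cluster \<omega> x = C}"
    then have \<omega>: "\<omega> \<subseteq> E" "cluster \<omega> x = C" by auto
    have "e \<subseteq> C \<or> e \<inter> C = {}" if "e \<in> \<omega>" for e
      using cluster_closed[OF \<omega>(1) that, of x] \<omega>(2) by simp
    then show "(case ({e \<in> \<omega>. e \<subseteq> C}, {e \<in> \<omega>. e \<inter> C = {}}) of (\<omega>, \<omega>') \<Rightarrow> \<omega> \<union> \<omega>') = \<omega>" by auto
    show "({e \<in> \<omega>. e \<subseteq> C}, {e \<in> \<omega>. e \<inter> C = {}}) \<in> spanning x C \<times> Pow (avoiding C)"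
      using cluster_restrict[of \<omega> x] \<omega> by auto
  qed
  finally show ?thesis ..
qed

definition merge :: "'v set \<Rightarrow> ('v \<Rightarrow> real) \<Rightarrow> ('v \<Rightarrow> real) \<Rightarrow> 'v \<Rightarrow> real" where
  "merge C a b = (\<lambda>v\<in>V. if v \<in> C then a v else b v)"

lemma merge_conf:
  assumes "a \<in> conf" "b \<in> conf"
  shows "merge C a b \<in> conf"
proof -
  have "(if v \<in> C then a v else b v) \<in> {-1, 1}" if "v \<in> V" for v
    using conf_values[OF assms(1) that] conf_values[OF assms(2) that] by auto
  then show ?thesis unfolding conf_def merge_def by (simp add: restrict_PiE_iff)
qed

lemma merge_merge:
  assumes "a \<in> conf"
  shows "merge C (merge C a b) (merge C b a) = a"
proof
  fix v
  show "merge C (merge C a b) (merge C b a) v = a v"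
    using assms PiE_arb[of a V "\<lambda>_. {-1, 1}" v] by (cases "v \<in> V") (simp_all add: merge_def conf_def)
qed

text \<open>Exchanging the values off C between two configurations is an involution on
  pairs.\<close>

lemma sum_merge:
  "(\<Sum>a\<in>conf. \<Sum>b\<in>conf. H (merge C a b)) = real (card conf) * (\<Sum>a\<in>conf. H a)"
proof -
  have "(\<Sum>(a, b)\<in>conf \<times> conf. H (merge C a b)) = (\<Sum>(a, b)\<in>conf \<times> conf. H a)"
    by (rule sum.reindex_bij_witness[where i = "\<lambda>(a, b). (merge C a b, merge C b a)"
          and j = "\<lambda>(a, b). (merge C a b, merge C b a)"]) (auto simp: merge_conf merge_merge)
  then show ?thesis by (simp add: sum.cartesian_product[symmetric] sum_distrib_left)
qed

text \<open>All configurations live on the whole of V, so independence of the spins on C and off C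
  is expressed by merging configurations; the discarded halves account for the factor
  \<open>card conf\<close> squared.\<close>

lemma sum_conf_independent:
  fixes F G :: "('v \<Rightarrow> real) \<Rightarrow> ('v \<Rightarrow> real) \<Rightarrow> real"
  assumes F: "\<And>s s' t t'. (\<And>v. v \<in> V \<Longrightarrow> v \<in> C \<Longrightarrow> s v = s' v \<and> t v = t' v) \<Longrightarrow> F s t = F s' t'"
    and G: "\<And>s s' t t'. (\<And>v. v \<in> V \<Longrightarrow> v \<notin> C \<Longrightarrow> s v = s' v \<and> t v = t' v) \<Longrightarrow> G s t = G s' t'"
  shows "(\<Sum>s\<in>conf. \<Sum>t\<in>conf. F s t) * (\<Sum>s\<in>conf. \<Sum>t\<in>conf. G s t) =
    (real (card conf))\<^sup>2 * (\<Sum>s\<in>conf. \<Sum>t\<in>conf. F s t * G s t)"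
proof -
  let ?H = "\<lambda>s t. F s t * G s t"
  have eq: "F s t * G s' t' = ?H (merge C s s') (merge C t t')" for s t s' t'
    using F[of s "merge C s s'" t "merge C t t'"] G[of s' "merge C s s'" t' "merge C t t'"]
    by (simp add: merge_def)
  have "(\<Sum>s\<in>conf. \<Sum>t\<in>conf. F s t) * (\<Sum>s\<in>conf. \<Sum>t\<in>conf. G s t) =
      (\<Sum>s\<in>conf. \<Sum>s'\<in>conf. \<Sum>t\<in>conf. \<Sum>t'\<in>conf. F s t * G s' t')"
    by (simp only: sum_product)
  also have "\<dots> = (\<Sum>s\<in>conf. \<Sum>s'\<in>conf. \<Sum>t\<in>conf. \<Sum>t'\<in>conf. ?H (merge C s s') (merge C t t'))"
    by (intro sum.cong refl eq)
  also have "\<dots> = real (card conf) * (\<Sum>s\<in>conf. \<Sum>s'\<in>conf. \<Sum>t\<in>conf. ?H (merge C s s') t)"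
    by (simp only: sum_merge[where H = "\<lambda>t. ?H _ t"] sum_distrib_left)
  also have "\<dots> = (real (card conf))\<^sup>2 * (\<Sum>s\<in>conf. \<Sum>t\<in>conf. ?H s t)"
    by (simp only: sum_merge[where H = "\<lambda>s. \<Sum>t\<in>conf. ?H s t"] power2_eq_square mult.assoc)
  finally show ?thesis .
qed

text \<open>This is the model with the vertices of C removed, except that they stay as free spins,
  which does not affect correlations outside C.\<close>

definition off :: "('v set \<Rightarrow> real) \<Rightarrow> 'v set \<Rightarrow> 'v set \<Rightarrow> real" where
  "off J C e = (if e \<inter> C = {} then J e else 0)"

definition cluster_weight ::
    "('v set \<Rightarrow> real) \<Rightarrow> 'v \<Rightarrow> 'v set \<Rightarrow> (('v \<Rightarrow> real) \<Rightarrow> ('v \<Rightarrow> real) \<Rightarrow> real) \<Rightarrow> real" where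
  "cluster_weight J x C f = (\<Sum>\<omega> | \<omega> \<subseteq> E \<and> cluster \<omega> x = C. double_weight J f \<omega>)"

text \<open>The part of the weight that lives inside C. The denominator makes up for the free spins,
  off C in this sum and on C in the complementary factor.\<close>

definition core :: "('v set \<Rightarrow> real) \<Rightarrow> 'v \<Rightarrow> 'v \<Rightarrow> 'v set \<Rightarrow> real" where
  "core J x y C = (\<Sum>s\<in>conf. \<Sum>t\<in>conf. s x * s y *
     (\<Sum>\<omega>\<in>spanning x C. \<Prod>e\<in>\<omega>. exp (J e * (prod s e + prod t e)) - 1)) / (real (card conf))\<^sup>2"

text \<open>Resumming the edges that avoid C restores the Boltzmann weight of
  \<open>off J C\<close>; the spins on C and off C are then independent.\<close>

lemma cluster_weight_factor:
  assumes V: "x \<in> C" "y \<in> C"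
    and f: "\<And>s s' t t'. (\<And>v. v \<in> V \<Longrightarrow> v \<notin> C \<Longrightarrow> s v = s' v \<and> t v = t' v) \<Longrightarrow> f s t = f s' t'"
    and C: "C \<subseteq> V"
  shows "cluster_weight J x C (\<lambda>s t. s x * s y * f s t) =
    core J x y C * (\<Sum>s\<in>conf. \<Sum>t\<in>conf. f s t * exp (\<Sum>e\<in>E. off J C e * (prod s e + prod t e)))"
proof -
  let ?g = "\<lambda>s t e. exp (J e * (prod s e + prod t e)) - 1"
  let ?K = "\<lambda>s t. \<Sum>\<omega>\<in>spanning x C. \<Prod>e\<in>\<omega>. ?g s t e"
  let ?X = "\<lambda>s t. exp (\<Sum>e\<in>E. off J C e * (prod s e + prod t e))"
  have X: "(\<Prod>e\<in>avoiding C. 1 + ?g s t e) = ?X s t" for s t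
  proof -
    have "?X s t = (\<Prod>e\<in>E. if e \<inter> C = {} then 1 + ?g s t e else 1)"
      unfolding exp_sum[OF finite_E] by (intro prod.cong refl) (simp add: off_def)
    then show ?thesis by (simp only: prod.inter_filter[OF finite_E])
  qed
  have edge_eq: "prod s e = prod s' e" if "e \<in> E" "\<And>v. v \<in> e \<Longrightarrow> s v = s' v" for s s' :: "'v \<Rightarrow> real" and e
    using that(2) by (rule prod.cong[OF refl])
  have "cluster_weight J x C (\<lambda>s t. s x * s y * f s t) =
      (\<Sum>s\<in>conf. \<Sum>t\<in>conf. s x * s y * f s t * (\<Sum>\<omega> | \<omega> \<subseteq> E \<and> cluster \<omega> x = C. \<Prod>e\<in>\<omega>. ?g s t e))"
    unfolding cluster_weight_def double_weight_def sum_distrib_left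
    by (subst sum.swap) (intro sum.cong refl sum.swap)
  also have "\<dots> = (\<Sum>s\<in>conf. \<Sum>t\<in>conf. (s x * s y * ?K s t) * (f s t * ?X s t))"
    unfolding sum_fixed_cluster X by (simp only: mult_ac)
  finally have 1: "cluster_weight J x C (\<lambda>s t. s x * s y * f s t) =
    (\<Sum>s\<in>conf. \<Sum>t\<in>conf. (s x * s y * ?K s t) * (f s t * ?X s t))" .
  have 2: "(\<Sum>s\<in>conf. \<Sum>t\<in>conf. s x * s y * ?K s t) * (\<Sum>s\<in>conf. \<Sum>t\<in>conf. f s t * ?X s t) =
    (real (card conf))\<^sup>2 * (\<Sum>s\<in>conf. \<Sum>t\<in>conf. (s x * s y * ?K s t) * (f s t * ?X s t))"
  proof (rule sum_conf_independent[where C = C])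
    fix s s' t t' :: "'v \<Rightarrow> real"
    assume eq: "\<And>v. v \<in> V \<Longrightarrow> v \<in> C \<Longrightarrow> s v = s' v \<and> t v = t' v"
    have "?g s t e = ?g s' t' e" if "e \<in> \<omega>" "\<omega> \<in> spanning x C" for e \<omega>
    proof -
      have "e \<in> E" "e \<subseteq> C" using that by auto
      then have "prod s e = prod s' e" "prod t e = prod t' e"
        using eq C by (intro edge_eq; blast)+
      then show ?thesis by simp
    qed
    then have "?K s t = ?K s' t'" by (intro sum.cong prod.cong refl) auto
    moreover have "s x = s' x" "s y = s' y" using eq V C by auto
    ultimately show "s x * s y * ?K s t = s' x * s' y * ?K s' t'" by simp
  next
    fix s s' t t' :: "'v \<Rightarrow> real"
    assume eq: "\<And>v. v \<in> V \<Longrightarrow> v \<notin> C \<Longrightarrow> s v = s' v \<and> t v = t' v"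
    have "off J C e * (prod s e + prod t e) = off J C e * (prod s' e + prod t' e)" if e: "e \<in> E" for e
    proof (cases "e \<inter> C = {}")
      case True
      have "prod s e = prod s' e" "prod t e = prod t' e"
        using eq edge[OF e] True by (intro edge_eq e; blast)+
      then show ?thesis by simp
    qed (simp add: off_def)
    then have "(\<Sum>e\<in>E. off J C e * (prod s e + prod t e)) = (\<Sum>e\<in>E. off J C e * (prod s' e + prod t' e))"
      by (rule sum.cong[OF refl])
    then have "?X s t = ?X s' t'" by simp
    then show "f s t * ?X s t = f s' t' * ?X s' t'" using f[OF eq] by simp
  qed
  have "card conf \<noteq> 0" using finite_conf conf_nonempty by simp
  then show ?thesis using 1 2 unfolding core_def by (simp add: field_simps)
qed

lemma double_part:
  "(\<Sum>s\<in>conf. \<Sum>t\<in>conf. f s * h t * exp (\<Sum>e\<in>E. J e * (prod s e + prod t e))) = part J f * part J h"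
  unfolding part_def sum_product
  by (intro sum.cong refl) (simp add: exp_add distrib_left sum.distrib mult_ac)

text \<open>The two observables read off the first and the second power of the correlation outside
  C; together they allow a square to be completed.\<close>

lemma cluster_weight_uv:
  assumes "x \<in> C" "y \<in> C" "C \<subseteq> V" "u \<notin> C" "v \<notin> C" "u \<in> V" "v \<in> V"
  shows "cluster_weight J x C (\<lambda>s t. s x * s y * (t u * t v)) =
      core J x y C * (Z (off J C))\<^sup>2 * tp (off J C) u v" (is ?A)
    and "cluster_weight J x C (\<lambda>s t. s x * s y * s u * s v * (t u * t v)) =
      core J x y C * (Z (off J C))\<^sup>2 * (tp (off J C) u v)\<^sup>2" (is ?B)
proof -
  have "cluster_weight J x C (\<lambda>s t. s x * s y * (1 * (t u * t v))) =
      core J x y C * (part (off J C) (\<lambda>_. 1) * part (off J C) (\<lambda>\<sigma>. \<sigma> u * \<sigma> v))"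
    by (subst cluster_weight_factor) (use assms in \<open>simp_all add: double_part flip: double_part\<close>)
  then show ?A using Z_pos[of "off J C"] by (simp add: ev_def power2_eq_square)
  have "cluster_weight J x C (\<lambda>s t. s x * s y * ((s u * s v) * (t u * t v))) =
      core J x y C * (part (off J C) (\<lambda>\<sigma>. \<sigma> u * \<sigma> v) * part (off J C) (\<lambda>\<sigma>. \<sigma> u * \<sigma> v))"
    unfolding double_part[symmetric] by (rule cluster_weight_factor) (use assms in simp_all)
  then show ?B using Z_pos[of "off J C"] by (simp add: ev_def power2_eq_square mult.assoc)
qed

lemma cluster_weight_core:
  assumes "x \<in> C" "y \<in> C" "C \<subseteq> V"
  shows "cluster_weight J x C (\<lambda>s t. s x * s y) = core J x y C * (Z (off J C))\<^sup>2"
proof -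
  have "cluster_weight J x C (\<lambda>s t. s x * s y * ((\<lambda>s t. 1 * 1) s t)) =
      core J x y C * (part (off J C) (\<lambda>_. 1) * part (off J C) (\<lambda>_. 1))"
    unfolding double_part[symmetric] by (rule cluster_weight_factor) (use assms in simp_all)
  then show ?thesis by (simp add: power2_eq_square)
qed

lemma sum_cluster_weight:
  assumes "x \<in> V"
  shows "(\<Sum>C\<in>Pow V. c C * cluster_weight J x C f) = (\<Sum>\<omega>\<in>Pow E. c (cluster \<omega> x) * double_weight J f \<omega>)"
proof -
  have "(\<Sum>\<omega>\<in>Pow E. c (cluster \<omega> x) * double_weight J f \<omega>) =
      (\<Sum>C\<in>Pow V. \<Sum>\<omega> | \<omega> \<in> Pow E \<and> cluster \<omega> x = C. c (cluster \<omega> x) * double_weight J f \<omega>)"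
    by (rule sum.group[symmetric]) (use finite_E finite_V cluster_subset assms in auto)
  also have "\<dots> = (\<Sum>C\<in>Pow V. c C * cluster_weight J x C f)"
    unfolding cluster_weight_def sum_distrib_left by (intro sum.cong refl) auto
  finally show ?thesis ..
qed

lemma cluster_weight_zero:
  assumes "x \<in> V" "y \<in> V" "y \<notin> C"
  shows "cluster_weight J x C (\<lambda>s t. s x * s y) = 0"
  unfolding cluster_weight_def
proof (rule sum.neutral, clarify)
  fix \<omega> assume "\<omega> \<subseteq> E" "C = cluster \<omega> x"
  then show "double_weight J (\<lambda>s t. s x * s y) \<omega> = 0"
    by (intro double_weight_odd[of _ _ x]) (use assms in \<open>simp_all add: flip_apply cluster_refl\<close>)
qed

section \<open>The cluster of the sources in a double trace\<close>

text \<open>Weight with which C is the cluster of x in the superposition of a trace with sources x,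
  y and a sourceless one. The normalisation gives total mass <xy>, not 1.\<close>

definition nu :: "('v set \<Rightarrow> real) \<Rightarrow> 'v \<Rightarrow> 'v \<Rightarrow> 'v set \<Rightarrow> real" where
  "nu J x y C = cluster_weight J x C (\<lambda>s t. s x * s y) / (Z J)\<^sup>2"

lemma nu_nonneg:
  assumes "\<And>e. e \<in> E \<Longrightarrow> 0 \<le> J e" "x \<in> V" "y \<in> V"
  shows "0 \<le> nu J x y C"
proof -
  have "0 \<le> double_weight J (\<lambda>s t. s x * s y) \<omega>" if "\<omega> \<subseteq> E" for \<omega>
    using double_weight_nonneg[OF positive_two[OF assms(2,3)] positive_const[of 1] assms(1) that] by simp
  then show ?thesis
    unfolding nu_def cluster_weight_def by (intro divide_nonneg_nonneg sum_nonneg) auto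
qed

lemma sum_nu:
  assumes "x \<in> V"
  shows "(\<Sum>C\<in>Pow V. nu J x y C) = tp J x y"
proof -
  have "(\<Sum>C\<in>Pow V. 1 * cluster_weight J x C (\<lambda>s t. s x * s y)) =
      part J (\<lambda>\<sigma>. \<sigma> x * \<sigma> y) * Z J"
    unfolding sum_cluster_weight[OF assms] part_mult_traces by simp
  then show ?thesis
    using Z_pos[of J] by (simp add: nu_def ev_def power2_eq_square flip: sum_divide_distrib)
qed

lemma sum_nu_through:
  assumes V: "x \<in> V" "y \<in> V" "u \<in> V"
  shows "(\<Sum>C\<in>Pow V. of_bool (u \<in> C) * nu J x y C) = tp J x u * tp J u y"
proof -
  have "(\<Sum>C\<in>Pow V. of_bool (u \<in> C) * cluster_weight J x C (\<lambda>s t. s x * s y)) =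
      part J (\<lambda>\<sigma>. \<sigma> x * \<sigma> u) * part J (\<lambda>\<sigma>. \<sigma> u * \<sigma> y)"
    unfolding sum_cluster_weight[OF V(1)] part_mult_traces
    by (intro sum.cong refl) (simp add: switch_left V)
  then show ?thesis
    using Z_pos[of J] by (simp add: nu_def ev_def power2_eq_square flip: sum_divide_distrib)
qed

text \<open>Only clusters that contain y and avoid u and v contribute to \<open>ursell_obs\<close>;
  given such a cluster C, the sources u and v of the second copy see the model with C
  removed.\<close>

lemma sum_nu_outside:
  assumes V: "x \<in> V" "y \<in> V" "u \<in> V" "v \<in> V"
  shows "fp J x y u v + tp J x y * tp J u v - tp J x u * tp J y v - tp J x v * tp J y u =
    2 * (\<Sum>C\<in>Pow V. of_bool (u \<notin> C \<and> v \<notin> C) * nu J x y C * tp (off J C) u v)"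
proof -
  let ?d = "double_weight J (\<lambda>s t. s x * s y * (t u * t v))"
  let ?c = "\<lambda>C. of_bool (y \<in> C \<and> u \<notin> C \<and> v \<notin> C)"
  have "(Z J)\<^sup>2 * (fp J x y u v + tp J x y * tp J u v - tp J x u * tp J y v - tp J x v * tp J y u)
      = (\<Sum>\<omega>\<in>Pow E. double_weight J (ursell_obs x y u v) \<omega>)"
    by (rule part_ursell_obs)
  also have "\<dots> = 2 * (\<Sum>\<omega>\<in>Pow E. ?c (cluster \<omega> x) * ?d \<omega>)"
    unfolding sum_distrib_left
  proof (intro sum.cong refl)
    fix \<omega> assume "\<omega> \<in> Pow E"
    then have \<omega>: "\<omega> \<subseteq> E" by simp
    show "double_weight J (ursell_obs x y u v) \<omega> = 2 * (?c (cluster \<omega> x) * ?d \<omega>)"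
    proof (cases "u \<in> cluster \<omega> y \<or> v \<in> cluster \<omega> y")
      case True
      have "\<not> (y \<in> cluster \<omega> x \<and> u \<notin> cluster \<omega> x \<and> v \<notin> cluster \<omega> x)"
        using True cluster_trans[of y \<omega> x u] cluster_trans[of y \<omega> x v] by auto
      then show ?thesis using ursell_obs_connected[OF \<omega> V True, of J] by simp
    next
      case False
      then have "double_weight J (ursell_obs x y u v) \<omega> = (if y \<in> cluster \<omega> x then 2 * ?d \<omega> else 0)"
        using ursell_obs_disconnected[OF \<omega> V, of J] by blast
      moreover have "u \<notin> cluster \<omega> x \<and> v \<notin> cluster \<omega> x" if "y \<in> cluster \<omega> x"
        using False cluster_eq[OF that] by simp
      ultimately show ?thesis by auto
    qed
  qed
  also have "(\<Sum>\<omega>\<in>Pow E. ?c (cluster \<omega> x) * ?d \<omega>) =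
      (\<Sum>C\<in>Pow V. ?c C * cluster_weight J x C (\<lambda>s t. s x * s y * (t u * t v)))"
    by (rule sum_cluster_weight[OF V(1), symmetric])
  also have "\<dots> = (\<Sum>C\<in>Pow V. (Z J)\<^sup>2 * (of_bool (u \<notin> C \<and> v \<notin> C) * nu J x y C * tp (off J C) u v))"
  proof (intro sum.cong refl)
    fix C assume C: "C \<in> Pow V"
    show "?c C * cluster_weight J x C (\<lambda>s t. s x * s y * (t u * t v)) =
        (Z J)\<^sup>2 * (of_bool (u \<notin> C \<and> v \<notin> C) * nu J x y C * tp (off J C) u v)"
    proof (cases "x \<in> C")
      case False
      then have "{\<omega>. \<omega> \<subseteq> E \<and> cluster \<omega> x = C} = {}" using cluster_refl[of x] by blast
      then have "cluster_weight J x C f = 0" for f by (simp only: cluster_weight_def sum.empty)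
      then show ?thesis by (simp add: nu_def)
    next
      case True
      show ?thesis
      proof (cases "y \<in> C \<and> u \<notin> C \<and> v \<notin> C")
        case y: True
        then show ?thesis
          using True C Z_pos[of J] V
          by (simp add: nu_def cluster_weight_uv(1)[of x C y u v J] cluster_weight_core)
      next
        case False
        then show ?thesis
          using cluster_weight_zero[OF V(1,2), of C J] by (auto simp: nu_def)
      qed
    qed
  qed
  finally show ?thesis
    using Z_pos[of J] unfolding sum_distrib_left[symmetric] by simp
qed

text \<open>The observable is s_x s_y times the values of s t at u and v. If both vertices lie in
  the cluster of x these values agree and drop out; if exactly one does, flipping \<open>t\<close>
  on the cluster of the other changes the sign.\<close>

lemma switch_four:
  assumes \<omega>: "\<omega> \<subseteq> E" and V: "x \<in> V" "y \<in> V" "u \<in> V" "v \<in> V"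
  shows "double_weight J (\<lambda>s t. s x * s y * s u * s v * (t u * t v)) \<omega> =
    of_bool (u \<in> cluster \<omega> x \<and> v \<in> cluster \<omega> x) * double_weight J (\<lambda>s t. s x * s y) \<omega> +
    of_bool (u \<notin> cluster \<omega> x \<and> v \<notin> cluster \<omega> x) *
      double_weight J (\<lambda>s t. s x * s y * s u * s v * (t u * t v)) \<omega>"
proof -
  let ?f = "\<lambda>s t. s x * s y * s u * s v * (t u * t v)"
  consider "u \<in> cluster \<omega> x" "v \<in> cluster \<omega> x" | "u \<in> cluster \<omega> x" "v \<notin> cluster \<omega> x"
    | "u \<notin> cluster \<omega> x" "v \<in> cluster \<omega> x" | "u \<notin> cluster \<omega> x" "v \<notin> cluster \<omega> x" by blast
  then show ?thesis
  proof cases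
    case 1
    have "double_weight J ?f \<omega> = double_weight J (\<lambda>s t. s x * s y) \<omega>"
    proof (rule double_weight_cong[OF \<omega>])
      fix s t assume st: "s \<in> conf" "t \<in> conf"
        and c: "\<And>a b. a \<in> V \<Longrightarrow> b \<in> cluster \<omega> a \<Longrightarrow> s a * t a = s b * t b"
      have "s u * t u = s v * t v" using c[OF V(1) 1(1)] c[OF V(1) 1(2)] by simp
      moreover have "?f s t = s x * s y * ((s u * t u) * (s v * t v))" by simp
      moreover have "(s v * t v) * (s v * t v) = 1"
        using spin_square[OF st(1) V(4)] spin_square[OF st(2) V(4)] by algebra
      ultimately show "?f s t = s x * s y" by simp
    qed
    then show ?thesis using 1 by simp
  next
    case 2
    then have "u \<notin> cluster \<omega> v"
      using cluster_trans[of u \<omega> x v] cluster_sym[of u \<omega> v] by auto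
    then have "double_weight J ?f \<omega> = 0"
      by (intro double_weight_odd_right[OF \<omega>, of _ v]) (use V in \<open>simp add: flip_apply cluster_refl\<close>)
    then show ?thesis using 2 by simp
  next
    case 3
    then have "v \<notin> cluster \<omega> u"
      using cluster_trans[of v \<omega> x u] cluster_sym[of v \<omega> u] by auto
    then have "double_weight J ?f \<omega> = 0"
      by (intro double_weight_odd_right[OF \<omega>, of _ u]) (use V in \<open>simp add: flip_apply cluster_refl\<close>)
    then show ?thesis using 3 by simp
  next
    case 4
    then show ?thesis by simp
  qed
qed

text \<open>The square arises because off C both copies carry the sources u and v and are
  independent given C.\<close>

lemma sum_nu_two:
  assumes V: "x \<in> V" "y \<in> V" "u \<in> V" "v \<in> V"
  shows "fp J x y u v * tp J u v = (\<Sum>C\<in>Pow V. of_bool (u \<in> C \<and> v \<in> C) * nu J x y C) +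
    (\<Sum>C\<in>Pow V. of_bool (u \<notin> C \<and> v \<notin> C) * nu J x y C * (tp (off J C) u v)\<^sup>2)"
proof -
  let ?f = "\<lambda>s t. s x * s y * s u * s v * (t u * t v)"
  let ?d = "double_weight J ?f"
  have f0: "double_weight J ?f \<omega> = 0" if "\<omega> \<subseteq> E" "y \<notin> cluster \<omega> x" for \<omega>
    by (rule double_weight_odd[OF that(1), of _ x]) (use that(2) V in \<open>simp add: flip_apply cluster_refl\<close>)
  have "(Z J)\<^sup>2 * (fp J x y u v * tp J u v) = (\<Sum>\<omega>\<in>Pow E. ?d \<omega>)"
    using Z_pos[of J] unfolding ev_def part_mult_traces[symmetric]
    by (simp add: power2_eq_square)
  also have "\<dots> = (\<Sum>\<omega>\<in>Pow E. of_bool (u \<in> cluster \<omega> x \<and> v \<in> cluster \<omega> x) * double_weight J (\<lambda>s t. s x * s y) \<omega>) +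
      (\<Sum>\<omega>\<in>Pow E. of_bool (u \<notin> cluster \<omega> x \<and> v \<notin> cluster \<omega> x) * ?d \<omega>)"
    unfolding sum.distrib[symmetric] by (intro sum.cong refl switch_four V) simp
  also have "\<dots> = (\<Sum>C\<in>Pow V. of_bool (u \<in> C \<and> v \<in> C) * cluster_weight J x C (\<lambda>s t. s x * s y)) +
      (\<Sum>C\<in>Pow V. of_bool (u \<notin> C \<and> v \<notin> C) * cluster_weight J x C ?f)"
    by (simp only: sum_cluster_weight[OF V(1), of "\<lambda>C. of_bool (u \<in> C \<and> v \<in> C)"]
        sum_cluster_weight[OF V(1), of "\<lambda>C. of_bool (u \<notin> C \<and> v \<notin> C)"])
  also have "(\<Sum>C\<in>Pow V. of_bool (u \<notin> C \<and> v \<notin> C) * cluster_weight J x C ?f) =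
      (\<Sum>C\<in>Pow V. (Z J)\<^sup>2 * (of_bool (u \<notin> C \<and> v \<notin> C) * nu J x y C * (tp (off J C) u v)\<^sup>2))"
  proof (intro sum.cong refl)
    fix C assume C: "C \<in> Pow V"
    show "of_bool (u \<notin> C \<and> v \<notin> C) * cluster_weight J x C ?f =
        (Z J)\<^sup>2 * (of_bool (u \<notin> C \<and> v \<notin> C) * nu J x y C * (tp (off J C) u v)\<^sup>2)"
    proof (cases "x \<in> C")
      case False
      then have "{\<omega>. \<omega> \<subseteq> E \<and> cluster \<omega> x = C} = {}" using cluster_refl[of x] by blast
      then have "cluster_weight J x C f = 0" for f by (simp only: cluster_weight_def sum.empty)
      then show ?thesis by (simp add: nu_def)
    next
      case True
      consider "y \<in> C" "u \<notin> C" "v \<notin> C" | "\<not> (u \<notin> C \<and> v \<notin> C)" | "y \<notin> C" by blast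
      then show ?thesis
      proof cases
        case 1
        then show ?thesis
          using True C Z_pos[of J] V
          by (simp add: nu_def cluster_weight_uv(2)[of x C y u v J] cluster_weight_core)
      next
        case 3
        have "cluster_weight J x C ?f = 0"
          unfolding cluster_weight_def by (rule sum.neutral) (use f0 3 in auto)
        then show ?thesis using cluster_weight_zero[OF V(1,2) 3, of J] by (simp add: nu_def)
      qed auto
    qed
  qed
  also have "(\<Sum>C\<in>Pow V. of_bool (u \<in> C \<and> v \<in> C) * cluster_weight J x C (\<lambda>s t. s x * s y)) =
      (\<Sum>C\<in>Pow V. (Z J)\<^sup>2 * (of_bool (u \<in> C \<and> v \<in> C) * nu J x y C))"
    using Z_pos[of J] by (simp add: nu_def)
  finally have "(Z J)\<^sup>2 * (fp J x y u v * tp J u v) = (Z J)\<^sup>2 * ((\<Sum>C\<in>Pow V. of_bool (u \<in> C \<and> v \<in> C) * nu J x y C) +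
    (\<Sum>C\<in>Pow V. of_bool (u \<notin> C \<and> v \<notin> C) * nu J x y C * (tp (off J C) u v)\<^sup>2))"
    by (simp only: distrib_left sum_distrib_left)
  then show ?thesis using Z_pos[of J] by simp
qed

text \<open>Completing the square: the weighted sum of \<open>(\<langle>\<sigma>\<^sub>u \<sigma>\<^sub>v\<rangle> - \<langle>\<sigma>\<^sub>u \<sigma>\<^sub>v\<rangle>\<^sub>V\<^sub>-\<^sub>C)\<^sup>2\<close> over the
  clusters \<open>C\<close> that contain neither \<open>u\<close> nor \<open>v\<close> is nonnegative.\<close>

lemma sum_nu_inside_le:
  assumes J: "\<And>e. e \<in> E \<Longrightarrow> 0 \<le> J e" and V: "x \<in> V" "y \<in> V" "u \<in> V" "v \<in> V"
  shows "(\<Sum>C\<in>Pow V. of_bool (u \<in> C \<and> v \<in> C) * nu J x y C) \<le>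
    tp J u v * (tp J x u * tp J y v + tp J x v * tp J y u)"
proof -
  let ?o = "\<lambda>C. of_bool (u \<notin> C \<and> v \<notin> C) * nu J x y C"
  let ?R = "\<lambda>C. tp (off J C) u v"
  let ?\<tau> = "tp J u v"
  have o: "0 \<le> ?o C" for C using nu_nonneg[of J x y C] J V by simp
  have "0 \<le> (\<Sum>C\<in>Pow V. ?o C * (?R C - ?\<tau>)\<^sup>2)" by (intro sum_nonneg mult_nonneg_nonneg o) simp
  also have "\<dots> = (\<Sum>C\<in>Pow V. ?o C * (?R C)\<^sup>2) - 2 * ?\<tau> * (\<Sum>C\<in>Pow V. ?o C * ?R C) + ?\<tau>\<^sup>2 * (\<Sum>C\<in>Pow V. ?o C)"
    unfolding sum_distrib_left sum_subtractf[symmetric] sum.distrib[symmetric]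
    by (intro sum.cong refl) (simp add: power2_eq_square algebra_simps)
  finally have sq: "2 * ?\<tau> * (\<Sum>C\<in>Pow V. ?o C * ?R C) \<le> (\<Sum>C\<in>Pow V. ?o C * (?R C)\<^sup>2) + ?\<tau>\<^sup>2 * (\<Sum>C\<in>Pow V. ?o C)"
    by linarith
  have "(\<Sum>C\<in>Pow V. ?o C) \<le> tp J x y"
    unfolding sum_nu[OF V(1), of J y, symmetric] using nu_nonneg[of J x y] J V by (intro sum_mono) simp
  then have "?\<tau>\<^sup>2 * (\<Sum>C\<in>Pow V. ?o C) \<le> ?\<tau>\<^sup>2 * tp J x y" by (intro mult_left_mono) auto
  then have "2 * ?\<tau> * (\<Sum>C\<in>Pow V. ?o C * ?R C) \<le> (\<Sum>C\<in>Pow V. ?o C * (?R C)\<^sup>2) + ?\<tau>\<^sup>2 * tp J x y"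
    using sq by linarith
  moreover have "2 * ?\<tau> * (\<Sum>C\<in>Pow V. ?o C * ?R C) =
      ?\<tau> * (fp J x y u v + tp J x y * ?\<tau> - tp J x u * tp J y v - tp J x v * tp J y u)"
    unfolding sum_nu_outside[OF V] by (simp add: mult_ac)
  ultimately show ?thesis
    using sum_nu_two[OF V, of J] by (simp add: power2_eq_square algebra_simps)
qed

definition through2 :: "('v set \<Rightarrow> real) \<Rightarrow> 'v \<Rightarrow> 'v \<Rightarrow> 'v \<Rightarrow> 'v \<Rightarrow> real" where
  "through2 J x y u v = (\<Sum>\<omega>\<in>Pow E. of_bool (u \<in> cluster \<omega> x \<and> v \<in> cluster \<omega> x) *
     trace_weight J (\<lambda>\<sigma>. \<sigma> x * \<sigma> y) \<omega>) / Z J"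

text \<open>A sourceless trace added to the first one only enlarges the cluster of x, so the weight
  for one trace is at most the corresponding weight under \<open>nu\<close>.\<close>

lemma through2_upper:
  assumes J: "\<And>e. e \<in> E \<Longrightarrow> 0 \<le> J e" and V: "x \<in> V" "y \<in> V" "u \<in> V" "v \<in> V"
  shows "through2 J x y u v \<le> tp J u v * (tp J x u * tp J y v + tp J x v * tp J y u)"
proof -
  let ?t = "trace_weight J (\<lambda>\<sigma>. \<sigma> x * \<sigma> y)"
  let ?c = "\<lambda>C. of_bool (u \<in> C \<and> v \<in> C) :: real"
  have "(Z J)\<^sup>2 * through2 J x y u v = (\<Sum>\<omega>\<in>Pow E. ?c (cluster \<omega> x) * ?t \<omega>) * Z J"
    using Z_pos[of J] by (simp add: through2_def power2_eq_square)
  also have "\<dots> = (\<Sum>\<omega>\<in>Pow E. \<Sum>\<omega>'\<in>Pow E. ?c (cluster \<omega> x) * (?t \<omega> * trace_weight J (\<lambda>_. 1) \<omega>'))"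
    unfolding part_traces[of J "\<lambda>_. 1"] sum_product by (simp add: mult_ac)
  also have "\<dots> \<le> (\<Sum>\<omega>\<in>Pow E. \<Sum>\<omega>'\<in>Pow E. ?c (cluster (\<omega> \<union> \<omega>') x) * (?t \<omega> * trace_weight J (\<lambda>_. 1) \<omega>'))"
  proof (intro sum_mono mult_right_mono mult_nonneg_nonneg trace_weight_nonneg positive_two positive_const J V)
    fix \<omega> \<omega>'
    show "?c (cluster \<omega> x) \<le> ?c (cluster (\<omega> \<union> \<omega>') x)"
      using cluster_mono[of \<omega> "\<omega> \<union> \<omega>'" x] by auto
  qed auto
  also have "\<dots> = (\<Sum>\<omega>\<in>Pow E. ?c (cluster \<omega> x) * double_weight J (\<lambda>s t. s x * s y * 1) \<omega>)"
    by (rule sum_double_weight_traces[symmetric])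
  also have "\<dots> = (\<Sum>C\<in>Pow V. ?c C * cluster_weight J x C (\<lambda>s t. s x * s y * 1))"
    by (rule sum_cluster_weight[OF V(1), symmetric])
  also have "\<dots> = (Z J)\<^sup>2 * (\<Sum>C\<in>Pow V. ?c C * nu J x y C)"
    using Z_pos[of J] unfolding sum_distrib_left by (simp add: nu_def)
  also have "\<dots> \<le> (Z J)\<^sup>2 * (tp J u v * (tp J x u * tp J y v + tp J x v * tp J y u))"
    by (intro mult_left_mono sum_nu_inside_le J V) auto
  finally show ?thesis using Z_pos[of J] by simp
qed

section \<open>Removing a set of vertices\<close>

lemma off_nonneg: "(\<And>e. e \<in> E \<Longrightarrow> 0 \<le> J e) \<Longrightarrow> e \<in> E \<Longrightarrow> 0 \<le> off J C e"
  by (simp add: off_def)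

text \<open>\<open>nu\<close> is \<open>core\<close> times the square of a ratio of partition
  functions. \<open>core\<close> involves only edges inside C, which avoid D, and the ratio grows
  when D is removed, by \<open>Z_supermodular\<close>.\<close>

lemma nu_off_mono:
  assumes J: "\<And>e. e \<in> E \<Longrightarrow> 0 \<le> J e" and V: "x \<in> V" "y \<in> V" and C: "C \<in> Pow V" "C \<inter> D = {}"
  shows "nu J x y C \<le> nu (off J D) x y C"
proof (cases "x \<in> C \<and> y \<in> C")
  case False
  have "nu J x y C = 0"
  proof (cases "x \<in> C")
    case False
    then have "{\<omega>. \<omega> \<subseteq> E \<and> cluster \<omega> x = C} = {}" using cluster_refl[of x] by blast
    then show ?thesis by (simp only: nu_def cluster_weight_def sum.empty div_0)
  next
    case True
    then show ?thesis using False cluster_weight_zero[OF V, of C J] by (simp add: nu_def)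
  qed
  moreover have "0 \<le> nu (off J D) x y C" by (intro nu_nonneg off_nonneg J V)
  ultimately show ?thesis by simp
next
  case True
  have pc: "(\<Prod>e\<in>\<omega>. exp (off J D e * (prod s e + prod t e)) - 1) = (\<Prod>e\<in>\<omega>. exp (J e * (prod s e + prod t e)) - 1)"
    if "\<omega> \<in> spanning x C" for \<omega> s t
  proof (rule prod.cong[OF refl])
    fix e assume "e \<in> \<omega>"
    then have "e \<inter> D = {}" using that C(2) by auto
    then show "exp (off J D e * (prod s e + prod t e)) - 1 = exp (J e * (prod s e + prod t e)) - 1"
      by (simp add: off_def)
  qed
  have core: "core (off J D) x y C = core J x y C"
    unfolding core_def
    by (intro arg_cong2[where f = "(/)"] arg_cong2[where f = "(*)"] sum.cong refl pc)
  have nu: "nu K x y C = core K x y C * (Z (off K C) / Z K)\<^sup>2" for K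
    using True C by (simp add: nu_def cluster_weight_core power_divide)
  have "0 \<le> core J x y C"
  proof -
    have "0 \<le> nu J x y C" by (intro nu_nonneg J V)
    moreover have "0 < (Z (off J C) / Z J)\<^sup>2" using Z_pos[of J] Z_pos[of "off J C"] by simp
    ultimately show ?thesis unfolding nu by (simp add: zero_le_mult_iff)
  qed
  moreover have "Z (off J C) / Z J \<le> Z (off (off J D) C) / Z (off J D)"
  proof -
    let ?G = "\<lambda>e. J e - off J D e"
    have "Z (\<lambda>e. off (off J D) C e + ?G e) * Z (off J D) \<le> Z (\<lambda>e. off J D e + ?G e) * Z (off (off J D) C)"
      by (rule Z_supermodular) (use J in \<open>simp_all add: off_def\<close>)
    \<comment> \<open>Edges that meet both C and D are switched off on the left but present on the
      right, so this is an inequality only.\<close>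
    moreover have "Z (off J C) \<le> Z (\<lambda>e. off (off J D) C e + ?G e)"
      by (rule Z_mono) (use J in \<open>simp add: off_def\<close>)
    then have "Z (off J C) * Z (off J D) \<le> Z (\<lambda>e. off (off J D) C e + ?G e) * Z (off J D)"
      using Z_pos[of "off J D"] by (intro mult_right_mono) (auto intro: less_imp_le)
    ultimately have "Z (off J C) * Z (off J D) \<le> Z J * Z (off (off J D) C)" by simp
    then show ?thesis using Z_pos[of J] Z_pos[of "off J D"] by (simp add: field_simps)
  qed
  ultimately show ?thesis
    unfolding nu[of J] nu[of "off J D"] core
    using Z_pos[of J] Z_pos[of "off J C"] by (intro mult_left_mono power_mono) (auto intro: less_imp_le)
qed

text \<open>Clusters that meet D are paid for by a union bound over the visited vertex w, evaluated
  with \<open>sum_nu_through\<close>; the others weigh at most as much as in the model without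
  D.\<close>

lemma tp_removal:
  assumes J: "\<And>e. e \<in> E \<Longrightarrow> 0 \<le> J e" and V: "y \<in> V" "v \<in> V" and D: "D \<subseteq> V"
  shows "tp J y v - (\<Sum>w\<in>D. tp J y w * tp J w v) \<le> tp (off J D) y v"
proof -
  have "tp J y v = (\<Sum>C\<in>Pow V. nu J y v C)" by (simp add: sum_nu V)
  also have "\<dots> \<le> (\<Sum>C\<in>Pow V. nu (off J D) y v C + (\<Sum>w\<in>D. of_bool (w \<in> C) * nu J y v C))"
  proof (rule sum_mono)
    fix C assume C: "C \<in> Pow V"
    have fin: "finite D" using D finite_V finite_subset by blast
    have "0 \<le> nu J y v C" by (intro nu_nonneg J V)
    moreover have "0 \<le> nu (off J D) y v C" by (intro nu_nonneg off_nonneg J V)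
    ultimately have nn: "0 \<le> nu J y v C" "0 \<le> nu (off J D) y v C" by simp_all
    show "nu J y v C \<le> nu (off J D) y v C + (\<Sum>w\<in>D. of_bool (w \<in> C) * nu J y v C)"
    proof (cases "C \<inter> D = {}")
      case True
      have "0 \<le> (\<Sum>w\<in>D. of_bool (w \<in> C) * nu J y v C)" using nn by (intro sum_nonneg) simp
      moreover have "nu J y v C \<le> nu (off J D) y v C"
        by (rule nu_off_mono[OF _ V C True]) (rule J)
      ultimately show ?thesis by linarith
    next
      case False
      then obtain w where w: "w \<in> D" "w \<in> C" by auto
      have "of_bool (w \<in> C) * nu J y v C \<le> (\<Sum>w\<in>D. of_bool (w \<in> C) * nu J y v C)"
        using nn by (intro member_le_sum fin w) simp_all
      then show ?thesis using w nn by simp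
    qed
  qed
  also have "\<dots> = tp (off J D) y v + (\<Sum>w\<in>D. \<Sum>C\<in>Pow V. of_bool (w \<in> C) * nu J y v C)"
    unfolding sum.distrib by (simp add: sum_nu V sum.swap[of _ D])
  also have "(\<Sum>w\<in>D. \<Sum>C\<in>Pow V. of_bool (w \<in> C) * nu J y v C) = (\<Sum>w\<in>D. tp J y w * tp J w v)"
    by (intro sum.cong refl sum_nu_through V) (use D in auto)
  finally show ?thesis by simp
qed

text \<open>The weaker couplings \<open>J'\<close> cut the paths from \<open>y\<close> to \<open>v\<close> short, which makes the subtracted
  term small.\<close>

lemma truncated_lower:
  assumes J: "\<And>e. e \<in> E \<Longrightarrow> 0 \<le> J' e" "\<And>e. e \<in> E \<Longrightarrow> J' e \<le> J e"
    and V: "x \<in> V" "y \<in> V" "u \<in> V" "v \<in> V"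
  shows "tp J x u * tp J' y v - (\<Sum>w\<in>V. tp J x w * tp J w u * (tp J' y w * tp J' w v)) \<le>
    fp J x y u v - tp J x y * tp J u v"
proof -
  have J0: "0 \<le> J e" if "e \<in> E" for e using J that order_trans by blast
  let ?S = "\<lambda>x u y v. \<Sum>C\<in>Pow V. of_bool (y \<notin> C \<and> v \<notin> C) * nu J x u C * tp (off J C) y v"
  have S0: "0 \<le> ?S x u y v" if "x \<in> V" "u \<in> V" "y \<in> V" "v \<in> V" for x u y v
    using that by (intro sum_nonneg mult_nonneg_nonneg nu_nonneg tp_nonneg off_nonneg J0) auto
  have t: "0 \<le> tp J' a b" if "a \<in> V" "b \<in> V" for a b using that by (intro tp_nonneg J)
  have "tp J x u * tp J' y v - (\<Sum>w\<in>V. tp J x w * tp J w u * (tp J' y w * tp J' w v)) =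
      (\<Sum>C\<in>Pow V. nu J x u C) * tp J' y v -
      (\<Sum>w\<in>V. (\<Sum>C\<in>Pow V. of_bool (w \<in> C) * nu J x u C) * (tp J' y w * tp J' w v))"
    using sum_nu_through[OF V(1,3)] by (simp add: sum_nu V)
  also have "\<dots> = (\<Sum>C\<in>Pow V. nu J x u C * (tp J' y v - (\<Sum>w\<in>V. of_bool (w \<in> C) * (tp J' y w * tp J' w v))))"
    unfolding sum_distrib_right sum_distrib_left right_diff_distrib sum_subtractf
    by (subst sum.swap) (simp add: mult_ac)
  also have "\<dots> \<le> ?S x u y v"
  proof (rule sum_mono)
    fix C assume C: "C \<in> Pow V"
    have fin: "finite C" using C finite_V finite_subset by blast
    have nn: "0 \<le> nu J x u C" using nu_nonneg[of J] J0 V by simp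
    have eq: "(\<Sum>w\<in>V. of_bool (w \<in> C) * (tp J' y w * tp J' w v)) = (\<Sum>w\<in>C. tp J' y w * tp J' w v)"
      using C finite_V by (intro sum.mono_neutral_cong_right) auto
    have p: "0 \<le> tp J' y w * tp J' w v" if "w \<in> C" for w using that C V t by auto
    have "tp J' y v - (\<Sum>w\<in>C. tp J' y w * tp J' w v) \<le> of_bool (y \<notin> C \<and> v \<notin> C) * tp (off J C) y v"
    proof (cases "y \<notin> C \<and> v \<notin> C")
      case True
      have "tp J' y v - (\<Sum>w\<in>C. tp J' y w * tp J' w v) \<le> tp (off J' C) y v"
        using C by (intro tp_removal J V) auto
      also have "\<dots> \<le> tp (off J C) y v"
        using J by (intro tp_mono V) (auto simp: off_def)
      finally show ?thesis using True by simp
    next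
      case False
      \<comment> \<open>The summand at the endpoint that lies in C equals the left-hand side, as the
        correlation of a vertex with itself is 1.\<close>
      have "tp J' y v \<le> (\<Sum>w\<in>C. tp J' y w * tp J' w v)"
      proof (cases "y \<in> C")
        case True
        from member_le_sum[OF True _ fin, of "\<lambda>w. tp J' y w * tp J' w v"] show ?thesis
          using p tp_same[OF V(2), of J'] by simp
      next
        case y: False
        then have "v \<in> C" using False by simp
        from member_le_sum[OF this _ fin, of "\<lambda>w. tp J' y w * tp J' w v"] show ?thesis
          using p tp_same[OF V(4), of J'] by simp
      qed
      then show ?thesis using False by auto
    qed
    from mult_left_mono[OF this nn]
    show "nu J x u C * (tp J' y v - (\<Sum>w\<in>V. of_bool (w \<in> C) * (tp J' y w * tp J' w v))) \<le>
        of_bool (y \<notin> C \<and> v \<notin> C) * nu J x u C * tp (off J C) y v"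
      unfolding eq by (simp add: mult_ac)
  qed
  \<comment> \<open>The second, nonnegative sum completes the truncated correlation: when the two
    instances of \<open>sum_nu_outside\<close> are added, the terms <xu><yv> and <xv><yu>
    cancel.\<close>
  also have "\<dots> \<le> ?S x u y v + ?S x v y u" using S0[of x v y u] V by simp
  also have "\<dots> = fp J x y u v - tp J x y * tp J u v"
    using sum_nu_outside[OF V(1,3,2,4), of J] sum_nu_outside[OF V(1,4,2,3), of J]
    by (simp add: mult_ac)
  finally show ?thesis .
qed

end

subsection \<open>Second moment method\<close>

text \<open>Cauchy-Schwarz for the number N of common points of two independent random sets: (E N)^2
  \<le> P(N > 0) E(N^2). By independence, both moments are sums of squares of quantities for one
  set.\<close>

lemma second_moment_sets:
  fixes q :: "'p \<Rightarrow> real" and S :: "'p \<Rightarrow> 'v set"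
  assumes "finite P" "finite V" "\<And>p. p \<in> P \<Longrightarrow> 0 \<le> q p" "\<And>p. p \<in> P \<Longrightarrow> S p \<subseteq> V"
  shows "(\<Sum>u\<in>V. (\<Sum>p\<in>P. of_bool (u \<in> S p) * q p)\<^sup>2)\<^sup>2 \<le>
    (\<Sum>p\<in>P. \<Sum>p'\<in>P. of_bool (S p \<inter> S p' \<noteq> {}) * (q p * q p')) *
    (\<Sum>u\<in>V. \<Sum>v\<in>V. (\<Sum>p\<in>P. of_bool (u \<in> S p \<and> v \<in> S p) * q p)\<^sup>2)"
proof -
  let ?W = "\<lambda>(p, p'). q p * q p'"
  let ?N = "\<lambda>(p, p'). \<Sum>u\<in>V. of_bool (u \<in> S p \<and> u \<in> S p') :: real"
  let ?I = "\<lambda>(p, p'). of_bool (S p \<inter> S p' \<noteq> {}) :: real"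
  have W: "0 \<le> ?W i" if "i \<in> P \<times> P" for i using that assms(3) by auto
  have pairs: "(\<Sum>i\<in>P \<times> P. F i) = (\<Sum>p\<in>P. \<Sum>p'\<in>P. F (p, p'))" for F :: "'p \<times> 'p \<Rightarrow> real"
    by (simp add: sum.cartesian_product case_prod_unfold)
  have NI: "?I i * ?N i = ?N i" for i
    by (cases i) (auto intro!: sum.neutral)
  have "(\<Sum>i\<in>P \<times> P. ?W i * ?N i) = (\<Sum>i\<in>P \<times> P. (sqrt (?W i) * ?I i) * (sqrt (?W i) * ?N i))"
  proof (rule sum.cong[OF refl])
    fix i assume "i \<in> P \<times> P"
    then have "sqrt (?W i) * sqrt (?W i) = ?W i" using W by simp
    moreover have "(sqrt (?W i) * ?I i) * (sqrt (?W i) * ?N i) = (sqrt (?W i) * sqrt (?W i)) * (?I i * ?N i)"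
      by (simp only: mult_ac)
    ultimately show "?W i * ?N i = (sqrt (?W i) * ?I i) * (sqrt (?W i) * ?N i)"
      by (simp only: NI)
  qed
  then have "(\<Sum>i\<in>P \<times> P. ?W i * ?N i)\<^sup>2 \<le>
      (\<Sum>i\<in>P \<times> P. (sqrt (?W i) * ?I i)\<^sup>2) * (\<Sum>i\<in>P \<times> P. (sqrt (?W i) * ?N i)\<^sup>2)"
    by (simp only: Cauchy_Schwarz_ineq_sum)
  also have "(\<Sum>i\<in>P \<times> P. (sqrt (?W i) * ?I i)\<^sup>2) = (\<Sum>i\<in>P \<times> P. ?I i * ?W i)"
  proof (rule sum.cong[OF refl])
    fix i assume "i \<in> P \<times> P"
    then have "(sqrt (?W i))\<^sup>2 = ?W i" using W by simp
    moreover have "(?I i)\<^sup>2 = ?I i" by (cases i) simp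
    ultimately show "(sqrt (?W i) * ?I i)\<^sup>2 = ?I i * ?W i" by (simp only: power_mult_distrib mult.commute)
  qed
  also have "\<dots> = (\<Sum>p\<in>P. \<Sum>p'\<in>P. of_bool (S p \<inter> S p' \<noteq> {}) * (q p * q p'))"
    unfolding pairs prod.case ..
  also have "(\<Sum>i\<in>P \<times> P. (sqrt (?W i) * ?N i)\<^sup>2) = (\<Sum>i\<in>P \<times> P. ?W i * (?N i * ?N i))"
  proof (rule sum.cong[OF refl])
    fix i assume "i \<in> P \<times> P"
    then have "(sqrt (?W i))\<^sup>2 = ?W i" using W by simp
    then show "(sqrt (?W i) * ?N i)\<^sup>2 = ?W i * (?N i * ?N i)" by (simp only: power_mult_distrib power2_eq_square[of "?N i"])
  qed
  also have "\<dots> = (\<Sum>p\<in>P. \<Sum>p'\<in>P. \<Sum>u\<in>V. \<Sum>v\<in>V.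
      (of_bool (u \<in> S p \<and> v \<in> S p) * q p) * (of_bool (u \<in> S p' \<and> v \<in> S p') * q p'))"
    unfolding pairs prod.case sum_product unfolding sum_distrib_left
    by (intro sum.cong refl) auto
  also have "\<dots> = (\<Sum>p\<in>P. \<Sum>u\<in>V. \<Sum>v\<in>V. \<Sum>p'\<in>P.
      (of_bool (u \<in> S p \<and> v \<in> S p) * q p) * (of_bool (u \<in> S p' \<and> v \<in> S p') * q p'))"
    by (intro sum.cong refl, subst sum.swap, intro sum.cong refl sum.swap)
  also have "\<dots> = (\<Sum>u\<in>V. \<Sum>v\<in>V. \<Sum>p\<in>P. \<Sum>p'\<in>P.
      (of_bool (u \<in> S p \<and> v \<in> S p) * q p) * (of_bool (u \<in> S p' \<and> v \<in> S p') * q p'))"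
    by (subst sum.swap, intro sum.cong refl sum.swap)
  also have "\<dots> = (\<Sum>u\<in>V. \<Sum>v\<in>V. (\<Sum>p\<in>P. of_bool (u \<in> S p \<and> v \<in> S p) * q p)\<^sup>2)"
    by (simp only: power2_eq_square sum_product)
  also have "(\<Sum>i\<in>P \<times> P. ?W i * ?N i) = (\<Sum>p\<in>P. \<Sum>p'\<in>P. \<Sum>u\<in>V.
      (of_bool (u \<in> S p) * q p) * (of_bool (u \<in> S p') * q p'))"
    unfolding pairs prod.case sum_distrib_left
    by (intro sum.cong refl) auto
  also have "\<dots> = (\<Sum>p\<in>P. \<Sum>u\<in>V. \<Sum>p'\<in>P. (of_bool (u \<in> S p) * q p) * (of_bool (u \<in> S p') * q p'))"
    by (intro sum.cong refl sum.swap)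
  also have "\<dots> = (\<Sum>u\<in>V. \<Sum>p\<in>P. \<Sum>p'\<in>P. (of_bool (u \<in> S p) * q p) * (of_bool (u \<in> S p') * q p'))"
    by (rule sum.swap)
  also have "\<dots> = (\<Sum>u\<in>V. (\<Sum>p\<in>P. of_bool (u \<in> S p) * q p)\<^sup>2)"
    by (simp only: power2_eq_square sum_product)
  finally show ?thesis .
qed

context ising_graph
begin

text \<open>The sources belong to the index set of \<open>second_moment_sets\<close>, so
  Cauchy-Schwarz is applied once to the sum over x, y, z, w and not to each quadruple.\<close>

lemma sum_ursell_lower:
  assumes J: "\<And>e. e \<in> E \<Longrightarrow> 0 \<le> J e"
  shows "2 * (\<Sum>u\<in>V. (\<Sum>x\<in>V. \<Sum>y\<in>V. through J x y u)\<^sup>2)\<^sup>2 \<le>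
    (\<Sum>x\<in>V. \<Sum>y\<in>V. \<Sum>z\<in>V. \<Sum>w\<in>V. - ursell J x y z w) *
    (\<Sum>u\<in>V. \<Sum>v\<in>V. (\<Sum>x\<in>V. \<Sum>y\<in>V. through2 J x y u v)\<^sup>2)"
proof -
  let ?P = "V \<times> V \<times> Pow E"
  let ?t = "\<lambda>x y. trace_weight J (\<lambda>\<sigma>. \<sigma> x * \<sigma> y)"
  define q where "q = (\<lambda>(x, y, \<omega>). ?t x y \<omega> / Z J)"
  define S where "S = (\<lambda>(x :: 'v, y :: 'v, \<omega> :: 'v set set). cluster \<omega> x)"
  have fin: "finite ?P" using finite_V finite_E by simp
  have q: "0 \<le> q p" if "p \<in> ?P" for p
    using that Z_pos[of J] unfolding q_def
    by (auto intro!: divide_nonneg_pos trace_weight_nonneg positive_two J)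
  have S: "S p \<subseteq> V" if "p \<in> ?P" for p
    using that cluster_subset unfolding S_def by auto
  have triples: "(\<Sum>p\<in>?P. F p) = (\<Sum>x\<in>V. \<Sum>y\<in>V. \<Sum>\<omega>\<in>Pow E. F (x, y, \<omega>))"
    for F :: "'v \<times> 'v \<times> 'v set set \<Rightarrow> real"
    by (simp add: sum.cartesian_product case_prod_unfold)
  have sum_P: "(\<Sum>p\<in>?P. c (S p) * q p) = (\<Sum>x\<in>V. \<Sum>y\<in>V. (\<Sum>\<omega>\<in>Pow E. c (cluster \<omega> x) * ?t x y \<omega>) / Z J)" for c
    unfolding triples S_def q_def prod.case by (simp add: sum_divide_distrib)
  have 1: "(\<Sum>p\<in>?P. of_bool (u \<in> S p) * q p) = (\<Sum>x\<in>V. \<Sum>y\<in>V. through J x y u)" for u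
    unfolding sum_P[of "\<lambda>C. of_bool (u \<in> C)"] through_def ..
  have 2: "(\<Sum>p\<in>?P. of_bool (u \<in> S p \<and> v \<in> S p) * q p) = (\<Sum>x\<in>V. \<Sum>y\<in>V. through2 J x y u v)" for u v
    unfolding sum_P[of "\<lambda>C. of_bool (u \<in> C \<and> v \<in> C)"] through2_def ..
  have "2 * (\<Sum>p\<in>?P. \<Sum>p'\<in>?P. of_bool (S p \<inter> S p' \<noteq> {}) * (q p * q p')) =
      (\<Sum>x\<in>V. \<Sum>y\<in>V. \<Sum>\<omega>\<in>Pow E. \<Sum>z\<in>V. \<Sum>w\<in>V. \<Sum>\<omega>'\<in>Pow E.
        2 * (of_bool (cluster \<omega> x \<inter> cluster \<omega>' z \<noteq> {}) * (?t x y \<omega> * ?t z w \<omega>')) / (Z J)\<^sup>2)"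
    unfolding triples sum_distrib_left S_def q_def prod.case
    by (intro sum.cong refl) (simp add: power2_eq_square)
  also have "\<dots> = (\<Sum>x\<in>V. \<Sum>y\<in>V. \<Sum>z\<in>V. \<Sum>w\<in>V. \<Sum>\<omega>\<in>Pow E. \<Sum>\<omega>'\<in>Pow E.
        2 * (of_bool (cluster \<omega> x \<inter> cluster \<omega>' z \<noteq> {}) * (?t x y \<omega> * ?t z w \<omega>')) / (Z J)\<^sup>2)"
    by (intro sum.cong refl, subst sum.swap, intro sum.cong refl sum.swap)
  also have "\<dots> = (\<Sum>x\<in>V. \<Sum>y\<in>V. \<Sum>z\<in>V. \<Sum>w\<in>V. 2 * (\<Sum>\<omega>\<in>Pow E. \<Sum>\<omega>'\<in>Pow E.
        of_bool (cluster \<omega> x \<inter> cluster \<omega>' z \<noteq> {}) * (?t x y \<omega> * ?t z w \<omega>')) / (Z J)\<^sup>2)"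
    by (simp only: sum_distrib_left sum_divide_distrib)
  also have "\<dots> \<le> (\<Sum>x\<in>V. \<Sum>y\<in>V. \<Sum>z\<in>V. \<Sum>w\<in>V. - ursell J x y z w)"
  proof (intro sum_mono)
    fix x y z w assume V: "x \<in> V" "y \<in> V" "z \<in> V" "w \<in> V"
    have "2 * (\<Sum>\<omega>\<in>Pow E. \<Sum>\<omega>'\<in>Pow E. of_bool (cluster \<omega> x \<inter> cluster \<omega>' z \<noteq> {}) * (?t x y \<omega> * ?t z w \<omega>'))
        \<le> - ursell J x y z w * (Z J)\<^sup>2"
      by (rule ursell_bound[OF _ V]) (rule J)
    then show "2 * (\<Sum>\<omega>\<in>Pow E. \<Sum>\<omega>'\<in>Pow E. of_bool (cluster \<omega> x \<inter> cluster \<omega>' z \<noteq> {}) * (?t x y \<omega> * ?t z w \<omega>'))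
        / (Z J)\<^sup>2 \<le> - ursell J x y z w"
      using Z_pos[of J] by (simp add: pos_divide_le_eq)
  qed
  finally have "2 * (\<Sum>p\<in>?P. \<Sum>p'\<in>?P. of_bool (S p \<inter> S p' \<noteq> {}) * (q p * q p')) \<le>
      (\<Sum>x\<in>V. \<Sum>y\<in>V. \<Sum>z\<in>V. \<Sum>w\<in>V. - ursell J x y z w)" .
  then have "2 * (\<Sum>p\<in>?P. \<Sum>p'\<in>?P. of_bool (S p \<inter> S p' \<noteq> {}) * (q p * q p')) *
      (\<Sum>u\<in>V. \<Sum>v\<in>V. (\<Sum>x\<in>V. \<Sum>y\<in>V. through2 J x y u v)\<^sup>2) \<le>
      (\<Sum>x\<in>V. \<Sum>y\<in>V. \<Sum>z\<in>V. \<Sum>w\<in>V. - ursell J x y z w) *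
      (\<Sum>u\<in>V. \<Sum>v\<in>V. (\<Sum>x\<in>V. \<Sum>y\<in>V. through2 J x y u v)\<^sup>2)"
    by (intro mult_right_mono sum_nonneg) auto
  moreover have "(\<Sum>u\<in>V. (\<Sum>x\<in>V. \<Sum>y\<in>V. through J x y u)\<^sup>2)\<^sup>2 \<le>
      (\<Sum>p\<in>?P. \<Sum>p'\<in>?P. of_bool (S p \<inter> S p' \<noteq> {}) * (q p * q p')) *
      (\<Sum>u\<in>V. \<Sum>v\<in>V. (\<Sum>x\<in>V. \<Sum>y\<in>V. through2 J x y u v)\<^sup>2)"
    using second_moment_sets[OF fin finite_V, of q S] q S unfolding 1 2 by blast
  ultimately show ?thesis by linarith
qed

section \<open>Moments of the total spin\<close>

lemma ev_add: "ev J (\<lambda>\<sigma>. f \<sigma> + g \<sigma>) = ev J f + ev J g"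
  by (simp add: ev_def part_add add_divide_distrib)

abbreviation moment :: "('v set \<Rightarrow> real) \<Rightarrow> nat \<Rightarrow> real" where
  "moment J k \<equiv> ev J (\<lambda>\<sigma>. (\<Sum>x\<in>V. \<sigma> x) ^ k)"

lemma moment_2: "moment J 2 = (\<Sum>x\<in>V. \<Sum>y\<in>V. tp J x y)"
  by (simp add: power2_eq_square sum_product ev_sum)

lemma moment_4: "moment J 4 = (\<Sum>x\<in>V. \<Sum>y\<in>V. \<Sum>z\<in>V. \<Sum>w\<in>V. fp J x y z w)"
proof -
  have "(\<Sum>x\<in>V. \<sigma> x) ^ 4 = (\<Sum>x\<in>V. \<Sum>y\<in>V. \<Sum>z\<in>V. \<Sum>w\<in>V. \<sigma> x * \<sigma> y * \<sigma> z * \<sigma> w)" for \<sigma> :: "'v \<Rightarrow> real"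
  proof -
    have "(\<Sum>x\<in>V. \<sigma> x) ^ 4 = ((\<Sum>x\<in>V. \<sigma> x) * (\<Sum>x\<in>V. \<sigma> x)) * ((\<Sum>x\<in>V. \<sigma> x) * (\<Sum>x\<in>V. \<sigma> x))"
      by (simp add: power4_eq_xxxx mult.assoc)
    also have "\<dots> = (\<Sum>x\<in>V. \<Sum>z\<in>V. \<Sum>y\<in>V. \<Sum>w\<in>V. (\<sigma> x * \<sigma> y) * (\<sigma> z * \<sigma> w))"
      by (simp only: sum_product)
    also have "\<dots> = (\<Sum>x\<in>V. \<Sum>y\<in>V. \<Sum>z\<in>V. \<Sum>w\<in>V. (\<sigma> x * \<sigma> y) * (\<sigma> z * \<sigma> w))"
      by (intro sum.cong refl sum.swap)
    finally show ?thesis by (simp only: mult.assoc)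
  qed
  then show ?thesis by (simp add: ev_sum)
qed

lemma sum_ursell: "(\<Sum>x\<in>V. \<Sum>y\<in>V. \<Sum>z\<in>V. \<Sum>w\<in>V. - ursell J x y z w) = 3 * (moment J 2)\<^sup>2 - moment J 4"
proof -
  have a: "(\<Sum>x\<in>V. \<Sum>y\<in>V. \<Sum>z\<in>V. \<Sum>w\<in>V. tp J x y * tp J z w) = (moment J 2)\<^sup>2"
  proof -
    have "(\<Sum>x\<in>V. \<Sum>y\<in>V. \<Sum>z\<in>V. \<Sum>w\<in>V. tp J x y * tp J z w) =
        (\<Sum>x\<in>V. \<Sum>y\<in>V. tp J x y) * (\<Sum>z\<in>V. \<Sum>w\<in>V. tp J z w)"
      by (simp only: sum_distrib_right) (simp only: sum_distrib_left)
    then show ?thesis by (simp only: moment_2) (simp only: power2_eq_square)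
  qed
  have b: "(\<Sum>x\<in>V. \<Sum>y\<in>V. \<Sum>z\<in>V. \<Sum>w\<in>V. tp J x z * tp J y w) = (moment J 2)\<^sup>2"
    unfolding a[symmetric] by (intro sum.cong refl sum.swap)
  have c: "(\<Sum>x\<in>V. \<Sum>y\<in>V. \<Sum>z\<in>V. \<Sum>w\<in>V. tp J x w * tp J y z) = (moment J 2)\<^sup>2"
    unfolding b[symmetric] by (intro sum.cong refl sum.swap)
  have "(\<Sum>x\<in>V. \<Sum>y\<in>V. \<Sum>z\<in>V. \<Sum>w\<in>V. - ursell J x y z w) =
      (\<Sum>x\<in>V. \<Sum>y\<in>V. \<Sum>z\<in>V. \<Sum>w\<in>V. tp J x y * tp J z w) +
      (\<Sum>x\<in>V. \<Sum>y\<in>V. \<Sum>z\<in>V. \<Sum>w\<in>V. tp J x z * tp J y w) +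
      (\<Sum>x\<in>V. \<Sum>y\<in>V. \<Sum>z\<in>V. \<Sum>w\<in>V. tp J x w * tp J y z) -
      (\<Sum>x\<in>V. \<Sum>y\<in>V. \<Sum>z\<in>V. \<Sum>w\<in>V. fp J x y z w)"
    unfolding sum.distrib[symmetric] sum_subtractf[symmetric]
    by (intro sum.cong refl) (simp add: ursell_def)
  then show ?thesis unfolding a b c moment_4 by simp
qed

lemma moment_2_le_4: "(moment J 2)\<^sup>2 \<le> moment J 4"
proof -
  let ?M = "\<lambda>\<sigma> :: 'v \<Rightarrow> real. \<Sum>x\<in>V. \<sigma> x"
  let ?m = "moment J 2"
  have "ev J (\<lambda>_. 0) \<le> ev J (\<lambda>\<sigma>. ((?M \<sigma>)\<^sup>2 - ?m)\<^sup>2)" by (rule ev_mono) simp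
  also have "\<dots> = ev J (\<lambda>\<sigma>. ?M \<sigma> ^ 4 + ((- 2 * ?m) * (?M \<sigma>)\<^sup>2 + ?m\<^sup>2))"
    by (intro ev_cong) (simp add: power2_diff power_mult[symmetric] mult_ac)
  also have "\<dots> = moment J 4 + (- 2 * ?m * ?m + ?m\<^sup>2)"
    by (simp only: ev_add ev_cmult ev_const)
  finally show ?thesis by (simp add: ev_const power2_eq_square)
qed

text \<open>Summed over x and y, \<open>through2_upper\<close> gives 2 X^2 <uv>; the second moment
  of the number of common vertices is therefore 4 X^4 times a sum of bubbles at most.\<close>

lemma kurtosis_lower:
  assumes J: "\<And>e. e \<in> E \<Longrightarrow> 0 \<le> J e"
    and a: "0 \<le> a" "\<And>u. u \<in> V \<Longrightarrow> a \<le> (\<Sum>x\<in>V. \<Sum>y\<in>V. through J x y u)"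
    and X: "\<And>u. u \<in> V \<Longrightarrow> (\<Sum>x\<in>V. tp J x u) = X"
    and B: "\<And>u. u \<in> V \<Longrightarrow> (\<Sum>v\<in>V. (tp J u v)\<^sup>2) \<le> B"
  shows "2 * (real (card V) * a\<^sup>2)\<^sup>2 \<le> (3 * (moment J 2)\<^sup>2 - moment J 4) * (4 * X ^ 4 * (real (card V) * B))"
proof -
  have U: "0 \<le> (\<Sum>x\<in>V. \<Sum>y\<in>V. \<Sum>z\<in>V. \<Sum>w\<in>V. - ursell J x y z w)"
  proof (intro sum_nonneg)
    fix x y z w assume V: "x \<in> V" "y \<in> V" "z \<in> V" "w \<in> V"
    have "0 \<le> 2 * (\<Sum>\<omega>\<in>Pow E. \<Sum>\<omega>'\<in>Pow E. of_bool (cluster \<omega> x \<inter> cluster \<omega>' z \<noteq> {}) *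
      (trace_weight J (\<lambda>\<sigma>. \<sigma> x * \<sigma> y) \<omega> * trace_weight J (\<lambda>\<sigma>. \<sigma> z * \<sigma> w) \<omega>'))"
      by (intro mult_nonneg_nonneg sum_nonneg trace_weight_nonneg positive_two V J) auto
    also have "\<dots> \<le> - ursell J x y z w * (Z J)\<^sup>2" by (rule ursell_bound[OF _ V]) (rule J)
    finally show "0 \<le> - ursell J x y z w" using Z_pos[of J] by (simp add: mult_le_0_iff)
  qed
  have t2: "(\<Sum>x\<in>V. \<Sum>y\<in>V. through2 J x y u v) \<le> 2 * X\<^sup>2 * tp J u v" if "u \<in> V" "v \<in> V" for u v
  proof -
    have "(\<Sum>x\<in>V. \<Sum>y\<in>V. through2 J x y u v) \<le>
        (\<Sum>x\<in>V. \<Sum>y\<in>V. tp J u v * (tp J x u * tp J y v + tp J x v * tp J y u))"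
      by (intro sum_mono through2_upper that J)
    also have "\<dots> = tp J u v * ((\<Sum>x\<in>V. tp J x u) * (\<Sum>y\<in>V. tp J y v) + (\<Sum>x\<in>V. tp J x v) * (\<Sum>y\<in>V. tp J y u))"
      unfolding sum_product unfolding sum.distrib[symmetric] unfolding sum_distrib_left ..
    finally show ?thesis using that by (simp add: X power2_eq_square mult_ac)
  qed
  have t0: "0 \<le> through2 J x y u v" if "x \<in> V" "y \<in> V" for x y u v
    unfolding through2_def using Z_pos[of J] that
    by (intro divide_nonneg_pos sum_nonneg mult_nonneg_nonneg trace_weight_nonneg positive_two J) auto
  have "(\<Sum>u\<in>V. \<Sum>v\<in>V. (\<Sum>x\<in>V. \<Sum>y\<in>V. through2 J x y u v)\<^sup>2) \<le> (\<Sum>u\<in>V. \<Sum>v\<in>V. (2 * X\<^sup>2 * tp J u v)\<^sup>2)"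
    by (intro sum_mono power_mono t2 sum_nonneg t0)
  also have "\<dots> = 4 * X ^ 4 * (\<Sum>u\<in>V. \<Sum>v\<in>V. (tp J u v)\<^sup>2)"
    unfolding sum_distrib_left by (simp add: power_mult_distrib power_mult[symmetric])
  also have "\<dots> \<le> 4 * X ^ 4 * (\<Sum>u\<in>V. B)"
    by (intro mult_left_mono sum_mono B) auto
  also have "\<dots> = 4 * X ^ 4 * (real (card V) * B)" by simp
  finally have D: "(\<Sum>u\<in>V. \<Sum>v\<in>V. (\<Sum>x\<in>V. \<Sum>y\<in>V. through2 J x y u v)\<^sup>2) \<le> 4 * X ^ 4 * (real (card V) * B)" .
  have "(\<Sum>u\<in>V. a\<^sup>2) \<le> (\<Sum>u\<in>V. (\<Sum>x\<in>V. \<Sum>y\<in>V. through J x y u)\<^sup>2)"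
    by (intro sum_mono power_mono a)
  then have "2 * (real (card V) * a\<^sup>2)\<^sup>2 \<le> 2 * (\<Sum>u\<in>V. (\<Sum>x\<in>V. \<Sum>y\<in>V. through J x y u)\<^sup>2)\<^sup>2"
    by (simp add: power_mono)
  also have "\<dots> \<le> (\<Sum>x\<in>V. \<Sum>y\<in>V. \<Sum>z\<in>V. \<Sum>w\<in>V. - ursell J x y z w) *
    (\<Sum>u\<in>V. \<Sum>v\<in>V. (\<Sum>x\<in>V. \<Sum>y\<in>V. through2 J x y u v)\<^sup>2)"
    by (rule sum_ursell_lower) (rule J)
  also have "\<dots> \<le> (\<Sum>x\<in>V. \<Sum>y\<in>V. \<Sum>z\<in>V. \<Sum>w\<in>V. - ursell J x y z w) * (4 * X ^ 4 * (real (card V) * B))"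
    by (intro mult_left_mono D U)
  finally show ?thesis unfolding sum_ursell .
qed

text \<open>Summing \<open>truncated_lower\<close> over x and y produces X X' from both terms, the
  subtracted one with the factor bounded in \<open>small\<close>; \<open>through_lower\<close> then
  converts truncated correlations into visits of u.\<close>

lemma through_sum_lower:
  assumes J: "\<And>e. e \<in> E \<Longrightarrow> 0 \<le> J' e" "\<And>e. e \<in> E \<Longrightarrow> J' e \<le> J e" and "0 \<le> C"
    and C: "\<And>e. e \<in> E \<Longrightarrow> sinh (J e) \<le> C * (cosh (J e) - 1)"
      "\<And>e. e \<in> E \<Longrightarrow> cosh (J e) - 1 \<le> C * sinh (J e)" "\<And>e. e \<in> E \<Longrightarrow> 1 \<le> C * sinh (J e)"
    and walk: "((\<lambda>a b. {a, b} \<in> E) ^^ l) u v" and V: "u \<in> V" "v \<in> V"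
    and X: "\<And>w. w \<in> V \<Longrightarrow> (\<Sum>x\<in>V. tp J x w) = X" "\<And>w. w \<in> V \<Longrightarrow> (\<Sum>x\<in>V. tp J' x w) = X'"
    and small: "(\<Sum>w\<in>V. tp J u w * tp J' w v) \<le> 1 / 2"
  shows "X * X' / 2 \<le> (2 * C) ^ l * (\<Sum>x\<in>V. \<Sum>y\<in>V. through J x y u)"
proof -
  have J0: "0 \<le> J e" if "e \<in> E" for e using J that order_trans by blast
  have "0 \<le> (\<Sum>x\<in>V. tp J x u)" "0 \<le> (\<Sum>x\<in>V. tp J' x u)"
    by (intro sum_nonneg tp_nonneg J0 J V; assumption)+
  then have XX: "0 \<le> X * X'" by (simp add: X V)
  have "X * X' * (1 / 2) \<le> X * X' * (1 - (\<Sum>w\<in>V. tp J u w * tp J' w v))"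
    by (intro mult_left_mono XX) (use small in simp)
  also have "\<dots> = X * X' - (\<Sum>w\<in>V. X * (tp J w u * (X' * tp J' w v)))"
    by (simp add: sum_distrib_left right_diff_distrib tp_commute[of J u] mult_ac)
  also have "\<dots> = X * X' - (\<Sum>w\<in>V. \<Sum>x\<in>V. \<Sum>y\<in>V. tp J x w * tp J w u * (tp J' y w * tp J' w v))"
  proof -
    have "X * (tp J w u * (X' * tp J' w v)) =
        (\<Sum>x\<in>V. \<Sum>y\<in>V. tp J x w * tp J w u * (tp J' y w * tp J' w v))" if "w \<in> V" for w
    proof -
      have "X * (tp J w u * (X' * tp J' w v)) = (tp J w u * tp J' w v) * (X * X')"
        by (simp only: mult_ac)
      also have "\<dots> = (\<Sum>x\<in>V. \<Sum>y\<in>V. tp J x w * tp J w u * (tp J' y w * tp J' w v))"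
        unfolding X(1)[OF that, symmetric] X(2)[OF that, symmetric] sum_product
        unfolding sum_distrib_left by (intro sum.cong refl) (simp only: mult_ac)
      finally show ?thesis .
    qed
    then show ?thesis by simp
  qed
  also have "\<dots> = (\<Sum>x\<in>V. \<Sum>y\<in>V. tp J x u * tp J' y v -
      (\<Sum>w\<in>V. tp J x w * tp J w u * (tp J' y w * tp J' w v)))"
  proof -
    have "X * X' = (\<Sum>x\<in>V. \<Sum>y\<in>V. tp J x u * tp J' y v)"
      unfolding X(1)[OF V(1), symmetric] X(2)[OF V(2), symmetric] by (rule sum_product)
    moreover have "(\<Sum>w\<in>V. \<Sum>x\<in>V. \<Sum>y\<in>V. tp J x w * tp J w u * (tp J' y w * tp J' w v)) =
        (\<Sum>x\<in>V. \<Sum>y\<in>V. \<Sum>w\<in>V. tp J x w * tp J w u * (tp J' y w * tp J' w v))"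
      by (subst sum.swap) (intro sum.cong refl sum.swap)
    ultimately show ?thesis by (simp only: sum_subtractf)
  qed
  also have "\<dots> \<le> (\<Sum>x\<in>V. \<Sum>y\<in>V. fp J x y u v - tp J x y * tp J u v)"
    by (intro sum_mono truncated_lower J V)
  also have "\<dots> \<le> (\<Sum>x\<in>V. \<Sum>y\<in>V. (2 * C) ^ l * through J x y u)"
    by (intro sum_mono through_lower[OF _ assms(3) _ _ _ walk] J0 C V)
  finally show ?thesis by (simp add: sum_distrib_left)
qed

subsection \<open>Small couplings and isolated vertices\<close>

lemma part_isolated:
  assumes "x \<in> V" "y \<in> V" "x \<noteq> y" "\<And>e. e \<in> E \<Longrightarrow> x \<in> e \<Longrightarrow> J e = 0"
  shows "tp J x y = 0"
proof -
  have e: "J e * prod (flip {x} \<sigma>) e = J e * prod \<sigma> e" if "e \<in> E" for e \<sigma>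
  proof (cases "x \<in> e")
    case False
    then have "prod (flip {x} \<sigma>) e = prod \<sigma> e" using that by (intro flip_edge) auto
    then show ?thesis by simp
  qed (use assms(4) that in simp)
  have "part J (\<lambda>\<sigma>. \<sigma> x * \<sigma> y) = (\<Sum>\<sigma>\<in>conf. (flip {x} \<sigma> x * flip {x} \<sigma> y) * exp (\<Sum>e\<in>E. J e * prod (flip {x} \<sigma>) e))"
    unfolding part_def by (rule sum_flip)
  also have "\<dots> = - part J (\<lambda>\<sigma>. \<sigma> x * \<sigma> y)"
    unfolding part_def sum_negf[symmetric]
    by (intro sum.cong refl) (use assms(1-3) in \<open>simp add: e flip_apply cong: sum.cong\<close>)
  finally show ?thesis by (simp add: ev_def)
qed

text \<open>Splitting off the factor cosh + sinh \<sigma>_x \<sigma>_v of the edge gives an exact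
  quotient; its denominator is bounded below by cosh, and <vy> is raised back to the full
  couplings.\<close>

lemma tp_remove_edge:
  assumes J: "\<And>e. e \<in> E \<Longrightarrow> 0 \<le> J e" and e: "{x, v} \<in> E" and y: "y \<in> V"
  shows "tp J x y \<le> tp (J({x, v} := 0)) x y + tanh (J {x, v}) * tp J v y"
proof -
  let ?e = "{x, v}"
  let ?K = "J(?e := 0)"
  let ?c = "cosh (J ?e)" and ?s = "sinh (J ?e)"
  have V: "x \<in> V" "v \<in> V" "x \<noteq> v" using edge[OF e] by auto
  have exp_eq: "exp (\<Sum>e\<in>E. J e * prod \<sigma> e) = (?c + ?s * (\<sigma> x * \<sigma> v)) * exp (\<Sum>e\<in>E. ?K e * prod \<sigma> e)"
    if "\<sigma> \<in> conf" for \<sigma>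
  proof -
    have "(\<Sum>e\<in>E. J e * prod \<sigma> e) = J ?e * prod \<sigma> ?e + (\<Sum>e\<in>E. ?K e * prod \<sigma> e)"
      using finite_E e by (simp add: sum.remove[of E ?e])
    then show ?thesis using exp_edge[OF that e, of "J ?e"] V by (simp add: exp_add)
  qed
  have Z: "Z J = ?c * Z ?K + ?s * part ?K (\<lambda>\<sigma>. \<sigma> x * \<sigma> v)"
    unfolding part_def sum_distrib_left sum.distrib[symmetric]
    by (intro sum.cong refl) (simp add: exp_eq algebra_simps)
  have P: "part J (\<lambda>\<sigma>. \<sigma> x * \<sigma> y) = ?c * part ?K (\<lambda>\<sigma>. \<sigma> x * \<sigma> y) + ?s * part ?K (\<lambda>\<sigma>. \<sigma> v * \<sigma> y)"
    unfolding part_def sum_distrib_left sum.distrib[symmetric]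
    by (intro sum.cong refl) (use V spin_square_left in \<open>simp add: exp_eq algebra_simps\<close>)
  have K0: "0 \<le> ?K e" if "e \<in> E" for e using J that by simp
  have s: "0 \<le> ?s" "0 < ?c" using J[OF e] by simp_all
  have xv: "0 \<le> tp ?K x v" and xy: "0 \<le> tp ?K x y" and vy: "0 \<le> tp ?K v y"
    using V y K0 by (intro tp_nonneg; simp)+
  have "tp J x y = (?c * tp ?K x y + ?s * tp ?K v y) / (?c + ?s * tp ?K x v)"
  proof -
    have z: "part ?K f = ev ?K f * Z ?K" for f using Z_pos[of ?K] by (simp add: ev_def)
    have "tp J x y = ((?c * tp ?K x y + ?s * tp ?K v y) * Z ?K) / ((?c + ?s * tp ?K x v) * Z ?K)"
      unfolding ev_def[of J] Z P z[of "\<lambda>\<sigma>. \<sigma> x * \<sigma> y"] z[of "\<lambda>\<sigma>. \<sigma> v * \<sigma> y"] z[of "\<lambda>\<sigma>. \<sigma> x * \<sigma> v"]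
      by (simp only: distrib_right mult.assoc)
    then show ?thesis using Z_pos[of ?K] by simp
  qed
  also have "\<dots> \<le> (?c * tp ?K x y + ?s * tp ?K v y) / ?c"
  proof (rule divide_left_mono)
    show "?c \<le> ?c + ?s * tp ?K x v" using s xv by simp
    show "0 \<le> ?c * tp ?K x y + ?s * tp ?K v y" using s xy vy by simp
    have "0 < ?c + ?s * tp ?K x v" by (rule add_pos_nonneg) (use s xv in simp_all)
    then show "0 < (?c + ?s * tp ?K x v) * ?c" using s(2) by (rule mult_pos_pos)
  qed
  also have "\<dots> = tp ?K x y + tanh (J ?e) * tp ?K v y"
    using s by (simp add: tanh_def add_divide_distrib)
  also have "\<dots> \<le> tp ?K x y + tanh (J ?e) * tp J v y"
  proof (intro add_left_mono mult_left_mono)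
    show "tp ?K v y \<le> tp J v y" by (intro tp_mono V y K0) (use J in auto)
  qed (use J[OF e] in simp)
  finally show ?thesis .
qed

text \<open>The edges at x are removed one by one until x is isolated and its correlation with y
  vanishes.\<close>

lemma tp_neighbours:
  assumes J: "\<And>e. e \<in> E \<Longrightarrow> 0 \<le> J e" and V: "x \<in> V" "y \<in> V" "x \<noteq> y"
  shows "tp J x y \<le> (\<Sum>v | {x, v} \<in> E. tanh (J {x, v}) * tp J v y)"
proof -
  have fin: "finite {v. {x, v} \<in> E}"
    by (rule finite_subset[OF _ finite_V]) (use edge in auto)
  have "tp J x y \<le> tp (\<lambda>e. if e \<in> (\<lambda>v. {x, v}) ` A then 0 else J e) x y + (\<Sum>v\<in>A. tanh (J {x, v}) * tp J v y)"
    if "A \<subseteq> {v. {x, v} \<in> E}" for A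
    using finite_subset[OF that fin] that
  proof (induction rule: finite_induct)
    case empty
    then show ?case by simp
  next
    case (insert v A)
    let ?K = "\<lambda>A e. if e \<in> (\<lambda>v. {x, v}) ` A then 0 else J e"
    have e: "{x, v} \<in> E" using insert.prems by simp
    have v: "v \<in> V" using edge[OF e] by auto
    have notin: "{x, v} \<notin> (\<lambda>v. {x, v}) ` A"
      using insert.hyps by (auto simp: doubleton_eq_iff)
    have upd: "(?K A)({x, v} := 0) = ?K (insert v A)" by auto
    have "tp (?K A) x y \<le> tp (?K (insert v A)) x y + tanh (?K A {x, v}) * tp (?K A) v y"
      unfolding upd[symmetric] by (rule tp_remove_edge[OF _ e V(2)]) (simp add: J)
    also have "\<dots> \<le> tp (?K (insert v A)) x y + tanh (J {x, v}) * tp J v y"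
      using notin J[OF e] by (auto intro!: mult_left_mono tp_mono v V simp: J)
    finally show ?case using insert by simp
  qed
  from this[of "{v. {x, v} \<in> E}"]
  have "tp J x y \<le> tp (\<lambda>e. if e \<in> (\<lambda>v. {x, v}) ` {v. {x, v} \<in> E} then 0 else J e) x y +
      (\<Sum>v | {x, v} \<in> E. tanh (J {x, v}) * tp J v y)" by simp
  moreover have "tp (\<lambda>e. if e \<in> (\<lambda>v. {x, v}) ` {v. {x, v} \<in> E} then 0 else J e) x y = 0"
  proof (rule part_isolated[OF V])
    fix e assume e: "e \<in> E" "x \<in> e"
    then obtain v where "e = {x, v}"
      by (elim edge_cases) (auto simp: insert_commute)
    then show "(if e \<in> (\<lambda>v. {x, v}) ` {v. {x, v} \<in> E} then 0 else J e) = 0" using e by auto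
  qed
  ultimately show ?thesis by simp
qed

text \<open>The largest row sum M satisfies M \<le> 1 + d tanh \<beta> M \<le> 1 + M / 2. Since only
  the degree enters, this bounds the susceptibility at high temperature uniformly over
  boxes.\<close>

lemma sum_tp_le:
  assumes \<beta>: "0 \<le> \<beta>" "real d * tanh \<beta> \<le> 1 / 2" and d: "\<And>x. x \<in> V \<Longrightarrow> card {v. {x, v} \<in> E} \<le> d"
    and x: "x \<in> V"
  shows "(\<Sum>y\<in>V. tp (\<lambda>_. \<beta>) x y) \<le> 2"
proof -
  let ?S = "\<lambda>x. \<Sum>y\<in>V. tp (\<lambda>_. \<beta>) x y"
  define M where "M = Max (?S ` V)"
  have fin: "finite (?S ` V)" "?S ` V \<noteq> {}" using finite_V x by auto
  have M: "?S a \<le> M" if "a \<in> V" for a using fin that unfolding M_def by (intro Max_ge) auto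
  obtain a where a: "a \<in> V" "M = ?S a" using Max_in[OF fin] unfolding M_def by auto
  have nn: "0 \<le> tp (\<lambda>_. \<beta>) a b" if "a \<in> V" "b \<in> V" for a b using that \<beta> by (intro tp_nonneg) auto
  have N: "v \<in> V" if "{a, v} \<in> E" for v using edge[OF that] by auto
  have finN: "finite {v. {a, v} \<in> E}" by (rule finite_subset[OF _ finite_V]) (use N in auto)
  have M0: "0 \<le> M" unfolding a(2) by (intro sum_nonneg nn a)
  have t: "0 \<le> tanh \<beta>" using \<beta> by simp
  have "?S a = 1 + (\<Sum>y\<in>V - {a}. tp (\<lambda>_. \<beta>) a y)"
    using finite_V a by (simp add: sum.remove tp_same)
  also have "(\<Sum>y\<in>V - {a}. tp (\<lambda>_. \<beta>) a y) \<le> (\<Sum>y\<in>V - {a}. \<Sum>v | {a, v} \<in> E. tanh \<beta> * tp (\<lambda>_. \<beta>) v y)"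
    by (intro sum_mono tp_neighbours) (use a \<beta> in auto)
  also have "\<dots> = (\<Sum>v | {a, v} \<in> E. tanh \<beta> * (\<Sum>y\<in>V - {a}. tp (\<lambda>_. \<beta>) v y))"
    by (subst sum.swap) (simp add: sum_distrib_left)
  also have "\<dots> \<le> (\<Sum>v | {a, v} \<in> E. tanh \<beta> * M)"
  proof (intro sum_mono mult_left_mono t)
    fix v assume v: "v \<in> {v. {a, v} \<in> E}"
    have "(\<Sum>y\<in>V - {a}. tp (\<lambda>_. \<beta>) v y) \<le> ?S v"
      using v N by (intro sum_mono2 finite_V nn) auto
    then show "(\<Sum>y\<in>V - {a}. tp (\<lambda>_. \<beta>) v y) \<le> M" using M[of v] N v by simp
  qed
  also have "\<dots> \<le> (real d * tanh \<beta>) * M"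
    using d[OF a(1)] t M0 by (simp add: mult_right_mono mult.assoc)
  also have "\<dots> \<le> 1 / 2 * M" by (intro mult_right_mono \<beta> M0)
  finally have "M \<le> 2" using a by simp
  then show ?thesis using M[OF x] by simp
qed

end

subsection \<open>Comparison of graphs\<close>

lemma sum_PiE_extend:
  fixes f :: "('v \<Rightarrow> real) \<Rightarrow> real"
  assumes "finite W" "V \<inter> W = {}"
  shows "(\<Sum>\<sigma>\<in>(V \<union> W) \<rightarrow>\<^sub>E {-1, 1}. f (restrict \<sigma> V)) = 2 ^ card W * (\<Sum>\<sigma>\<in>V \<rightarrow>\<^sub>E {-1, 1}. f \<sigma>)"
  using assms
proof (induction rule: finite_induct)
  case empty
  have "f (restrict \<sigma> V) = f \<sigma>" if "\<sigma> \<in> V \<rightarrow>\<^sub>E {-1, 1}" for \<sigma>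
    using that by (simp add: PiE_restrict)
  then show ?case by simp
next
  case (insert w W)
  have w: "w \<notin> V \<union> W" "w \<notin> V" using insert by auto
  have ins: "V \<union> insert w W = insert w (V \<union> W)" by simp
  have "(\<Sum>\<sigma>\<in>(V \<union> insert w W) \<rightarrow>\<^sub>E {-1, 1}. f (restrict \<sigma> V)) =
      (\<Sum>(y, g)\<in>{-1, 1} \<times> ((V \<union> W) \<rightarrow>\<^sub>E {-1, 1}). f (restrict (g(w := y)) V))"
    unfolding ins PiE_insert_eq
    by (subst sum.reindex[OF inj_combinator[OF w(1)]]) (simp add: case_prod_unfold)
  also have "\<dots> = (\<Sum>y\<in>{-1, 1 :: real}. \<Sum>g\<in>(V \<union> W) \<rightarrow>\<^sub>E {-1, 1}. f (restrict g V))"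
  proof -
    have "restrict (g(w := y)) V = restrict g V" for g :: "'v \<Rightarrow> real" and y
      using w(2) by (intro ext) (simp add: restrict_def)
    then show ?thesis by (simp add: sum.cartesian_product[symmetric])
  qed
  also have "\<dots> = 2 * (2 ^ card W * (\<Sum>\<sigma>\<in>V \<rightarrow>\<^sub>E {-1, 1}. f \<sigma>))"
  proof -
    have "(\<Sum>g\<in>(V \<union> W) \<rightarrow>\<^sub>E {-1, 1}. f (restrict g V)) = 2 ^ card W * (\<Sum>\<sigma>\<in>V \<rightarrow>\<^sub>E {-1, 1}. f \<sigma>)"
      by (rule insert.IH) (use insert.prems in auto)
    then show ?thesis by (simp only:) simp
  qed
  finally show ?case by (simp only: card_insert_disjoint[OF insert.hyps] power_Suc mult.assoc)
qed

context ising_graph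
begin

lemma expectation_eq_ev: "ising_expectation (V, E) \<beta> F = ev (\<lambda>_. \<beta>) F"
  unfolding ising_expectation_def ev_def part_def ising_weight_def by (simp add: sum_distrib_left)

lemma two_point_eq_tp: "two_point (V, E) \<beta> x y = tp (\<lambda>_. \<beta>) x y"
  by (simp add: two_point_def expectation_eq_ev)

lemma tp_extend:
  assumes "V \<subseteq> V'" "finite V'" and xy: "x \<in> V" "y \<in> V"
  shows "ising_graph.tp V' E J x y = tp J x y"
proof -
  interpret W: ising_graph V' E
    by unfold_locales (use assms edge in auto)
  define D where "D = V' - V"
  have D: "finite D" "V \<inter> D = {}" "V' = V \<union> D" using assms by (auto simp: D_def)
  have "W.part J f = 2 ^ card D * part J f" if f: "\<And>\<sigma>. f (restrict \<sigma> V) = f \<sigma>" for f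
  proof -
    have "prod (restrict \<sigma> V) e = prod \<sigma> e" if "e \<in> E" for e and \<sigma> :: "'v \<Rightarrow> real"
      by (rule prod.cong) (use edge[OF that] in auto)
    then have "W.part J f = (\<Sum>\<sigma>\<in>W.conf. f (restrict \<sigma> V) * exp (\<Sum>e\<in>E. J e * prod (restrict \<sigma> V) e))"
      unfolding W.part_def by (simp add: f)
    also have "W.conf = (V \<union> D) \<rightarrow>\<^sub>E {-1, 1}"
      unfolding D(3)[symmetric] by (rule W.conf_def)
    also have "(\<Sum>\<sigma>\<in>(V \<union> D) \<rightarrow>\<^sub>E {-1, 1}. f (restrict \<sigma> V) * exp (\<Sum>e\<in>E. J e * prod (restrict \<sigma> V) e)) =
        2 ^ card D * part J f"
      unfolding part_def conf_def by (rule sum_PiE_extend[OF D(1,2)])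
    finally show ?thesis .
  qed
  then have "W.part J (\<lambda>_. 1) = 2 ^ card D * Z J" "W.part J (\<lambda>\<sigma>. \<sigma> x * \<sigma> y) = 2 ^ card D * part J (\<lambda>\<sigma>. \<sigma> x * \<sigma> y)"
    using xy by simp_all
  then show ?thesis by (simp add: W.ev_def ev_def)
qed

text \<open>Treating missing edges as zero couplings turns monotonicity in the couplings into
  monotonicity in the graph.\<close>

lemma tp_more_edges:
  assumes "F \<subseteq> E"
  shows "ising_graph.tp V F J x y = tp (\<lambda>e. if e \<in> F then J e else 0) x y"
proof -
  interpret F: ising_graph V F
    by unfold_locales (use assms edge finite_V in auto)
  have "(\<Sum>e\<in>F. J e * prod \<sigma> e) = (\<Sum>e\<in>E. (if e \<in> F then J e else 0) * prod \<sigma> e)" for \<sigma> :: "'v \<Rightarrow> real"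
    by (rule sum.mono_neutral_cong_left) (use assms finite_E in auto)
  then have "F.part J f = part (\<lambda>e. if e \<in> F then J e else 0) f" for f
    unfolding F.part_def part_def F.conf_def conf_def by simp
  then show ?thesis by (simp add: F.ev_def ev_def)
qed

lemma tp_automorphism:
  assumes f: "bij_betw f V V" "\<And>e. e \<in> E \<Longrightarrow> f ` e \<in> E" and xy: "x \<in> V" "y \<in> V"
  shows "tp (\<lambda>_. \<beta>) (f x) (f y) = tp (\<lambda>_. \<beta>) x y"
proof -
  have inj: "inj_on f V" and im: "f ` V = V" using f(1) by (auto simp: bij_betw_def)
  define h where "h = inv_into V f"
  have h: "bij_betw h V V" "\<And>v. v \<in> V \<Longrightarrow> f (h v) = v" "\<And>v. v \<in> V \<Longrightarrow> h (f v) = v"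
    unfolding h_def using f(1) by (auto simp: bij_betw_inv_into bij_betw_inv_into_right bij_betw_inv_into_left)
  have fV: "f v \<in> V" "h v \<in> V" if "v \<in> V" for v using that im h(1) by (auto simp: bij_betw_def)
  define T where "T = (\<lambda>g (\<sigma> :: 'v \<Rightarrow> real). \<lambda>v\<in>V. \<sigma> (g v))"
  have T_conf: "T g \<sigma> \<in> conf" if "\<sigma> \<in> conf" "\<And>v. v \<in> V \<Longrightarrow> g v \<in> V" for g \<sigma>
    using that unfolding conf_def T_def by (auto simp: restrict_PiE_iff)
  have T_inv: "T g (T g' \<sigma>) = \<sigma>" if "\<sigma> \<in> conf" "\<And>v. v \<in> V \<Longrightarrow> g v \<in> V" "\<And>v. v \<in> V \<Longrightarrow> g' (g v) = v" for g g' \<sigma>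
  proof
    fix v show "T g (T g' \<sigma>) v = \<sigma> v"
      using that PiE_arb[of \<sigma> V "\<lambda>_. {-1, 1}" v] by (cases "v \<in> V") (simp_all add: T_def conf_def)
  qed
  have inj_E: "inj_on ((`) f) E"
    by (rule inj_on_subset[OF inj_on_image_Pow[OF inj]]) (use edge in auto)
  have im_E: "(`) f ` E = E"
    by (rule card_subset_eq) (use f(2) inj_E finite_E in \<open>auto simp: card_image\<close>)
  have "prod (T f \<sigma>) e = prod \<sigma> (f ` e)" if "e \<in> E" for e \<sigma>
  proof -
    have "inj_on f e" using inj edge[OF that] inj_on_subset by blast
    then have "prod \<sigma> (f ` e) = prod (\<lambda>v. \<sigma> (f v)) e" by (simp add: prod.reindex)
    also have "\<dots> = prod (T f \<sigma>) e" by (rule prod.cong) (use edge[OF that] in \<open>auto simp: T_def\<close>)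
    finally show ?thesis ..
  qed
  then have H: "(\<Sum>e\<in>E. \<beta> * prod (T f \<sigma>) e) = (\<Sum>e\<in>E. \<beta> * prod \<sigma> e)" for \<sigma>
    using sum.reindex[OF inj_E, of "\<lambda>e. \<beta> * prod \<sigma> e"] im_E by (simp cong: sum.cong)
  have "part (\<lambda>_. \<beta>) (\<lambda>\<sigma>. \<sigma> x * \<sigma> y) =
      (\<Sum>\<sigma>\<in>conf. (T f \<sigma> x * T f \<sigma> y) * exp (\<Sum>e\<in>E. \<beta> * prod (T f \<sigma>) e))"
    unfolding part_def
    by (rule sum.reindex_bij_witness[where i = "T f" and j = "T h"]) (simp_all add: T_conf T_inv fV h)
  also have "\<dots> = part (\<lambda>_. \<beta>) (\<lambda>\<sigma>. \<sigma> (f x) * \<sigma> (f y))"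
    unfolding H part_def using xy by (simp add: T_def)
  finally show ?thesis by (simp add: ev_def)
qed

end

subsection \<open>Boxes and tori\<close>

text \<open>Integer form of the half-open interval; the rounding in \<open>r div 2\<close> is right
  for even and for odd \<open>r\<close>.\<close>

definition box_range :: "nat \<Rightarrow> int set" where
  "box_range r = {- int (r div 2) ..< int r - int (r div 2)}"

lemma box_points_iff: "x \<in> box_points r \<longleftrightarrow> (\<forall>i. x $ i \<in> box_range r)"
proof -
  have "(- (real r / 2) \<le> real_of_int k \<and> real_of_int k < real r / 2) \<longleftrightarrow> k \<in> box_range r" for k
  proof -
    have "(- (real r / 2) \<le> real_of_int k) \<longleftrightarrow> real_of_int (- int r) \<le> real_of_int (2 * k)" by auto
    moreover have "(real_of_int k < real r / 2) \<longleftrightarrow> real_of_int (2 * k) < real_of_int (int r)" by auto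
    ultimately show ?thesis unfolding box_range_def of_int_le_iff of_int_less_iff by auto
  qed
  then show ?thesis by (simp add: box_points_def)
qed

lemma bij_betw_vec_PiE:
  "bij_betw (\<lambda>x :: int ^ 'd::finite. ($) x) {x. \<forall>i. x $ i \<in> I} (UNIV \<rightarrow>\<^sub>E I)"
  by (rule bij_betwI[where g = "\<lambda>f. \<chi> i. f i"]) auto

lemma finite_vec_range:
  assumes "finite I"
  shows "finite {x :: int ^ 'd::finite. \<forall>i. x $ i \<in> I}"
proof -
  have "finite ((UNIV :: 'd set) \<rightarrow>\<^sub>E I)" by (rule finite_PiE) (simp_all add: assms)
  then show ?thesis using bij_betw_finite[OF bij_betw_vec_PiE[where I = I and 'd = 'd]] by simp
qed

lemma finite_box_points: "finite (box_points r :: (int ^ 'd::finite) set)"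
proof -
  have "(box_points r :: (int ^ 'd) set) = {x. \<forall>i. x $ i \<in> box_range r}"
    using box_points_iff by blast
  then show ?thesis using finite_vec_range[of "box_range r"] by (simp add: box_range_def)
qed

lemma card_box_points: "card (box_points r :: (int ^ 'd::finite) set) = r ^ CARD('d)"
proof -
  have "(box_points r :: (int ^ 'd) set) = {x. \<forall>i. x $ i \<in> box_range r}"
    using box_points_iff by blast
  moreover have "card (box_range r) = r" by (simp add: box_range_def)
  ultimately show ?thesis
    using bij_betw_same_card[OF bij_betw_vec_PiE[where I = "box_range r" and 'd = 'd]]
    by (simp add: card_PiE)
qed

lemma sum_box_prod:
  fixes g :: "int \<Rightarrow> real"
  shows "(\<Sum>x\<in>(box_points r :: (int ^ 'd::finite) set). \<Prod>i\<in>UNIV. g (x $ i)) = (\<Sum>k\<in>box_range r. g k) ^ CARD('d)"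
proof -
  have "(box_points r :: (int ^ 'd) set) = {x. \<forall>i. x $ i \<in> box_range r}"
    using box_points_iff by blast
  then have "(\<Sum>x\<in>(box_points r :: (int ^ 'd) set). \<Prod>i\<in>UNIV. g (x $ i)) =
      (\<Sum>f\<in>UNIV \<rightarrow>\<^sub>E box_range r. \<Prod>i\<in>(UNIV :: 'd set). g (f i))"
    using sum.reindex_bij_betw[OF bij_betw_vec_PiE[where I = "box_range r"], of "\<lambda>f. \<Prod>i\<in>UNIV. g (f i)"] by simp
  also have "\<dots> = (\<Prod>i\<in>(UNIV :: 'd set). \<Sum>k\<in>box_range r. g k)"
    by (subst prod_sum_PiE) (simp_all add: box_range_def)
  finally show ?thesis by simp
qed

lemma nearest_neighbours_ne: "nearest_neighbours x y \<Longrightarrow> x \<noteq> y"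
  by (auto simp: nearest_neighbours_def)

lemma fst_box [simp]: "fst (box r) = box_points r" and fst_torus [simp]: "fst (torus r) = box_points r"
  by (simp_all add: box_def torus_def)

lemma ising_graph_box: "ising_graph (box_points r :: (int ^ 'd::finite) set) (snd (box r))"
proof
  fix e assume "e \<in> snd (box r :: (int ^ 'd) graph)"
  then show "e \<subseteq> box_points r \<and> card e = 2"
    using nearest_neighbours_ne by (fastforce simp: box_def card_2_iff)
qed (rule finite_box_points)

lemma two_point_box: "two_point (box r) \<beta> x y =
    ising_graph.tp (box_points r :: (int ^ 'd::finite) set) (snd (box r)) (\<lambda>_. \<beta>) x y"
  using ising_graph.two_point_eq_tp[OF ising_graph_box, of r \<beta> x y] by (metis fst_box prod.collapse)

lemma box_points_mono: "r \<le> r' \<Longrightarrow> box_points r \<subseteq> box_points r'"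
  by (auto simp: box_points_def) (smt (verit, best) of_nat_le_iff field_sum_of_halves)+

lemma two_point_box_mono:
  assumes "0 \<le> \<beta>" "r \<le> r'" "x \<in> box_points r" "y \<in> box_points r"
  shows "two_point (box r) \<beta> x y \<le> two_point (box r') \<beta> x (y :: int ^ 'd::finite)"
proof -
  interpret B: ising_graph "box_points r :: (int ^ 'd) set" "snd (box r)" by (rule ising_graph_box)
  interpret B': ising_graph "box_points r' :: (int ^ 'd) set" "snd (box r')" by (rule ising_graph_box)
  have sub: "snd (box r :: (int ^ 'd) graph) \<subseteq> snd (box r')"
    using box_points_mono[OF assms(2)] by (fastforce simp: box_def)
  have xy: "x \<in> box_points r'" "y \<in> box_points r'" using box_points_mono[OF assms(2)] assms by auto
  have "B.tp (\<lambda>_. \<beta>) x y = ising_graph.tp (box_points r') (snd (box r)) (\<lambda>_. \<beta>) x y"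
    by (rule B.tp_extend[symmetric]) (use assms box_points_mono finite_box_points in auto)
  also have "\<dots> = B'.tp (\<lambda>e. if e \<in> snd (box r) then \<beta> else 0) x y"
    by (rule B'.tp_more_edges[OF sub])
  also have "\<dots> \<le> B'.tp (\<lambda>_. \<beta>) x y"
    by (rule B'.tp_mono[OF xy]) (use assms in auto)
  finally show ?thesis by (simp only: two_point_box)
qed

lemma eventually_in_box: "eventually (\<lambda>r. x \<in> box_points r) sequentially"
proof -
  define m where "m = Max (range (\<lambda>i. nat \<bar>x $ i\<bar>))"
  have m: "nat \<bar>x $ i\<bar> \<le> m" for i unfolding m_def by (rule Max_ge) auto
  have "x \<in> box_points r" if "2 * m + 2 \<le> r" for r
    unfolding box_points_iff
  proof
    fix i show "x $ i \<in> box_range r" using m[of i] that by (auto simp: box_range_def)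
  qed
  then show ?thesis unfolding eventually_sequentially by blast
qed

section \<open>Infinite volume and the critical point\<close>

text \<open>Once both points lie in the box, the sequence increases and is bounded by 1, so the
  \<open>lim\<close> in \<open>tau\<close> is a genuine limit.\<close>

lemma tau_limit:
  assumes "0 \<le> \<beta>"
  shows "(\<lambda>r. two_point (box r) \<beta> x y) \<longlonglongrightarrow> tau \<beta> x (y :: int ^ 'd::finite)"
proof -
  have "eventually (\<lambda>r. x \<in> box_points r \<and> y \<in> box_points r) sequentially"
    using eventually_in_box by (intro eventually_conj)
  then obtain R where R: "\<And>r. R \<le> r \<Longrightarrow> x \<in> box_points r \<and> y \<in> box_points r"
    unfolding eventually_sequentially by blast
  let ?f = "\<lambda>r. two_point (box (r + R)) \<beta> x y"
  have "incseq ?f"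
  proof (rule incseq_SucI)
    fix n
    have "x \<in> box_points (n + R)" "y \<in> box_points (n + R)" using R[of "n + R"] by simp_all
    then show "?f n \<le> ?f (Suc n)" by (intro two_point_box_mono assms) simp_all
  qed
  moreover have "?f r \<le> 1" for r
    unfolding two_point_box using R[of "r + R"] by (intro ising_graph.tp_le_1[OF ising_graph_box]) simp_all
  ultimately obtain L where "?f \<longlonglongrightarrow> L" using incseq_convergent[of ?f 1] by blast
  then have "convergent ?f" by (rule convergentI)
  then have "convergent (\<lambda>r. two_point (box r) \<beta> x y)"
    using convergent_ignore_initial_segment[of "\<lambda>r. two_point (box r) \<beta> x y" R] by simp
  then show ?thesis unfolding tau_def by (simp add: convergent_LIMSEQ_iff)
qed

lemma tau_same: "0 \<le> \<beta> \<Longrightarrow> tau \<beta> x x = 1"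
proof -
  assume "0 \<le> \<beta>"
  from tau_limit[OF this, of x x]
  have lim: "(\<lambda>r. two_point (box r) \<beta> x x) \<longlonglongrightarrow> tau \<beta> x x" .
  have "eventually (\<lambda>r. two_point (box r) \<beta> x x = 1) sequentially"
    using eventually_in_box[of x]
    by (rule eventually_mono) (simp add: two_point_box ising_graph.tp_same[OF ising_graph_box])
  then have "(\<lambda>r. two_point (box r) \<beta> x x) \<longlonglongrightarrow> 1" by (rule tendsto_eventually)
  with lim show "tau \<beta> x x = 1" by (rule LIMSEQ_unique)
qed

lemma chi_ge_1:
  assumes "0 \<le> \<beta>" shows "1 \<le> chi (TYPE('d::finite)) \<beta>"
proof -
  have "(\<Sum>x\<in>{0 :: int ^ 'd}. ennreal (tau \<beta> 0 x)) \<le> (\<Sum>\<^sub>\<infinity>x\<in>(UNIV :: (int ^ 'd) set). ennreal (tau \<beta> 0 x))"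
    by (subst nonneg_infsum_complete) (simp_all only: zero_le, rule SUP_upper, simp)
  then show ?thesis using tau_same[OF assms, of "0 :: int ^ 'd"] by (simp add: chi_def)
qed

text \<open>At high temperature \<open>sum_tp_le\<close> bounds the susceptibility by 2. Positivity
  of the critical point is what keeps \<open>beta_star\<close> positive for large
  \<open>r\<close>.\<close>

lemma critical_point_pos: "0 < critical_point (TYPE('d::finite))"
proof -
  define W where "W = {w :: int ^ 'd. \<forall>i. w $ i \<in> {-1..1}}"
  define d where "d = card W"
  have finW: "finite W" unfolding W_def by (rule finite_vec_range) simp
  have deg: "card {v. {x, v} \<in> snd (box r)} \<le> d" for x :: "int ^ 'd" and r
  proof -
    have nn: "v \<in> (\<lambda>w. x + w) ` W" if "nearest_neighbours x v \<or> nearest_neighbours v x" for v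
    proof -
      have "\<bar>v $ i - x $ i\<bar> \<le> 1" for i
      proof -
        have "\<bar>a $ i - b $ i\<bar> \<le> 1" if "nearest_neighbours a b" for a b :: "int ^ 'd"
          using member_le_sum[of i UNIV "\<lambda>i. \<bar>a $ i - b $ i\<bar>"] that by (simp add: nearest_neighbours_def)
        then show ?thesis using that by (metis abs_minus_commute)
      qed
      then have "v - x \<in> W" unfolding W_def by (auto simp: abs_le_iff) (smt (verit))+
      then show ?thesis by (intro image_eqI[of _ _ "v - x"]) auto
    qed
    have "{v. {x, v} \<in> snd (box r)} \<subseteq> (\<lambda>w. x + w) ` W"
      using nn by (auto simp: box_def doubleton_eq_iff)
    then have "card {v. {x, v} \<in> snd (box r)} \<le> card ((\<lambda>w. x + w) ` W)"
      using finW by (intro card_mono) auto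
    also have "\<dots> \<le> d" unfolding d_def by (rule card_image_le[OF finW])
    finally show ?thesis .
  qed
  obtain \<beta> :: real where \<beta>: "0 < \<beta>" "real d * tanh \<beta> \<le> 1 / 2"
  proof -
    have "isCont tanh (0 :: real)" by (intro continuous_intros) simp
    then have "((\<lambda>b :: real. real d * tanh b) \<longlongrightarrow> real d * tanh 0) (at_right 0)"
      by (intro tendsto_intros) (auto simp: isCont_def filterlim_at_split)
    then have "eventually (\<lambda>b :: real. real d * tanh b < 1 / 2) (at_right 0)"
      by (rule order_tendstoD) simp
    then have "eventually (\<lambda>b :: real. 0 < b \<and> real d * tanh b < 1 / 2) (at_right 0)"
      using eventually_at_right_less[of 0] by eventually_elim simp
    then have "\<exists>b :: real. 0 < b \<and> real d * tanh b < 1 / 2"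
      using eventually_happens[of _ "at_right (0::real)"] by auto
    then show thesis using that by force
  qed
  have "(\<Sum>x\<in>F. ennreal (tau \<beta> 0 x)) \<le> 2" if F: "finite F" for F :: "(int ^ 'd) set"
  proof -
    have nn: "eventually (\<lambda>r. 0 \<le> two_point (box r) \<beta> 0 x) sequentially" for x :: "int ^ 'd"
      using eventually_in_box[of "0 :: int ^ 'd"] eventually_in_box[of x]
      by eventually_elim (use \<beta> in \<open>simp add: two_point_box ising_graph.tp_nonneg[OF ising_graph_box]\<close>)
    have tau0: "0 \<le> tau \<beta> 0 x" for x :: "int ^ 'd"
      by (rule tendsto_lowerbound[OF tau_limit nn]) (use \<beta> in auto)
    have "eventually (\<lambda>r. \<forall>x\<in>insert 0 F. x \<in> box_points r) sequentially"
      by (rule eventually_ball_finite) (use F eventually_in_box in blast)+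
    then have "eventually (\<lambda>r. (\<Sum>x\<in>F. two_point (box r) \<beta> 0 x) \<le> 2) sequentially"
    proof (rule eventually_mono)
      fix r assume r: "\<forall>x\<in>insert 0 F. x \<in> box_points r"
      interpret B: ising_graph "box_points r :: (int ^ 'd) set" "snd (box r)" by (rule ising_graph_box)
      have "(\<Sum>x\<in>F. B.tp (\<lambda>_. \<beta>) 0 x) \<le> (\<Sum>x\<in>box_points r. B.tp (\<lambda>_. \<beta>) 0 x)"
        using r \<beta> by (intro sum_mono2 finite_box_points B.tp_nonneg) auto
      also have "\<dots> \<le> 2" by (rule B.sum_tp_le[where d = d]) (use r \<beta> deg in auto)
      finally show "(\<Sum>x\<in>F. two_point (box r) \<beta> 0 x) \<le> 2" by (simp only: two_point_box)
    qed
    then have "(\<Sum>x\<in>F. tau \<beta> 0 x) \<le> 2"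
      by (intro tendsto_upperbound[OF tendsto_sum[OF tau_limit]]) (use \<beta> in auto)
    then have "ennreal (\<Sum>x\<in>F. tau \<beta> 0 x) \<le> ennreal 2" by (rule ennreal_leI)
    then show ?thesis using tau0 by simp
  qed
  then have "chi (TYPE('d)) \<beta> \<le> 2"
    unfolding chi_def by (subst nonneg_infsum_complete) (auto intro!: SUP_least)
  then have "chi (TYPE('d)) \<beta> < \<infinity>"
    using order_le_less_trans[of _ "2 :: ennreal" \<infinity>] by simp
  then have "ennreal \<beta> \<le> critical_point (TYPE('d))"
    unfolding critical_point_def using \<beta> by (intro SUP_upper) auto
  then show ?thesis using \<beta> by (metis ennreal_eq_0_iff less_le_trans linorder_not_le zero_less_iff_neq_zero)
qed

lemma chi_real_bounds:
  assumes "susceptibility_bounds TYPE('d::finite)"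
  shows "0 < beta_c TYPE('d)" "\<exists>a>0. \<exists>A>0. \<forall>\<beta>. 0 < \<beta> \<and> \<beta> < beta_c TYPE('d) \<longrightarrow>
    a / (beta_c TYPE('d) - \<beta>) \<le> enn2real (chi TYPE('d) \<beta>) \<and> enn2real (chi TYPE('d) \<beta>) \<le> A / (beta_c TYPE('d) - \<beta>)"
proof -
  obtain a A where aA: "0 < a" "0 < A" and bounds: "\<And>\<beta>. 0 < \<beta> \<Longrightarrow> ennreal \<beta> < critical_point TYPE('d) \<Longrightarrow>
      ennreal a / (critical_point TYPE('d) - ennreal \<beta>) \<le> chi TYPE('d) \<beta> \<and>
      chi TYPE('d) \<beta> \<le> ennreal A / (critical_point TYPE('d) - ennreal \<beta>)"
    using assms unfolding susceptibility_bounds_def by blast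
  have fin: "critical_point TYPE('d) \<noteq> \<infinity>"
  proof
    assume inf: "critical_point TYPE('d) = \<infinity>"
    \<comment> \<open>Division by infinity gives 0, whereas the term x = 0 alone contributes 1 to
      the susceptibility.\<close>
    then have "chi TYPE('d) 1 \<le> ennreal A / (\<infinity> - ennreal 1)" using bounds[of 1] by simp
    also have "\<infinity> - ennreal 1 = \<infinity>" by (simp add: ennreal_top_minus)
    finally have "chi TYPE('d) 1 \<le> 0" by simp
    moreover have "1 \<le> chi TYPE('d) 1" by (rule chi_ge_1) simp
    ultimately show False by simp
  qed
  then have crit: "critical_point TYPE('d) = ennreal (beta_c TYPE('d))"
    unfolding beta_c_def by (simp add: less_top)
  show bc: "0 < beta_c TYPE('d)"
    using critical_point_pos[where 'd = 'd] crit by simp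
  have "a / (beta_c TYPE('d) - \<beta>) \<le> enn2real (chi TYPE('d) \<beta>) \<and> enn2real (chi TYPE('d) \<beta>) \<le> A / (beta_c TYPE('d) - \<beta>)"
    if \<beta>: "0 < \<beta>" "\<beta> < beta_c TYPE('d)" for \<beta>
  proof -
    have lt: "ennreal \<beta> < critical_point TYPE('d)" unfolding crit using \<beta> by (simp add: ennreal_less_iff)
    have diff: "critical_point TYPE('d) - ennreal \<beta> = ennreal (beta_c TYPE('d) - \<beta>)"
      unfolding crit using \<beta> by (simp add: ennreal_minus)
    have "ennreal a / (critical_point TYPE('d) - ennreal \<beta>) = ennreal (a / (beta_c TYPE('d) - \<beta>))"
      "ennreal A / (critical_point TYPE('d) - ennreal \<beta>) = ennreal (A / (beta_c TYPE('d) - \<beta>))"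
      unfolding diff using \<beta> aA by (simp_all add: divide_ennreal)
    then have b: "ennreal (a / (beta_c TYPE('d) - \<beta>)) \<le> chi TYPE('d) \<beta>" "chi TYPE('d) \<beta> \<le> ennreal (A / (beta_c TYPE('d) - \<beta>))"
      using bounds[OF \<beta>(1) lt] by simp_all
    have "enn2real (ennreal (a / (beta_c TYPE('d) - \<beta>))) \<le> enn2real (chi TYPE('d) \<beta>)"
      by (rule enn2real_mono[OF b(1)]) (use b(2) in \<open>simp add: le_less_trans\<close>)
    moreover have "enn2real (chi TYPE('d) \<beta>) \<le> enn2real (ennreal (A / (beta_c TYPE('d) - \<beta>)))"
      by (rule enn2real_mono[OF b(2)]) simp
    ultimately show ?thesis using \<beta> aA by simp
  qed
  then show "\<exists>a>0. \<exists>A>0. \<forall>\<beta>. 0 < \<beta> \<and> \<beta> < beta_c TYPE('d) \<longrightarrow>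
    a / (beta_c TYPE('d) - \<beta>) \<le> enn2real (chi TYPE('d) \<beta>) \<and> enn2real (chi TYPE('d) \<beta>) \<le> A / (beta_c TYPE('d) - \<beta>)"
    using aA by blast
qed

subsection \<open>Translations of the torus\<close>

definition torus_adjacent :: "nat \<Rightarrow> int ^ 'd::finite \<Rightarrow> int ^ 'd \<Rightarrow> bool" where
  "torus_adjacent r x y \<longleftrightarrow> (\<exists>z. nearest_neighbours x z \<and> (\<forall>i. [z $ i = y $ i] (mod int r)))"

lemma torus_adjacent_sym:
  assumes "torus_adjacent r x y" shows "torus_adjacent r y x"
proof -
  obtain z where z: "nearest_neighbours x z" "\<And>i. [z $ i = y $ i] (mod int r)"
    using assms by (auto simp: torus_adjacent_def)
  have "nearest_neighbours y (x + (y - z))"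
    using z(1) by (simp add: nearest_neighbours_def) (simp add: abs_minus_commute)
  moreover have "[(x + (y - z)) $ i = x $ i] (mod int r)" for i
    using z(2)[of i] by (simp add: cong_iff_dvd_diff dvd_diff_commute)
  ultimately show ?thesis unfolding torus_adjacent_def by blast
qed

lemma torus_edge_iff:
  "{x, y} \<in> snd (torus r) \<longleftrightarrow> x \<in> box_points r \<and> y \<in> box_points r \<and> torus_adjacent r x y"
proof -
  have "{x, y} \<in> snd (torus r) \<longleftrightarrow>
      (\<exists>a b. {x, y} = {a, b} \<and> a \<in> box_points r \<and> b \<in> box_points r \<and> torus_adjacent r a b)"
    by (simp add: torus_def torus_adjacent_def)
  then show ?thesis using torus_adjacent_sym by (auto simp: doubleton_eq_iff)
qed

lemma torus_edgeE:
  assumes "e \<in> snd (torus r)"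
  obtains x y where "e = {x, y}" "x \<in> box_points r" "y \<in> box_points r" "torus_adjacent r x y"
  using assms by (auto simp: torus_def torus_adjacent_def)

text \<open>Adjacent points differ by a unit step, whose nonzero coordinate is not a multiple of r
  once r is at least 2; for r = 1 there would be loops.\<close>

lemma torus_adjacent_ne:
  assumes "2 \<le> r" "torus_adjacent r x y" shows "x \<noteq> y"
proof
  assume "x = y"
  then obtain z where z: "nearest_neighbours x z" "\<And>i. [z $ i = x $ i] (mod int r)"
    using assms(2) by (auto simp: torus_adjacent_def)
  have "\<bar>x $ i - z $ i\<bar> = 0" for i
  proof -
    have "\<bar>x $ i - z $ i\<bar> \<le> 1"
      using member_le_sum[of i UNIV "\<lambda>i. \<bar>x $ i - z $ i\<bar>"] z(1) by (simp add: nearest_neighbours_def)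
    moreover have "int r dvd x $ i - z $ i"
      using z(2)[of i] by (simp add: cong_iff_dvd_diff dvd_diff_commute)
    ultimately show ?thesis using assms(1) zdvd_imp_le[of "int r" "\<bar>x $ i - z $ i\<bar>"] by force
  qed
  then show False using z(1) by (simp add: nearest_neighbours_def)
qed

lemma ising_graph_torus:
  assumes "2 \<le> r"
  shows "ising_graph (box_points r :: (int ^ 'd::finite) set) (snd (torus r))"
proof
  fix e assume "e \<in> snd (torus r :: (int ^ 'd) graph)"
  then show "e \<subseteq> box_points r \<and> card e = 2"
  proof (elim torus_edgeE)
    fix x y :: "int ^ 'd"
    assume "e = {x, y}" "x \<in> box_points r" "y \<in> box_points r" "torus_adjacent r x y"
    then show ?thesis using torus_adjacent_ne[OF assms, of x y] by simp
  qed
qed (rule finite_box_points)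

lemma torus_pair: "torus r = (box_points r, snd (torus r))"
  by (simp add: torus_def)

lemma two_point_torus:
  assumes "2 \<le> r"
  shows "two_point (torus r) \<beta> x y =
    ising_graph.tp (box_points r :: (int ^ 'd::finite) set) (snd (torus r)) (\<lambda>_. \<beta>) x y"
  by (subst torus_pair) (rule ising_graph.two_point_eq_tp[OF ising_graph_torus[OF assms]])

definition torus_rep :: "nat \<Rightarrow> int ^ 'd::finite \<Rightarrow> int ^ 'd" where
  "torus_rep r x = (\<chi> i. (x $ i + int (r div 2)) mod int r - int (r div 2))"

lemma torus_rep_cong: "[torus_rep r x $ i = x $ i] (mod int r)"
  by (simp add: torus_rep_def cong_def mod_diff_left_eq)

lemma torus_rep_in_box: "0 < r \<Longrightarrow> torus_rep r x \<in> box_points r"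
  by (simp add: box_points_iff box_range_def torus_rep_def)

lemma torus_rep_eq:
  assumes "\<And>i. [x $ i = y $ i] (mod int r)" shows "torus_rep r x = torus_rep r y"
proof -
  have "(x $ i + int (r div 2)) mod int r = (y $ i + int (r div 2)) mod int r" for i
    using cong_add[OF assms cong_refl, of i "int (r div 2)"] by (simp add: cong_def)
  then show ?thesis by (simp add: torus_rep_def vec_eq_iff)
qed

lemma torus_rep_same:
  assumes "x \<in> box_points r" shows "torus_rep r x = x"
proof -
  have "(x $ i + int (r div 2)) mod int r = x $ i + int (r div 2)" for i
  proof -
    have "- int (r div 2) \<le> x $ i" "x $ i < int r - int (r div 2)"
      using assms by (simp_all add: box_points_iff box_range_def)
    then show ?thesis by (intro mod_pos_pos_trivial) linarith+
  qed
  then show ?thesis by (simp add: torus_rep_def vec_eq_iff)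
qed

definition shift :: "nat \<Rightarrow> int ^ 'd::finite \<Rightarrow> int ^ 'd \<Rightarrow> int ^ 'd" where
  "shift r u x = torus_rep r (u + x)"

lemma shift_in_box: "0 < r \<Longrightarrow> shift r u x \<in> box_points r"
  by (simp add: shift_def torus_rep_in_box)

lemma shift_cong: "[shift r u x $ i = u $ i + x $ i] (mod int r)"
  using torus_rep_cong[of r "u + x" i] by (simp add: shift_def)

lemma shift_inverse:
  assumes "x \<in> box_points r" shows "shift r (- u) (shift r u x) = x"
proof -
  have "torus_rep r (- u + shift r u x) = torus_rep r x"
  proof (rule torus_rep_eq)
    fix i
    show "[(- u + shift r u x) $ i = x $ i] (mod int r)"
      using cong_add[OF cong_refl[of "- u $ i"] shift_cong[of r u x i]] by simp
  qed
  then show ?thesis using torus_rep_same[OF assms] by (simp add: shift_def)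
qed

lemma shift_inverse': "x \<in> box_points r \<Longrightarrow> shift r u (shift r (- u) x) = x"
  using shift_inverse[of x r "- u"] by simp

lemma shift_zero: "u \<in> box_points r \<Longrightarrow> shift r u 0 = u"
  by (simp add: shift_def torus_rep_same)

lemma bij_shift: "0 < r \<Longrightarrow> bij_betw (shift r u) (box_points r) (box_points r)"
  by (rule bij_betwI[where g = "shift r (- u)"]) (auto simp: shift_in_box shift_inverse shift_inverse')

lemma torus_adjacent_shift:
  assumes "torus_adjacent r x y" shows "torus_adjacent r (shift r u x) (shift r u y)"
proof -
  obtain z where z: "nearest_neighbours x z" "\<And>i. [z $ i = y $ i] (mod int r)"
    using assms by (auto simp: torus_adjacent_def)
  have "nearest_neighbours (shift r u x) (shift r u x + (z - x))"
    using z(1) by (simp add: nearest_neighbours_def abs_minus_commute)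
  moreover have "[(shift r u x + (z - x)) $ i = shift r u y $ i] (mod int r)" for i
  proof -
    have "[shift r u x $ i + (z $ i - x $ i) = u $ i + x $ i + (z $ i - x $ i)] (mod int r)"
      by (rule cong_add[OF shift_cong cong_refl])
    also have "u $ i + x $ i + (z $ i - x $ i) = u $ i + z $ i" by simp
    also have "[u $ i + z $ i = u $ i + y $ i] (mod int r)"
      by (rule cong_add[OF cong_refl z(2)])
    also have "[u $ i + y $ i = shift r u y $ i] (mod int r)"
      by (rule cong_sym[OF shift_cong])
    finally show ?thesis by simp
  qed
  ultimately show ?thesis unfolding torus_adjacent_def by blast
qed

lemma torus_edge_shift:
  assumes "0 < r" "e \<in> snd (torus r)" shows "shift r u ` e \<in> snd (torus r)"
  using assms(2) by (elim torus_edgeE)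
    (simp add: torus_edge_iff shift_in_box[OF assms(1)] torus_adjacent_shift)

lemma tp_torus_shift:
  fixes x y u :: "int ^ 'd::finite"
  assumes "2 \<le> r" "x \<in> box_points r" "y \<in> box_points r"
  shows "ising_graph.tp (box_points r) (snd (torus r)) (\<lambda>_. \<beta>) (shift r u x) (shift r u y) =
    ising_graph.tp (box_points r) (snd (torus r)) (\<lambda>_. \<beta>) x y"
  by (rule ising_graph.tp_automorphism[OF ising_graph_torus[OF assms(1)] bij_shift torus_edge_shift assms(2,3)])
    (use assms(1) in auto)

definition axis_point :: "int \<Rightarrow> int ^ 'd::finite" where
  "axis_point k = (\<chi> i. if i = (SOME i. True) then k else 0)"

lemma torus_walk:
  fixes u :: "int ^ 'd::finite"
  assumes r: "0 < r" "2 * l < r"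
  shows "((\<lambda>a b. {a, b} \<in> snd (torus r)) ^^ l) (shift r u 0) (shift r u (axis_point (int l)))"
  using assms(2)
proof (induction l)
  case 0
  have "axis_point 0 = (0 :: int ^ 'd)" by (simp add: axis_point_def vec_eq_iff)
  then show ?case by simp
next
  case (Suc l)
  have in_box: "(axis_point k :: int ^ 'd) \<in> box_points r" if "0 \<le> k" "2 * k < int r" for k
    using that r by (auto simp: axis_point_def box_points_iff box_range_def)
  have "nearest_neighbours (axis_point (int l) :: int ^ 'd) (axis_point (int (Suc l)))"
  proof -
    have "(\<Sum>i\<in>(UNIV :: 'd set). \<bar>(axis_point (int l) :: int ^ 'd) $ i - axis_point (int (Suc l)) $ i\<bar>) =
        (\<Sum>i\<in>(UNIV :: 'd set). if i = (SOME i. True) then 1 else 0)"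
      by (intro sum.cong refl) (simp add: axis_point_def)
    then show ?thesis by (simp add: nearest_neighbours_def)
  qed
  then have "torus_adjacent r (axis_point (int l) :: int ^ 'd) (axis_point (int (Suc l)))"
    unfolding torus_adjacent_def by (intro exI conjI) (assumption, simp)
  then have "{axis_point (int l) :: int ^ 'd, axis_point (int (Suc l))} \<in> snd (torus r)"
    using in_box[of "int l"] in_box[of "int (Suc l)"] Suc.prems by (simp add: torus_edge_iff)
  from torus_edge_shift[OF r(1) this, of u]
  have "{shift r u (axis_point (int l)), shift r u (axis_point (int (Suc l)))} \<in> snd (torus r)" by simp
  moreover have "((\<lambda>a b. {a, b} \<in> snd (torus r)) ^^ l) (shift r u 0) (shift r u (axis_point (int l)))"
    using Suc by simp
  ultimately show ?case by auto
qed

subsection \<open>Sums of powers of the norm\<close>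

abbreviation norm1 :: "int ^ 'd::finite \<Rightarrow> real" where
  "norm1 x \<equiv> max 1 (sup_norm x)"

lemma component_le_sup_norm: "\<bar>real_of_int (x $ i)\<bar> \<le> sup_norm x"
  unfolding sup_norm_def by (rule Max_ge) auto

lemma sup_norm_le: "(\<And>i. \<bar>real_of_int (x $ i)\<bar> \<le> c) \<Longrightarrow> sup_norm x \<le> c"
  unfolding sup_norm_def by (rule Max.boundedI) auto

lemma sup_norm_box: "x \<in> box_points r \<Longrightarrow> sup_norm x \<le> real r / 2"
proof (rule sup_norm_le)
  fix i assume "x \<in> box_points r"
  then have "- (real r / 2) \<le> real_of_int (x $ i)" "real_of_int (x $ i) < real r / 2"
    by (simp_all add: box_points_def)
  then show "\<bar>real_of_int (x $ i)\<bar> \<le> real r / 2" by linarith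
qed

lemma norm1_box: "0 < r \<Longrightarrow> x \<in> box_points r \<Longrightarrow> norm1 x \<le> real r"
  using sup_norm_box[of x r] by auto

text \<open>The maximum is at least the geometric mean of the coordinates, so the sum is bounded by a
  product of one-dimensional sums.\<close>

lemma sum_norm1_powr_bounded:
  assumes "0 < \<epsilon>"
  shows "\<exists>S>0. \<forall>r. (\<Sum>x\<in>(box_points r :: (int ^ 'd::finite) set). norm1 x powr - (real CARD('d) + \<epsilon>)) \<le> S"
proof -
  define d where "d = real CARD('d)"
  have d: "0 < d" by (simp add: d_def)
  define s where "s = 1 + \<epsilon> / d"
  have s: "1 < s" "s * d = d + \<epsilon>" using assms d by (simp_all add: s_def field_simps)
  define g where "g = (\<lambda>k :: int. max 1 \<bar>real_of_int k\<bar> powr - s)"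
  define h where "h = (\<lambda>n. g (int n))"
  have g0: "0 \<le> g k" for k by (simp add: g_def)
  have "summable h"
  proof -
    have "summable (\<lambda>n. real n powr - s)" using s by (simp add: summable_real_powr_iff)
    moreover have "eventually (\<lambda>n. h n = real n powr - s) sequentially"
      using eventually_ge_at_top[of 1] by eventually_elim (simp add: h_def g_def max_def)
    ultimately show ?thesis by (subst summable_cong)
  qed
  then have h_le: "(\<Sum>n\<le>r. h n) \<le> suminf h" for r
    by (intro sum_le_suminf) (auto simp: h_def g0)
  have h1: "1 \<le> suminf h" using h_le[of 0] by (simp add: h_def g_def)
  have line: "(\<Sum>k\<in>box_range r. g k) \<le> 2 * suminf h" for r
  proof -
    have sub: "box_range r \<subseteq> int ` {..r} \<union> (\<lambda>n. - int n) ` {..r}"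
    proof
      fix k assume k: "k \<in> box_range r"
      show "k \<in> int ` {..r} \<union> (\<lambda>n. - int n) ` {..r}"
      proof (cases "0 \<le> k")
        case True
        then have "k = int (nat k)" "nat k \<le> r" using k by (auto simp: box_range_def)
        then show ?thesis by blast
      next
        case False
        then have "k = - int (nat (- k))" "nat (- k) \<le> r" using k by (auto simp: box_range_def)
        then show ?thesis by blast
      qed
    qed
    have "(\<Sum>k\<in>box_range r. g k) \<le> (\<Sum>k\<in>int ` {..r} \<union> (\<lambda>n. - int n) ` {..r}. g k)"
      by (rule sum_mono2[OF _ sub]) (auto simp: g0)
    also have "\<dots> \<le> (\<Sum>k\<in>int ` {..r}. g k) + (\<Sum>k\<in>(\<lambda>n. - int n) ` {..r}. g k)"
      by (subst sum_Un) (auto intro!: sum_nonneg g0)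
    also have "\<dots> = (\<Sum>n\<le>r. h n) + (\<Sum>n\<le>r. h n)"
      by (subst (1 2) sum.reindex) (auto simp: inj_on_def h_def g_def)
    also have "\<dots> \<le> 2 * suminf h" using h_le[of r] by simp
    finally show ?thesis .
  qed
  have "(\<Sum>x\<in>(box_points r :: (int ^ 'd) set). norm1 x powr - (real CARD('d) + \<epsilon>)) \<le> (2 * suminf h) ^ CARD('d)" for r
  proof -
    have "norm1 x powr - (real CARD('d) + \<epsilon>) \<le> (\<Prod>i\<in>UNIV. g (x $ i))" for x :: "int ^ 'd"
    proof -
      have "norm1 x powr - (real CARD('d) + \<epsilon>) = norm1 x powr (- s * d)" using s by (simp add: d_def)
      also have "\<dots> = (norm1 x powr - s) powr d" by (simp add: powr_powr)
      also have "\<dots> = (\<Prod>i\<in>(UNIV :: 'd set). norm1 x powr - s)" by (simp add: d_def powr_realpow)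
      also have "\<dots> \<le> (\<Prod>i\<in>UNIV. g (x $ i))"
      proof (intro prod_mono conjI)
        fix i
        have "max 1 \<bar>real_of_int (x $ i)\<bar> \<le> norm1 x" using component_le_sup_norm[of x i] by simp
        then show "norm1 x powr - s \<le> g (x $ i)" unfolding g_def using s by (intro powr_mono2') auto
      qed simp
      finally show ?thesis .
    qed
    then have "(\<Sum>x\<in>(box_points r :: (int ^ 'd) set). norm1 x powr - (real CARD('d) + \<epsilon>)) \<le>
        (\<Sum>x\<in>(box_points r :: (int ^ 'd) set). \<Prod>i\<in>UNIV. g (x $ i))" by (intro sum_mono)
    also have "\<dots> = (\<Sum>k\<in>box_range r. g k) ^ CARD('d)" by (rule sum_box_prod)
    also have "\<dots> \<le> (2 * suminf h) ^ CARD('d)" by (intro power_mono line sum_nonneg g0)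
    finally show ?thesis .
  qed
  moreover have "0 < (2 * suminf h) ^ CARD('d)" using h1 by simp
  ultimately show ?thesis by blast
qed

text \<open>On the chosen axis the two coordinates differ by l modulo r. If both were below l/2 in
  absolute value, l minus their difference would be a positive multiple of r smaller than 2 l \<le>
  r.\<close>

lemma norm1_shift_axis:
  fixes w :: "int ^ 'd::finite"
  assumes "2 * l \<le> r" "0 < l"
  shows "real l / 2 \<le> norm1 w \<or> real l / 2 \<le> norm1 (shift r (- axis_point (int l)) w)"
proof (rule ccontr)
  let ?i = "SOME i :: 'd. True"
  let ?k = "w $ ?i" and ?k' = "shift r (- axis_point (int l)) w $ ?i"
  assume "\<not> ?thesis"
  then have "sup_norm w < real l / 2" "sup_norm (shift r (- axis_point (int l)) w) < real l / 2" by auto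
  then have "\<bar>real_of_int ?k\<bar> < real l / 2" "\<bar>real_of_int ?k'\<bar> < real l / 2"
    using component_le_sup_norm order_le_less_trans by blast+
  then have "real_of_int \<bar>?k - ?k'\<bar> < real_of_int (int l)" by (simp add: abs_if split: if_splits)
  then have lt: "\<bar>?k - ?k'\<bar> < int l" by (simp only: of_int_less_iff)
  have "[?k' = - int l + ?k] (mod int r)"
    using shift_cong[of r "- axis_point (int l)" w ?i] by (simp add: axis_point_def)
  then have "int r dvd int l - (?k - ?k')" by (simp add: cong_iff_dvd_diff algebra_simps)
  then have "int r \<le> int l - (?k - ?k')" using lt by (intro zdvd_imp_le) auto
  then show False using lt assms by linarith
qed

context
  fixes r :: nat and S C p :: real and f :: "int ^ 'd::finite \<Rightarrow> real"
  assumes dim: "CARD('d) > 4" and r: "0 < r" and C: "0 \<le> C" and p: "0 \<le> p"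
    and S: "(\<Sum>x\<in>(box_points r :: (int ^ 'd) set). norm1 x powr - (real CARD('d) + 1 / 4)) \<le> S"
begin

lemma dim_real: "5 \<le> real CARD('d)"
  using dim by simp

lemma decay_powr: "1 / norm1 x ^ (CARD('d) - 2) = norm1 (x :: int ^ 'd) powr - (real CARD('d) - 2)"
proof -
  have "norm1 x powr (real CARD('d) - 2) = norm1 x ^ (CARD('d) - 2)"
    using powr_realpow[of "norm1 x" "CARD('d) - 2"] dim by (simp add: of_nat_diff)
  then show ?thesis by (simp only: powr_minus_divide)
qed

text \<open>Trading 9/4 powers of the norm for \<open>r\<close> leaves the summable exponent d +
  1/4. As 9/4 < 5/2 \<le> d/2, this contribution to the susceptibility is of lower order than
  r^(d/2).\<close>

lemma sum_decay:
  "(\<Sum>x\<in>(box_points r :: (int ^ 'd) set). 1 / norm1 x ^ (CARD('d) - 2)) \<le> S * real r powr (9 / 4)"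
proof -
  have "(\<Sum>x\<in>(box_points r :: (int ^ 'd) set). 1 / norm1 x ^ (CARD('d) - 2)) \<le>
      (\<Sum>x\<in>(box_points r :: (int ^ 'd) set). norm1 x powr - (real CARD('d) + 1 / 4) * real r powr (9 / 4))"
  proof (rule sum_mono)
    fix x :: "int ^ 'd" assume x: "x \<in> box_points r"
    have "1 / norm1 x ^ (CARD('d) - 2) = norm1 x powr (- (real CARD('d) + 1 / 4) + 9 / 4)"
      unfolding decay_powr by simp
    also have "\<dots> = norm1 x powr - (real CARD('d) + 1 / 4) * norm1 x powr (9 / 4)"
      by (rule powr_add)
    also have "\<dots> \<le> norm1 x powr - (real CARD('d) + 1 / 4) * real r powr (9 / 4)"
      by (intro mult_left_mono powr_mono2 norm1_box r x) auto
    finally show "1 / norm1 x ^ (CARD('d) - 2) \<le> norm1 x powr - (real CARD('d) + 1 / 4) * real r powr (9 / 4)" .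
  qed
  also have "\<dots> \<le> S * real r powr (9 / 4)"
    unfolding sum_distrib_right[symmetric] by (intro mult_right_mono S) simp
  finally show ?thesis .
qed

text \<open>The bubble converges because 2 (d - 2) \<ge> d + 1/4 for integers d > 4.\<close>

lemma sum_decay_square:
  "(\<Sum>x\<in>(box_points r :: (int ^ 'd) set). (1 / norm1 x ^ (CARD('d) - 2))\<^sup>2) \<le> S"
proof -
  have "(\<Sum>x\<in>(box_points r :: (int ^ 'd) set). (1 / norm1 x ^ (CARD('d) - 2))\<^sup>2) \<le>
      (\<Sum>x\<in>(box_points r :: (int ^ 'd) set). norm1 x powr - (real CARD('d) + 1 / 4))"
  proof (rule sum_mono)
    fix x :: "int ^ 'd"
    have "(1 / norm1 x ^ (CARD('d) - 2))\<^sup>2 = norm1 x powr (- (real CARD('d) - 2) + - (real CARD('d) - 2))"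
      unfolding decay_powr power2_eq_square by (rule powr_add[symmetric])
    also have "\<dots> \<le> norm1 x powr - (real CARD('d) + 1 / 4)"
      by (intro powr_mono) (use dim_real in linarith, simp)
    finally show "(1 / norm1 x ^ (CARD('d) - 2))\<^sup>2 \<le> norm1 x powr - (real CARD('d) + 1 / 4)" .
  qed
  then show ?thesis using S by linarith
qed

text \<open>Each decay factor is split into norm^(-(d + 1/4)/2) and norm^(-3/8), which d \<ge> 5
  permits, with equality at d = 5. One of the two points has norm at least l/2, which gives the
  gain; the other halves are recombined by the arithmetic-geometric mean inequality.\<close>

lemma sum_decay_product:
  assumes l: "0 < l" "2 * l \<le> r"
  shows "(\<Sum>x\<in>(box_points r :: (int ^ 'd) set). (1 / norm1 x ^ (CARD('d) - 2)) *
    (1 / norm1 (shift r (- axis_point (int l)) x) ^ (CARD('d) - 2))) \<le> S * (real l / 2) powr - (3 / 8)"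
proof -
  let ?b = "\<lambda>x :: int ^ 'd. norm1 x powr - (real CARD('d) + 1 / 4)"
  let ?s = "shift r (- axis_point (int l)) :: int ^ 'd \<Rightarrow> int ^ 'd"
  let ?L = "(real l / 2) powr - (3 / 8)"
  have A: "1 / norm1 x ^ (CARD('d) - 2) \<le> norm1 x powr - ((real CARD('d) + 1 / 4) / 2) * norm1 x powr - (3 / 8)"
    for x :: "int ^ 'd"
  proof -
    have e: "- (D - 2) \<le> - ((D + 1 / 4) / 2) + - (3 / 8)" if "5 \<le> D" for D :: real
      using that by (simp add: field_simps)
    have "norm1 x powr - (real CARD('d) - 2) \<le> norm1 x powr (- ((real CARD('d) + 1 / 4) / 2) + - (3 / 8))"
      by (rule powr_mono[OF e[OF dim_real]]) simp
    then show ?thesis unfolding decay_powr powr_add .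
  qed
  have "(1 / norm1 x ^ (CARD('d) - 2)) * (1 / norm1 (?s x) ^ (CARD('d) - 2)) \<le> ?L * ((?b x + ?b (?s x)) / 2)"
    for x :: "int ^ 'd"
  proof -
    let ?c = "norm1 x powr - ((real CARD('d) + 1 / 4) / 2)"
    let ?c' = "norm1 (?s x) powr - ((real CARD('d) + 1 / 4) / 2)"
    have "(1 / norm1 x ^ (CARD('d) - 2)) * (1 / norm1 (?s x) ^ (CARD('d) - 2)) \<le>
        (?c * norm1 x powr - (3 / 8)) * (?c' * norm1 (?s x) powr - (3 / 8))"
      by (intro mult_mono A) auto
    also have "\<dots> = (norm1 x powr - (3 / 8) * norm1 (?s x) powr - (3 / 8)) * (?c * ?c')"
      by (simp only: mult_ac)
    also have "\<dots> \<le> ?L * ((?b x + ?b (?s x)) / 2)"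
    proof (rule mult_mono)
      have one: "norm1 y powr - (3 / 8) \<le> 1" for y :: "int ^ 'd"
      proof -
        have "norm1 y powr - (3 / 8) \<le> norm1 y powr 0" by (rule powr_mono) simp_all
        also have "\<dots> = 1" using powr_zero_eq_one[of "norm1 y"] by (simp add: max_def)
        finally show ?thesis .
      qed
      have L: "norm1 y powr - (3 / 8) \<le> ?L" if "real l / 2 \<le> norm1 y" for y :: "int ^ 'd"
        using that l by (intro powr_mono2') auto
      show "norm1 x powr - (3 / 8) * norm1 (?s x) powr - (3 / 8) \<le> ?L"
        using norm1_shift_axis[OF l(2,1), of x]
      proof
        assume "real l / 2 \<le> norm1 x"
        from mult_mono[OF L[OF this] one[of "?s x"]] show ?thesis by simp
      next
        assume "real l / 2 \<le> norm1 (?s x)"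
        from mult_mono[OF one[of x] L[OF this]] show ?thesis by simp
      qed
      have amgm: "u * v \<le> (u * u + v * v) / 2" for u v :: real
        using sum_squares_bound[of u v] by (simp add: power2_eq_square)
      have b: "?b x = ?c * ?c" "?b (?s x) = ?c' * ?c'"
        unfolding powr_add[symmetric] by simp_all
      show "?c * ?c' \<le> (?b x + ?b (?s x)) / 2" unfolding b by (rule amgm)
    qed auto
    finally show ?thesis .
  qed
  then have "(\<Sum>x\<in>(box_points r :: (int ^ 'd) set). (1 / norm1 x ^ (CARD('d) - 2)) *
    (1 / norm1 (?s x) ^ (CARD('d) - 2))) \<le> (\<Sum>x\<in>box_points r. ?L * ((?b x + ?b (?s x)) / 2))"
    by (intro sum_mono)
  also have "\<dots> = ?L * (((\<Sum>x\<in>box_points r. ?b x) + (\<Sum>x\<in>box_points r. ?b (?s x))) / 2)"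
    by (simp only: sum_distrib_left[symmetric] sum_divide_distrib[symmetric] sum.distrib)
  also have "(\<Sum>x\<in>box_points r. ?b (?s x)) = (\<Sum>x\<in>box_points r. ?b x)"
    by (rule sum.reindex_bij_betw[OF bij_shift[OF r]])
  also have "?L * (((\<Sum>x\<in>box_points r. ?b x) + (\<Sum>x\<in>box_points r. ?b x)) / 2) \<le> ?L * S"
    using S by (intro mult_left_mono) auto
  finally show ?thesis by (simp only: mult.commute)
qed

text \<open>The profile is the infinite-volume decay plus the plateau \<open>p\<close>; in the
  square the mixed term is absorbed by (a + b)^2 \<le> 2 a^2 + 2 b^2.\<close>

lemma sum_plateau:
  assumes f: "\<And>x. x \<in> box_points r \<Longrightarrow> 0 \<le> f x \<and> f x \<le> C / norm1 x ^ (CARD('d) - 2) + p"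
  shows "(\<Sum>x\<in>box_points r. f x) \<le> C * S * real r powr (9 / 4) + real r ^ CARD('d) * p"
    and "(\<Sum>x\<in>box_points r. (f x)\<^sup>2) \<le> 2 * C\<^sup>2 * S + 2 * (real r ^ CARD('d) * p\<^sup>2)"
proof -
  let ?A = "\<lambda>x :: int ^ 'd. 1 / norm1 x ^ (CARD('d) - 2)"
  have f': "0 \<le> f x" "f x \<le> C * ?A x + p" if "x \<in> box_points r" for x using f[OF that] by auto
  have "(\<Sum>x\<in>box_points r. f x) \<le> (\<Sum>x\<in>box_points r. C * ?A x + p)" by (intro sum_mono f')
  also have "\<dots> = C * (\<Sum>x\<in>box_points r. ?A x) + real r ^ CARD('d) * p"
    by (simp only: sum.distrib sum_distrib_left[symmetric] sum_constant card_box_points of_nat_power)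
  also have "\<dots> \<le> C * (S * real r powr (9 / 4)) + real r ^ CARD('d) * p"
    by (intro add_right_mono mult_left_mono sum_decay C)
  finally show "(\<Sum>x\<in>box_points r. f x) \<le> C * S * real r powr (9 / 4) + real r ^ CARD('d) * p"
    by (simp only: mult.assoc)
  have "(\<Sum>x\<in>box_points r. (f x)\<^sup>2) \<le> (\<Sum>x\<in>box_points r. 2 * C\<^sup>2 * (?A x)\<^sup>2 + 2 * p\<^sup>2)"
  proof (rule sum_mono)
    fix x assume x: "x \<in> (box_points r :: (int ^ 'd) set)"
    have "(f x)\<^sup>2 \<le> (C * ?A x + p)\<^sup>2" by (intro power_mono f' x)
    also have "\<dots> \<le> 2 * (C * ?A x)\<^sup>2 + 2 * p\<^sup>2"
      using sum_squares_bound[of "C * ?A x" p] by (simp only: power2_sum)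
    finally show "(f x)\<^sup>2 \<le> 2 * C\<^sup>2 * (?A x)\<^sup>2 + 2 * p\<^sup>2" by (simp only: power_mult_distrib mult.assoc)
  qed
  also have "\<dots> = 2 * C\<^sup>2 * (\<Sum>x\<in>box_points r. (?A x)\<^sup>2) + real r ^ CARD('d) * (2 * p\<^sup>2)"
    by (simp only: sum.distrib sum_distrib_left[symmetric] sum_constant card_box_points of_nat_power)
  also have "\<dots> \<le> 2 * C\<^sup>2 * S + real r ^ CARD('d) * (2 * p\<^sup>2)"
    by (intro add_right_mono mult_left_mono sum_decay_square) auto
  finally show "(\<Sum>x\<in>box_points r. (f x)\<^sup>2) \<le> 2 * C\<^sup>2 * S + 2 * (real r ^ CARD('d) * p\<^sup>2)"
    by (simp only: mult_ac)
qed

text \<open>For plateaus of order r^(-d/2), decay times decay is small for large \<open>l\<close>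
  and the mixed products are small for large \<open>r\<close>; only plateau times plateau has to be
  made small through \<open>p'\<close>.\<close>

lemma sum_plateau_product:
  assumes f: "\<And>x. x \<in> box_points r \<Longrightarrow> 0 \<le> f x \<and> f x \<le> C / norm1 x ^ (CARD('d) - 2) + p"
    and g: "\<And>x. x \<in> box_points r \<Longrightarrow> 0 \<le> g x \<and> g x \<le> C / norm1 x ^ (CARD('d) - 2) + p'"
    and p': "0 \<le> p'" and l: "0 < l" "2 * l \<le> r"
  shows "(\<Sum>x\<in>box_points r. f x * g (shift r (- axis_point (int l)) x)) \<le>
    C\<^sup>2 * (S * (real l / 2) powr - (3 / 8)) + (p + p') * (C * (S * real r powr (9 / 4))) + real r ^ CARD('d) * (p * p')"
proof -
  let ?A = "\<lambda>x :: int ^ 'd. 1 / norm1 x ^ (CARD('d) - 2)"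
  let ?s = "shift r (- axis_point (int l)) :: int ^ 'd \<Rightarrow> int ^ 'd"
  have f': "0 \<le> f x" "f x \<le> C * ?A x + p" if "x \<in> box_points r" for x using f[OF that] by auto
  have g': "0 \<le> g x" "g x \<le> C * ?A x + p'" if "x \<in> box_points r" for x using g[OF that] by auto
  have s: "?s x \<in> box_points r" for x by (rule shift_in_box[OF r])
  have "(\<Sum>x\<in>box_points r. f x * g (?s x)) \<le> (\<Sum>x\<in>box_points r. (C * ?A x + p) * (C * ?A (?s x) + p'))"
    using C p by (intro sum_mono mult_mono f' g' s) auto
  also have "\<dots> = (\<Sum>x\<in>box_points r. C\<^sup>2 * (?A x * ?A (?s x)) + p' * (C * ?A x) + p * (C * ?A (?s x)) + p * p')"
  proof -
    have "(C * a + p) * (C * b + p') = C\<^sup>2 * (a * b) + p' * (C * a) + p * (C * b) + p * p'" for a b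
      by (simp add: power2_eq_square algebra_simps)
    then show ?thesis by (intro sum.cong refl)
  qed
  also have "\<dots> = C\<^sup>2 * (\<Sum>x\<in>box_points r. ?A x * ?A (?s x)) + p' * (C * (\<Sum>x\<in>box_points r. ?A x)) +
      p * (C * (\<Sum>x\<in>box_points r. ?A (?s x))) + real r ^ CARD('d) * (p * p')"
    by (simp only: sum.distrib sum_distrib_left[symmetric] sum_constant card_box_points of_nat_power) (simp only: mult_ac)
  also have "(\<Sum>x\<in>box_points r. ?A (?s x)) = (\<Sum>x\<in>box_points r. ?A x)"
    by (rule sum.reindex_bij_betw[OF bij_shift[OF r]])
  also have "C\<^sup>2 * (\<Sum>x\<in>box_points r. ?A x * ?A (?s x)) + p' * (C * (\<Sum>x\<in>box_points r. ?A x)) +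
      p * (C * (\<Sum>x\<in>box_points r. ?A x)) + real r ^ CARD('d) * (p * p') \<le>
      C\<^sup>2 * (S * (real l / 2) powr - (3 / 8)) + p' * (C * (S * real r powr (9 / 4))) +
      p * (C * (S * real r powr (9 / 4))) + real r ^ CARD('d) * (p * p')"
    by (intro add_right_mono add_mono mult_left_mono sum_decay_product sum_decay l C p p') auto
  finally show ?thesis by (simp add: distrib_right)
qed

end

section \<open>Kurtosis on the torus and choice of the constants\<close>

text \<open>\<open>C\<close> is coth (b/2). Since sinh \<beta> / (cosh \<beta> - 1) = coth
  (\<beta>/2) decreases in \<beta>, one constant serves the local modification for all \<beta> \<ge>
  b.\<close>

lemma coth_bounds:
  fixes \<beta> b :: real
  assumes "0 < b" "b \<le> \<beta>"
  defines "C \<equiv> (exp b + 1) / (exp b - 1)"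
  shows "0 \<le> C" "sinh \<beta> \<le> C * (cosh \<beta> - 1)" "cosh \<beta> - 1 \<le> C * sinh \<beta>" "1 \<le> C * sinh \<beta>"
proof -
  define x where "x = exp \<beta>"
  have x: "1 < x" using assms by (simp add: x_def)
  have b: "1 < exp b" "exp b \<le> x" using assms by (simp_all add: x_def)
  have sinh: "sinh \<beta> = (x - 1) * (x + 1) / (2 * x)" and cosh: "cosh \<beta> - 1 = (x - 1) * (x - 1) / (2 * x)"
    using x by (simp_all add: sinh_def cosh_def x_def exp_minus field_simps)
  have "(x + 1) * (exp b - 1) \<le> (exp b + 1) * (x - 1)" using b by (simp add: algebra_simps)
  then have "x + 1 \<le> (exp b + 1) * (x - 1) / (exp b - 1)"
    using b by (simp only: pos_le_divide_eq diff_gt_0_iff_gt)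
  also have "\<dots> = C * (x - 1)" by (simp add: C_def)
  finally have C: "(x + 1) / (x - 1) \<le> C"
    using x by (simp only: pos_divide_le_eq diff_gt_0_iff_gt)
  have C1: "1 \<le> C" using b by (simp add: C_def pos_le_divide_eq)
  from C1 show "0 \<le> C" by simp
  have "sinh \<beta> = (x + 1) / (x - 1) * (cosh \<beta> - 1)"
    unfolding sinh cosh using x by (simp add: divide_simps)
  also have "\<dots> \<le> C * (cosh \<beta> - 1)" by (intro mult_right_mono C) (simp add: cosh_real_ge_1)
  finally show "sinh \<beta> \<le> C * (cosh \<beta> - 1)" .
  have s0: "0 \<le> sinh \<beta>" using assms by simp
  have "cosh \<beta> - 1 \<le> sinh \<beta>"
    unfolding sinh cosh using x by (intro divide_right_mono mult_left_mono) auto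
  also have "\<dots> \<le> C * sinh \<beta>" using mult_right_mono[OF C1 s0] by simp
  finally show "cosh \<beta> - 1 \<le> C * sinh \<beta>" .
  have "1 \<le> (x + 1) / (x - 1) * sinh \<beta>"
    unfolding sinh using x by (simp add: divide_simps) (simp add: algebra_simps)
  also have "\<dots> \<le> C * sinh \<beta>" by (intro mult_right_mono C s0)
  finally show "1 \<le> C * sinh \<beta>" .
qed

lemma eventually_powr_le:
  fixes k e s :: real
  assumes "0 < s" "0 < e"
  shows "eventually (\<lambda>r :: nat. k * real r powr - s \<le> e) sequentially"
proof -
  have "((\<lambda>r :: nat. k * real r powr - s) \<longlongrightarrow> k * 0) sequentially"
    by (intro tendsto_intros tendsto_neg_powr filterlim_real_sequentially) (use assms in auto)
  then have "eventually (\<lambda>r :: nat. k * real r powr - s < e) sequentially"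
    by (rule order_tendstoD) (use assms in simp)
  then show ?thesis by (rule eventually_mono) simp
qed

text \<open>The powers of the volume cancel, as numerator and denominator are both of degree four in
  the magnetization.\<close>

lemma renormalized_coupling_torus:
  fixes \<beta> :: real
  assumes "2 \<le> r"
  defines "M \<equiv> ising_graph.moment (box_points r :: (int ^ 'd::finite) set) (snd (torus r)) (\<lambda>_. \<beta>)"
  assumes "M 2 \<noteq> 0"
  shows "renormalized_coupling TYPE('d) r \<beta> = (3 * (M 2)\<^sup>2 - M 4) / (M 2)\<^sup>2"
proof -
  interpret T: ising_graph "box_points r :: (int ^ 'd) set" "snd (torus r)"
    by (rule ising_graph_torus[OF assms(1)])
  define N where "N = real r ^ CARD('d)"
  have N: "0 < N" using assms(1) by (simp add: N_def)
  have mom: "magnetization_moment TYPE('d) r \<beta> k = M k / N ^ k" for k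
  proof -
    have "magnetization_moment TYPE('d) r \<beta> k = T.ev (\<lambda>_. \<beta>) (\<lambda>\<sigma>. magnetization r \<sigma> ^ k)"
      unfolding magnetization_moment_def by (subst torus_pair) (rule T.expectation_eq_ev)
    also have "\<dots> = T.ev (\<lambda>_. \<beta>) (\<lambda>\<sigma>. (1 / N ^ k) * (\<Sum>x\<in>box_points r. \<sigma> x) ^ k)"
      by (intro T.ev_cong) (simp add: magnetization_def N_def power_divide)
    also have "\<dots> = M k / N ^ k" unfolding T.ev_cmult M_def by simp
    finally show ?thesis .
  qed
  have "(M 2 / N\<^sup>2)\<^sup>2 = (M 2)\<^sup>2 / N ^ 4" by (simp add: power_divide power_mult[symmetric])
  then show ?thesis
    using assms(3) N unfolding renormalized_coupling_def mom by (simp add: divide_simps)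
qed

text \<open>The estimates for a single torus, with \<open>R = r\<^sup>d\<^sup>/\<^sup>2\<close> and a second, smaller inverse temperature
  \<open>\<beta>'\<close> at which the susceptibility is still of order \<open>R\<close>.\<close>

lemma torus_kurtosis_lower:
  fixes \<beta> \<beta>' \<kappa> \<kappa>' \<rho> b C S :: real and r l :: nat
  assumes dim: "CARD('d::finite) > 4" and r: "3 \<le> r" and l: "0 < l" "2 * l < r"
    and \<beta>: "0 < b" "b \<le> \<beta>" "0 \<le> \<beta>'" "\<beta>' \<le> \<beta>"
    and nonneg: "0 \<le> C" "0 \<le> \<kappa>" "0 \<le> \<kappa>'" "0 \<le> \<rho>" "0 < S"
    and S: "(\<Sum>x\<in>(box_points r :: (int ^ 'd) set). norm1 x powr - (real CARD('d) + 1 / 4)) \<le> S"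
  defines "R \<equiv> real r powr (real CARD('d) / 2)"
  assumes upper: "\<And>x :: int ^ 'd. x \<in> box_points r \<Longrightarrow>
      two_point (torus r) \<beta> 0 x \<le> C / norm1 x ^ (CARD('d) - 2) + \<kappa> / R"
    and upper': "\<And>x :: int ^ 'd. x \<in> box_points r \<Longrightarrow>
      two_point (torus r) \<beta>' 0 x \<le> C / norm1 x ^ (CARD('d) - 2) + \<kappa>' / R"
    and lower': "\<rho> * R \<le> (\<Sum>x\<in>(box_points r :: (int ^ 'd) set). two_point (torus r) \<beta>' 0 x)"
    and small: "C\<^sup>2 * (S * (real l / 2) powr - (3 / 8)) + (\<kappa> + \<kappa>') * (C * S) * real r powr - (1 / 4) + \<kappa> * \<kappa>' \<le> 1 / 2"
  shows "\<rho> ^ 4 / (32 * (2 * ((exp b + 1) / (exp b - 1))) ^ (4 * l) * (2 * C\<^sup>2 * S + 2 * \<kappa>\<^sup>2 + 1) * (C * S + \<kappa>)\<^sup>2)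
      \<le> renormalized_coupling TYPE('d) r \<beta>" and "renormalized_coupling TYPE('d) r \<beta> \<le> 2"
proof -
  interpret T: ising_graph "box_points r :: (int ^ 'd) set" "snd (torus r)"
    by (rule ising_graph_torus) (use r in simp)
  let ?B = "box_points r :: (int ^ 'd) set"
  define N where "N = real r ^ CARD('d)"
  define J where "J = (\<lambda>_ :: (int ^ 'd) set. \<beta>)"
  define J' where "J' = (\<lambda>_ :: (int ^ 'd) set. \<beta>')"
  define f where "f = (\<lambda>x. T.tp J 0 x)"
  define f' where "f' = (\<lambda>x. T.tp J' 0 x)"
  have r0: "0 < r" "2 \<le> r" and R: "1 \<le> R" "0 < R"
    using r ge_one_powr_ge_zero[of "real r" "real CARD('d) / 2"] by (simp_all add: R_def)
  have RN: "R * R = N"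
    using r unfolding R_def N_def powr_add[symmetric] by (simp add: powr_realpow)
  have N: "0 < N" "real (card ?B) = N" using r by (simp_all add: N_def card_box_points)
  have tp: "two_point (torus r) \<beta> 0 x = f x" "two_point (torus r) \<beta>' 0 x = f' x" for x :: "int ^ 'd"
    unfolding f_def f'_def J_def J'_def by (simp_all only: two_point_torus[OF r0(2)])
  have zero: "(0 :: int ^ 'd) \<in> ?B" using r by (simp add: box_points_def)
  have J0: "0 \<le> J e" "0 \<le> J' e" "J' e \<le> J e" for e using \<beta> by (simp_all add: J_def J'_def)
  have F: "0 \<le> f x \<and> f x \<le> C / norm1 x ^ (CARD('d) - 2) + \<kappa> / R" if "x \<in> ?B" for x
    using upper[OF that] T.tp_nonneg[OF zero that, of J] J0 unfolding tp by (simp add: f_def)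
  have F': "0 \<le> f' x \<and> f' x \<le> C / norm1 x ^ (CARD('d) - 2) + \<kappa>' / R" if "x \<in> ?B" for x
    using upper'[OF that] T.tp_nonneg[OF zero that, of J'] J0 unfolding tp by (simp add: f'_def)
  define X where "X = (\<Sum>x\<in>?B. f x)"
  define X' where "X' = (\<Sum>x\<in>?B. f' x)"
  define B where "B = 2 * C\<^sup>2 * S + 2 * \<kappa>\<^sup>2 + 1"
  have p: "0 \<le> \<kappa> / R" "0 \<le> \<kappa>' / R" using nonneg R by simp_all
  \<comment> \<open>The inequality 9/4 \<le> d/2 - 1/4 for d \<ge> 5 leaves a spare factor r^(-1/4),
    which makes the mixed products in \<open>small\<close> vanish as r grows.\<close>
  have r94: "real r powr (9 / 4) \<le> real r powr - (1 / 4) * R"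
  proof -
    have "9 / 4 \<le> - (1 / 4) + D / 2" if "5 \<le> D" for D :: real using that by simp
    from powr_mono[OF this[of "real CARD('d)"], of "real r"] show ?thesis
      using r dim unfolding R_def powr_add[symmetric] by simp
  qed
  have "real r powr - (1 / 4) \<le> 1" using powr_mono[of "- (1 / 4)" 0 "real r"] r by simp
  then have r94': "real r powr (9 / 4) \<le> R" using r94 mult_right_mono[of "real r powr - (1 / 4)" 1 R] R by linarith
  have X: "X \<le> (C * S + \<kappa>) * R"
  proof -
    have "X \<le> C * S * real r powr (9 / 4) + N * (\<kappa> / R)"
      unfolding X_def N_def by (rule sum_plateau(1)[OF dim r0(1) nonneg(1) p(1) S F])
    also have "N * (\<kappa> / R) = \<kappa> * R" using R RN by (simp add: field_simps)
    also have "C * S * real r powr (9 / 4) \<le> C * S * R"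
      using nonneg by (intro mult_left_mono r94') simp
    finally show ?thesis by (simp add: distrib_right)
  qed
  have B: "(\<Sum>x\<in>?B. (f x)\<^sup>2) \<le> B"
  proof -
    have "(\<Sum>x\<in>?B. (f x)\<^sup>2) \<le> 2 * C\<^sup>2 * S + 2 * (N * (\<kappa> / R)\<^sup>2)"
      unfolding N_def by (rule sum_plateau(2)[OF dim r0(1) nonneg(1) p(1) S F])
    also have "N * (\<kappa> / R)\<^sup>2 = \<kappa>\<^sup>2" using R RN[symmetric] by (simp add: power2_eq_square)
    finally show ?thesis by (simp add: B_def)
  qed
  have B0: "0 < B" using nonneg by (simp add: B_def add_nonneg_pos)
  \<comment> \<open>Translation invariance reduces every row to that of 0; \<open>h\<close> covers
    the correlation and its square at once.\<close>
  have row: "(\<Sum>w\<in>?B. h (T.tp K u w)) = (\<Sum>w\<in>?B. h (T.tp K 0 w))" if u: "u \<in> ?B" and K: "K = (\<lambda>_. c)" for u K c and h :: "real \<Rightarrow> real"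
  proof -
    have "(\<Sum>w\<in>?B. h (T.tp K u w)) = (\<Sum>w\<in>?B. h (T.tp K u (shift r u w)))"
      by (rule sum.reindex_bij_betw[OF bij_shift[OF r0(1)], symmetric])
    also have "\<dots> = (\<Sum>w\<in>?B. h (T.tp K 0 w))"
      using tp_torus_shift[OF r0(2) zero, where u = u] shift_zero[OF u] unfolding K by (intro sum.cong refl) simp
    finally show ?thesis .
  qed
  have rows: "(\<Sum>x\<in>?B. T.tp J x w) = X" "(\<Sum>x\<in>?B. T.tp J' x w) = X'" "(\<Sum>v\<in>?B. (T.tp J w v)\<^sup>2) \<le> B"
    if "w \<in> ?B" for w
    using row[OF that J_def, of "\<lambda>t. t"] row[OF that J'_def, of "\<lambda>t. t"] row[OF that J_def, of "\<lambda>t. t\<^sup>2"] B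
    by (simp_all add: X_def X'_def f_def f'_def T.tp_commute[of _ _ w])
  let ?v = "axis_point (int l) :: int ^ 'd"
  have v: "?v \<in> ?B" using l by (auto simp: axis_point_def box_points_iff box_range_def)
  \<comment> \<open>Shifting u to 0 turns the sum into a convolution of the two profiles at the axis
    point, and \<open>small\<close> bounds its contributions.\<close>
  have cross: "(\<Sum>w\<in>?B. T.tp J u w * T.tp J' w (shift r u ?v)) \<le> 1 / 2" if u: "u \<in> ?B" for u
  proof -
    have "(\<Sum>w\<in>?B. T.tp J u w * T.tp J' w (shift r u ?v)) =
        (\<Sum>w\<in>?B. T.tp J u (shift r u w) * T.tp J' (shift r u w) (shift r u ?v))"
      by (rule sum.reindex_bij_betw[OF bij_shift[OF r0(1)], symmetric])
    also have "\<dots> = (\<Sum>w\<in>?B. f w * f' (shift r (- ?v) w))"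
    proof (intro sum.cong refl arg_cong2[where f = "(*)"])
      fix w assume w: "w \<in> ?B"
      show "T.tp J u (shift r u w) = f w"
        using tp_torus_shift[OF r0(2) zero w, of \<beta> u] shift_zero[OF u] by (simp add: f_def J_def)
      have "T.tp J' (shift r u w) (shift r u ?v) = T.tp J' ?v w"
        using tp_torus_shift[OF r0(2) w v, of \<beta>' u] by (simp add: J'_def mult.commute)
      also have "\<dots> = f' (shift r (- ?v) w)"
        using tp_torus_shift[OF r0(2) zero shift_in_box[OF r0(1), of "- ?v" w], of \<beta>' ?v]
          shift_zero[OF v] shift_inverse'[OF w, of ?v] by (simp add: f'_def J'_def)
      finally show "T.tp J' (shift r u w) (shift r u ?v) = f' (shift r (- ?v) w)" .
    qed
    also have "\<dots> \<le> C\<^sup>2 * (S * (real l / 2) powr - (3 / 8)) +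
        (\<kappa> / R + \<kappa>' / R) * (C * (S * real r powr (9 / 4))) + N * (\<kappa> / R * (\<kappa>' / R))"
      unfolding N_def
      by (rule sum_plateau_product[OF dim r0(1) nonneg(1) p(1) S F F' p(2) l(1)]) (use l in simp_all)
    also have "N * (\<kappa> / R * (\<kappa>' / R)) = \<kappa> * \<kappa>'" using R RN[symmetric] by simp
    also have "(\<kappa> / R + \<kappa>' / R) * (C * (S * real r powr (9 / 4))) \<le>
        (\<kappa> / R + \<kappa>' / R) * (C * (S * (real r powr - (1 / 4) * R)))"
      using p nonneg by (intro mult_left_mono r94) auto
    also have "\<dots> = (\<kappa> + \<kappa>') * (C * S) * real r powr - (1 / 4)" using R by (simp add: field_simps)
    finally show ?thesis using small by linarith
  qed
  define c where "c = (exp b + 1) / (exp b - 1)"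
  note coth = coth_bounds[OF \<beta>(1,2), folded c_def]
  have c1: "1 \<le> c" using \<beta>(1) by (simp add: c_def pos_le_divide_eq)
  define a where "a = X * X' / 2 / (2 * c) ^ l"
  have X1: "1 \<le> X"
  proof -
    have "f 0 \<le> X" unfolding X_def by (rule member_le_sum[OF zero]) (use F finite_box_points in auto)
    then show ?thesis using T.tp_same[OF zero, of J] by (simp add: f_def)
  qed
  have X': "\<rho> * R \<le> X'" "0 \<le> X'"
    using lower' nonneg R F' unfolding tp X'_def by (auto intro!: sum_nonneg)
  have a0: "0 \<le> a" using X1 X' c1 by (simp add: a_def)
  have a: "a \<le> (\<Sum>x\<in>?B. \<Sum>y\<in>?B. T.through J x y u)" if u: "u \<in> ?B" for u
  proof -
    have walk: "((\<lambda>a b. {a, b} \<in> snd (torus r)) ^^ l) u (shift r u ?v)"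
      using torus_walk[OF r0(1) l(2), of u] shift_zero[OF u] by simp
    have "X * X' / 2 \<le> (2 * c) ^ l * (\<Sum>x\<in>?B. \<Sum>y\<in>?B. T.through J x y u)"
      by (rule T.through_sum_lower[OF _ _ coth(1) _ _ _ walk u shift_in_box[OF r0(1)] rows(1) rows(2) cross[OF u]])
        (use J0 coth in \<open>simp_all add: J_def\<close>)
    then show ?thesis using c1 unfolding a_def by (simp add: pos_divide_le_eq mult.commute)
  qed
  define D where "D = 3 * (T.moment J 2)\<^sup>2 - T.moment J 4"
  have "2 * (real (card ?B) * a\<^sup>2)\<^sup>2 \<le> D * (4 * X ^ 4 * (real (card ?B) * B))"
    unfolding D_def by (rule T.kurtosis_lower[OF _ a0 a rows(1) rows(3)]) (use J0 in simp_all)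
  then have "N * (2 * N * a ^ 4) \<le> N * (D * (4 * X ^ 4 * B))"
    by (simp add: N power_mult_distrib power2_eq_square power4_eq_xxxx mult_ac)
  then have D: "2 * N * a ^ 4 \<le> D * (4 * X ^ 4 * B)" using N by simp
  have m2: "T.moment J 2 = N * X"
    unfolding T.moment_2 using rows(1) by (simp add: T.tp_commute[of J] N sum.swap[of "\<lambda>x y. T.tp J x y"])
  have NX: "0 < N * X" using N X1 by simp
  have g: "renormalized_coupling TYPE('d) r \<beta> = D / (N * X)\<^sup>2"
  proof -
    have "N \<noteq> 0" "X \<noteq> 0" using N X1 by simp_all
    then show ?thesis
      using renormalized_coupling_torus[OF r0(2), where 'd = 'd and \<beta> = \<beta>] m2
      unfolding D_def J_def by simp
  qed
  have "D \<le> 2 * (N * X)\<^sup>2"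
    unfolding D_def m2[symmetric] using T.moment_2_le_4[of J] by simp
  then show "renormalized_coupling TYPE('d) r \<beta> \<le> 2" 
    unfolding g using zero_less_power[OF NX, of 2] by (simp only: pos_divide_le_eq)
  let ?c = "(2 * c) ^ (4 * l)"
  have c0: "0 < ?c" using c1 by simp
  have "\<rho> ^ 4 * N\<^sup>2 \<le> X' ^ 4"
  proof -
    have "\<rho> ^ 4 * N\<^sup>2 = (\<rho> * R) ^ 4"
      unfolding RN[symmetric] by (simp add: power_mult_distrib power2_eq_square power4_eq_xxxx)
    also have "\<dots> \<le> X' ^ 4" using X' nonneg R by (intro power_mono) auto
    finally show ?thesis .
  qed
  have a4: "a ^ 4 * (16 * ?c) = X ^ 4 * X' ^ 4"
  proof -
    define q where "q = (2 * c) ^ l"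
    have q: "q \<noteq> 0" using c1 by (simp add: q_def)
    have "?c = q ^ 4" unfolding q_def power_mult[symmetric] by (simp only: mult.commute)
    then show ?thesis
      unfolding a_def q_def[symmetric] using q by (simp add: power_divide power_mult_distrib)
  qed
  have X4: "0 < X ^ 4" using X1 by simp
  \<comment> \<open>The fourth power of X occurs in the first and in the second moment bound and
    cancels; the susceptibility at \<beta>' remains.\<close>
  have "X ^ 4 * (2 * N * X' ^ 4) = 2 * N * a ^ 4 * (16 * ?c)" using a4 by (simp add: mult_ac)
  also have "\<dots> \<le> D * (4 * X ^ 4 * B) * (16 * ?c)" using D c0 by (intro mult_right_mono) auto
  also have "\<dots> = X ^ 4 * (64 * D * B * ?c)" by simp
  finally have "2 * N * X' ^ 4 \<le> 64 * D * B * ?c" using X4 by (simp only: mult_le_cancel_left_pos)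
  then have "2 * N * (\<rho> ^ 4 * N\<^sup>2) \<le> 64 * D * B * ?c"
    using mult_left_mono[OF \<open>\<rho> ^ 4 * N\<^sup>2 \<le> X' ^ 4\<close>, of "2 * N"] N by linarith
  then have num: "\<rho> ^ 4 * (N * N\<^sup>2) \<le> 32 * ?c * B * D" by (simp add: mult_ac)
  have D0: "0 \<le> D"
  proof -
    have "0 \<le> \<rho> ^ 4 * (N * N\<^sup>2)" using N by simp
    then have "0 \<le> (32 * ?c * B) * D" using num by linarith
    moreover have "0 < 32 * ?c * B" using c0 B0 by simp
    ultimately show ?thesis by (simp only: zero_le_mult_iff) linarith
  qed
  have Y: "X\<^sup>2 \<le> (C * S + \<kappa>)\<^sup>2 * N"
    using power_mono[OF X, of 2] X1 by (simp add: RN[symmetric] power2_eq_square mult_ac)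
  have Y0: "0 < (C * S + \<kappa>)\<^sup>2"
  proof -
    have "0 < (C * S + \<kappa>) * R" using X X1 by linarith
    then show ?thesis using R by (simp add: zero_less_mult_iff)
  qed
  have den: "0 < 32 * ?c * B * (C * S + \<kappa>)\<^sup>2" using c0 B0 Y0 by simp
  \<comment> \<open>X is at most of order R, the square root of N, so (N X)^2 is at most of order
    N^3, which is the order of the lower bound for \<open>D\<close>.\<close>
  have "\<rho> ^ 4 * (N * X)\<^sup>2 = (\<rho> ^ 4 * N\<^sup>2) * X\<^sup>2" by (simp add: power_mult_distrib)
  also have "\<dots> \<le> (\<rho> ^ 4 * N\<^sup>2) * ((C * S + \<kappa>)\<^sup>2 * N)" by (intro mult_left_mono Y) simp
  also have "\<dots> = \<rho> ^ 4 * (N * N\<^sup>2) * (C * S + \<kappa>)\<^sup>2" by (simp only: mult_ac)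
  also have "\<dots> \<le> 32 * ?c * B * D * (C * S + \<kappa>)\<^sup>2" by (intro mult_right_mono num) simp
  also have "\<dots> = D * (32 * ?c * B * (C * S + \<kappa>)\<^sup>2)" by (simp only: mult_ac)
  finally have "\<rho> ^ 4 / (32 * ?c * B * (C * S + \<kappa>)\<^sup>2) \<le> D / (N * X)\<^sup>2"
    by (simp only: pos_divide_le_eq[OF den] times_divide_eq_left pos_le_divide_eq[OF zero_less_power[OF NX, of 2]])
  then show "\<rho> ^ 4 / (32 * (2 * ((exp b + 1) / (exp b - 1))) ^ (4 * l) * (2 * C\<^sup>2 * S + 2 * \<kappa>\<^sup>2 + 1) * (C * S + \<kappa>)\<^sup>2)
      \<le> renormalized_coupling TYPE('d) r \<beta>"
    unfolding g c_def B_def .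
qed

theorem theorem1p4:
  fixes c\<^sub>0 C\<^sub>0 c\<^sub>1 c\<^sub>2 c\<^sub>3 c\<^sub>4 c\<^sub>5 :: real
  assumes dim: "CARD('d::finite) > 4"
    and pos_inputs: "c\<^sub>0 > 0" "C\<^sub>0 > 0"
    and chi_bounds: "susceptibility_bounds TYPE('d)"
    and tau_upper: "tau_upper_bound TYPE('d) c\<^sub>0 C\<^sub>0"
    and tau_lower: "tau_lower_bound TYPE('d) c\<^sub>0"
    and pos: "c\<^sub>1 > 0" "c\<^sub>2 > 0" "c\<^sub>3 > 0" "c\<^sub>4 > 0" "c\<^sub>5 > 0"
    and c3: "c\<^sub>3 = 4 / 9 * c\<^sub>0\<^sup>2"
    and torus_upper: "torus_upper_bound TYPE('d) c\<^sub>1"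
    and torus_lower: "torus_lower_bound TYPE('d) c\<^sub>2 c\<^sub>3 c\<^sub>4 c\<^sub>5"
  shows "\<exists>c\<^sub>g>0. \<exists>r\<^sub>0::nat. \<forall>r\<ge>r\<^sub>0.
           c\<^sub>g \<le> renormalized_coupling TYPE('d) r (beta_star TYPE('d) c\<^sub>4 r) \<and>
           renormalized_coupling TYPE('d) r (beta_star TYPE('d) c\<^sub>4 r) \<le> 2"
proof -
  define bc where "bc = beta_c TYPE('d)"
  have bc: "0 < bc" unfolding bc_def by (rule chi_real_bounds(1)[OF chi_bounds])
  obtain a A where aA: "0 < a" "0 < A" and chi: "\<And>\<beta>. 0 < \<beta> \<Longrightarrow> \<beta> < bc \<Longrightarrow>
      a / (bc - \<beta>) \<le> enn2real (chi TYPE('d) \<beta>) \<and> enn2real (chi TYPE('d) \<beta>) \<le> A / (bc - \<beta>)"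
    using chi_real_bounds(2)[OF chi_bounds] unfolding bc_def by blast
  obtain S where S: "0 < S"
    "\<And>r. (\<Sum>x\<in>(box_points r :: (int ^ 'd) set). norm1 x powr - (real CARD('d) + 1 / 4)) \<le> S"
    using sum_norm1_powr_bounded[of "1 / 4", where 'd = 'd] by auto
  \<comment> \<open>Bound on the plateau height at \<open>beta_star\<close>, multiplied by R =
    r^(d/2): it is \<open>c\<^sub>1\<close> \<chi> / R^2 with \<chi> at most A R /
    \<open>c\<^sub>4\<close>.\<close>
  define \<kappa> where "\<kappa> = c\<^sub>1 * A / c\<^sub>4"
  have \<kappa>: "0 < \<kappa>" using aA pos by (simp add: \<kappa>_def)
  \<comment> \<open>At \<beta>' the bound on the height is smaller by the factor K; this value makes
    the product of the two heights, times the volume, at most 1/8.\<close>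
  define K where "K = 1 + 8 * \<kappa>\<^sup>2"
  have K: "1 \<le> K" "\<kappa> * (\<kappa> / K) \<le> 1 / 8" by (simp_all add: K_def power2_eq_square pos_divide_le_eq add_pos_nonneg)
  \<comment> \<open>The 2 in the denominator allows for keeping at least half of the vertices, those
    with sup norm at least \<open>c\<^sub>5\<close>; the K reflects the smaller susceptibility at
    \<beta>'.\<close>
  define \<rho> where "\<rho> = c\<^sub>2 * a / (2 * K * c\<^sub>4)"
  have \<rho>: "0 < \<rho>" using aA pos K by (simp add: \<rho>_def)
  \<comment> \<open>Three contributions, controlled by l, by K and by r, are each made at most 1/8,
    so their sum stays below 1/2.\<close>
  obtain l :: nat where l: "0 < l" "C\<^sub>0\<^sup>2 * (S * (real l / 2) powr - (3 / 8)) \<le> 1 / 8"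
  proof -
    have "eventually (\<lambda>l :: nat. 0 < l \<and> (C\<^sub>0\<^sup>2 * S * (1 / 2) powr - (3 / 8)) * real l powr - (3 / 8) \<le> 1 / 8) sequentially"
      by (intro eventually_conj eventually_gt_at_top eventually_powr_le) auto
    then obtain l :: nat where l: "0 < l" "(C\<^sub>0\<^sup>2 * S * (1 / 2) powr - (3 / 8)) * real l powr - (3 / 8) \<le> 1 / 8"
      unfolding eventually_sequentially by blast
    have "(real l / 2) powr - (3 / 8) = (1 / 2) powr - (3 / 8) * real l powr - (3 / 8)"
      using powr_mult[of "1 / 2" "real l" "- (3 / 8)"] by simp
    then show thesis using l by (intro that[of l]) (simp_all add: mult.assoc)
  qed
  define M where "M = card {x :: int ^ 'd. sup_norm x < c\<^sub>5}"
  have finM: "finite {x :: int ^ 'd. sup_norm x < c\<^sub>5}"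
  proof (rule finite_subset)
    show "{x :: int ^ 'd. sup_norm x < c\<^sub>5} \<subseteq> {x. \<forall>i. x $ i \<in> {- \<lceil>c\<^sub>5\<rceil>..\<lceil>c\<^sub>5\<rceil>}}"
    proof clarify
      fix x :: "int ^ 'd" and i assume "sup_norm x < c\<^sub>5"
      then have "\<bar>real_of_int (x $ i)\<bar> < c\<^sub>5" using component_le_sup_norm order_le_less_trans by blast
      then have "real_of_int (x $ i) \<le> real_of_int \<lceil>c\<^sub>5\<rceil>" "- real_of_int \<lceil>c\<^sub>5\<rceil> \<le> real_of_int (x $ i)"
        using le_of_int_ceiling[of c\<^sub>5] by linarith+
      then show "x $ i \<in> {- \<lceil>c\<^sub>5\<rceil>..\<lceil>c\<^sub>5\<rceil>}"
        unfolding of_int_minus[symmetric] of_int_le_iff by simp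
    qed
  qed (rule finite_vec_range, simp)
  \<comment> \<open>The lower bound of \<open>torus_kurtosis_lower\<close> at b = bc/2; K, entering
    through \<rho>, and l are fixed before r, so it does not depend on r.\<close>
  define c\<^sub>g where "c\<^sub>g = \<rho> ^ 4 / (32 * (2 * ((exp (bc / 2) + 1) / (exp (bc / 2) - 1))) ^ (4 * l) *
    (2 * C\<^sub>0\<^sup>2 * S + 2 * \<kappa>\<^sup>2 + 1) * (C\<^sub>0 * S + \<kappa>)\<^sup>2)"
  have "0 < (exp (bc / 2) + 1) / (exp (bc / 2) - 1)" using bc by (simp add: add_pos_pos)
  moreover have "0 < 2 * C\<^sub>0\<^sup>2 * S + 2 * \<kappa>\<^sup>2 + 1" "0 < C\<^sub>0 * S + \<kappa>"
    using S \<kappa> pos_inputs by (auto intro!: add_nonneg_pos add_pos_pos)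
  ultimately have cg: "0 < c\<^sub>g"
    unfolding c\<^sub>g_def by (intro divide_pos_pos mult_pos_pos zero_less_power \<rho>) (simp_all add: bc add_pos_pos)
  \<comment> \<open>The exponents come from r^(-d/2) \<le> r^(-5/2). With t =
    \<open>c\<^sub>4\<close> r^(-d/2), the bound on K t keeps \<beta>' positive, and the two bounds
    on K t r^2 put \<beta>' into the window of the plateau and the whole box into the range of the
    lower bound on \<open>tau\<close>.\<close>
  have ev: "eventually (\<lambda>r :: nat. 3 \<le> r \<and> 2 * l < r \<and> 2 * M \<le> r \<and>
      (K * c\<^sub>4) * real r powr - (5 / 2) \<le> bc / 2 \<and> (K * c\<^sub>4) * real r powr - (1 / 2) \<le> c\<^sub>3 \<and>
      (K * c\<^sub>4) * real r powr - (1 / 2) \<le> c\<^sub>0\<^sup>2 \<and>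
      ((\<kappa> + \<kappa> / K) * (C\<^sub>0 * S)) * real r powr - (1 / 4) \<le> 1 / 8) sequentially"
    by (intro eventually_conj eventually_ge_at_top eventually_gt_at_top eventually_powr_le)
      (use bc pos pos_inputs in auto)
  then obtain r\<^sub>0 where r\<^sub>0: "\<And>r. r\<^sub>0 \<le> r \<Longrightarrow> 3 \<le> r \<and> 2 * l < r \<and> 2 * M \<le> r \<and>
      (K * c\<^sub>4) * real r powr - (5 / 2) \<le> bc / 2 \<and> (K * c\<^sub>4) * real r powr - (1 / 2) \<le> c\<^sub>3 \<and>
      (K * c\<^sub>4) * real r powr - (1 / 2) \<le> c\<^sub>0\<^sup>2 \<and>
      ((\<kappa> + \<kappa> / K) * (C\<^sub>0 * S)) * real r powr - (1 / 4) \<le> 1 / 8"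
    unfolding eventually_sequentially by blast
  have "c\<^sub>g \<le> renormalized_coupling TYPE('d) r (beta_star TYPE('d) c\<^sub>4 r) \<and>
           renormalized_coupling TYPE('d) r (beta_star TYPE('d) c\<^sub>4 r) \<le> 2" if "r\<^sub>0 \<le> r" for r
  proof -
    from r\<^sub>0[OF that] have r: "3 \<le> r" "2 * l < r" "2 * M \<le> r"
      and small: "(K * c\<^sub>4) * real r powr - (5 / 2) \<le> bc / 2" "(K * c\<^sub>4) * real r powr - (1 / 2) \<le> c\<^sub>3"
        "(K * c\<^sub>4) * real r powr - (1 / 2) \<le> c\<^sub>0\<^sup>2"
        "((\<kappa> + \<kappa> / K) * (C\<^sub>0 * S)) * real r powr - (1 / 4) \<le> 1 / 8" by auto
    define R where "R = real r powr (real CARD('d) / 2)"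
    define N where "N = real r ^ CARD('d)"
    have R: "0 < R" using r by (simp add: R_def)
    have RN: "R * R = N"
      using r unfolding R_def N_def powr_add[symmetric] by (simp add: powr_realpow)
    have N: "0 < N" using r by (simp add: N_def)
    define t where "t = c\<^sub>4 / R"
    have t: "0 < t" using pos R by (simp add: t_def)
    have t_powr: "t = c\<^sub>4 * real r powr - (real CARD('d) / 2)" by (simp add: t_def R_def powr_minus_divide)
    define \<beta> where "\<beta> = bc - t"
    \<comment> \<open>K \<ge> 1 keeps \<beta>' at or below \<open>beta_star\<close>, where the
      plateau lower bound is available.\<close>
    define \<beta>' where "\<beta>' = bc - K * t"
    have star: "beta_star TYPE('d) c\<^sub>4 r = \<beta>" by (simp add: beta_star_def \<beta>_def bc_def t_powr)
    have tK: "t \<le> K * t" using K t by simp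
    have t_le: "K * t \<le> (K * c\<^sub>4) * real r powr - (5 / 2)"
    proof -
      have "- (D / 2) \<le> - (5 / 2)" if "5 \<le> D" for D :: real using that by simp
      moreover have "5 \<le> real CARD('d)" using dim by simp
      ultimately have "real r powr - (real CARD('d) / 2) \<le> real r powr - (5 / 2)"
        using r by (intro powr_mono) auto
      then show ?thesis unfolding t_powr using K pos by simp
    qed
    have Kt2: "K * t * (real r)\<^sup>2 \<le> (K * c\<^sub>4) * real r powr - (1 / 2)"
    proof -
      have "real r powr - (5 / 2) * (real r)\<^sup>2 = real r powr (- (5 / 2) + 2)"
      proof -
        have "(real r)\<^sup>2 = real r powr 2" using r by (simp add: powr_numeral)
        then show ?thesis by (simp only: powr_add)
      qed
      then have eq: "real r powr - (5 / 2) * (real r)\<^sup>2 = real r powr - (1 / 2)" by simp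
      have "K * t * (real r)\<^sup>2 \<le> (K * c\<^sub>4) * real r powr - (5 / 2) * (real r)\<^sup>2"
        by (intro mult_right_mono t_le) simp
      also have "\<dots> = (K * c\<^sub>4) * real r powr - (1 / 2)" by (simp only: mult.assoc eq)
      finally show ?thesis .
    qed
    have \<beta>: "bc / 2 \<le> \<beta>" "\<beta> < bc" "0 < \<beta>" "0 < \<beta>'" "\<beta>' \<le> \<beta>" "\<beta>' < bc"
      unfolding \<beta>_def \<beta>'_def using t tK order_trans[OF t_le small(1)] bc by linarith+
    have upper: "two_point (torus r) b 0 x \<le> C\<^sub>0 / norm1 x ^ (CARD('d) - 2) + (c\<^sub>1 * A / s) / N"
      if b: "b = bc - s" "0 < b" "0 < s" and x: "x \<in> box_points r" for b s and x :: "int ^ 'd"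
    proof -
      have "two_point (torus r) b 0 x \<le> tau b 0 x + c\<^sub>1 * enn2real (chi TYPE('d) b) / N"
        using torus_upper r x b unfolding torus_upper_bound_def N_def bc_def by simp
      also have "tau b 0 x \<le> C\<^sub>0 / norm1 x ^ (CARD('d) - 2) * exp (- c\<^sub>0 * sqrt (bc - b) * sup_norm x)"
        by (rule tau_upper[unfolded tau_upper_bound_def, rule_format, of b x, folded bc_def]) (use b in auto)
      also have "\<dots> \<le> C\<^sub>0 / norm1 x ^ (CARD('d) - 2) * 1"
      proof (intro mult_left_mono)
        have "0 \<le> sup_norm x" using component_le_sup_norm[of x undefined] by linarith
        then show "exp (- c\<^sub>0 * sqrt (bc - b) * sup_norm x) \<le> 1" using pos_inputs b by simp
      qed (use pos_inputs in simp)
      also have "c\<^sub>1 * enn2real (chi TYPE('d) b) / N \<le> c\<^sub>1 * (A / s) / N"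
        using chi[of b] b pos N by (intro divide_right_mono mult_left_mono) auto
      finally show ?thesis by simp
    qed
    have lower: "c\<^sub>2 * (a / (K * t)) / N \<le> two_point (torus r) \<beta>' 0 x"
      if x: "x \<in> box_points r" "c\<^sub>5 \<le> sup_norm x" for x :: "int ^ 'd"
    proof -
      have s: "0 \<le> sup_norm x" "sup_norm x \<le> real r / 2"
        using component_le_sup_norm[of x undefined] sup_norm_box[OF x(1)] by linarith+
      have "(sup_norm x * sqrt (bc - \<beta>'))\<^sup>2 = (sup_norm x)\<^sup>2 * (K * t)"
        using K t by (simp add: power_mult_distrib \<beta>'_def)
      also have "\<dots> \<le> (real r)\<^sup>2 * (K * t)"
        using s K t by (intro mult_right_mono power_mono) auto
      also have "\<dots> \<le> c\<^sub>0\<^sup>2" using Kt2 small(3) by (simp add: mult.commute)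
      finally have "sup_norm x * sqrt (bc - \<beta>') \<le> c\<^sub>0" by (rule power2_le_imp_le) (use pos_inputs in simp)
      then have "c\<^sub>0 / norm1 x ^ (CARD('d) - 2) \<le> tau \<beta>' 0 x"
        using tau_lower \<beta> unfolding tau_lower_bound_def bc_def by simp
      then have "0 \<le> tau \<beta>' 0 x" using pos_inputs by (rule_tac order_trans[rotated]) auto
      moreover have "bc - c\<^sub>3 / (real r)\<^sup>2 \<le> \<beta>'"
        using Kt2 small(2) r unfolding \<beta>'_def by (simp add: pos_le_divide_eq)
      then have "tau \<beta>' 0 x + c\<^sub>2 * enn2real (chi TYPE('d) \<beta>') / N \<le> two_point (torus r) \<beta>' 0 x"
        using torus_lower r x \<beta> unfolding torus_lower_bound_def N_def bc_def[symmetric] by (simp add: star)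
      moreover have "c\<^sub>2 * (a / (K * t)) / N \<le> c\<^sub>2 * enn2real (chi TYPE('d) \<beta>') / N"
        using chi[of \<beta>'] \<beta> pos N by (intro divide_right_mono mult_left_mono) (auto simp: \<beta>'_def)
      ultimately show ?thesis by linarith
    qed
    have tp0: "0 \<le> two_point (torus r) \<beta>' 0 x" if "x \<in> box_points r" for x :: "int ^ 'd"
    proof -
      interpret T: ising_graph "box_points r :: (int ^ 'd) set" "snd (torus r)"
        by (rule ising_graph_torus) (use r in simp)
      have "(0 :: int ^ 'd) \<in> box_points r" using r by (simp add: box_points_def)
      then show ?thesis using r that \<beta> by (subst two_point_torus) (auto intro!: T.tp_nonneg)
    qed
    have sum_lower: "\<rho> * R \<le> (\<Sum>x\<in>(box_points r :: (int ^ 'd) set). two_point (torus r) \<beta>' 0 x)"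
    proof -
      let ?G = "box_points r - {x :: int ^ 'd. sup_norm x < c\<^sub>5}"
      have "card (box_points r :: (int ^ 'd) set) - M \<le> card ?G"
        unfolding M_def by (rule diff_card_le_card_Diff[OF finM])
      then have "real (r ^ CARD('d)) - real M \<le> real (card ?G)" unfolding card_box_points by linarith
      then have "N - real M \<le> real (card ?G)" by (simp add: N_def)
      moreover have "real M \<le> N / 2"
      proof -
        have "real (2 * M) \<le> real r" using r by simp
        also have "\<dots> \<le> N" unfolding N_def using r self_le_power[of "real r" "CARD('d)"] by simp
        finally show ?thesis by simp
      qed
      ultimately have card: "N / 2 \<le> real (card ?G)" by linarith
      have "\<rho> * R = N / 2 * (c\<^sub>2 * (a / (K * t)) / N)"
        using R N K pos unfolding \<rho>_def t_def by (simp add: field_simps)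
      also have "\<dots> \<le> real (card ?G) * (c\<^sub>2 * (a / (K * t)) / N)"
        using card pos aA K t N by (intro mult_right_mono) auto
      also have "\<dots> \<le> (\<Sum>x\<in>?G. two_point (torus r) \<beta>' 0 x)"
        by (rule sum_bounded_below) (use lower in auto)
      also have "\<dots> \<le> (\<Sum>x\<in>(box_points r :: (int ^ 'd) set). two_point (torus r) \<beta>' 0 x)"
        by (rule sum_mono2) (use finite_box_points tp0 in auto)
      finally show ?thesis .
    qed
    have p: "c\<^sub>1 * A / t / N = \<kappa> / R" "c\<^sub>1 * A / (K * t) / N = \<kappa> / K / R"
      using R K pos unfolding \<kappa>_def t_def RN[symmetric] by (simp_all add: field_simps)
    have tot: "C\<^sub>0\<^sup>2 * (S * (real l / 2) powr - (3 / 8)) + (\<kappa> + \<kappa> / K) * (C\<^sub>0 * S) * real r powr - (1 / 4) + \<kappa> * (\<kappa> / K) \<le> 1 / 2"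
      using l(2) small(4) K(2) by linarith
    have \<kappa>K: "0 \<le> \<kappa> / K" using \<kappa> K by simp
    have K0: "0 < K * t" using K t by simp
    have up: "two_point (torus r) \<beta> 0 x \<le> C\<^sub>0 / norm1 x ^ (CARD('d) - 2) + \<kappa> / real r powr (real CARD('d) / 2)"
      if "x \<in> box_points r" for x :: "int ^ 'd"
      using upper[OF \<beta>_def \<beta>(3) t that] unfolding p R_def .
    have up': "two_point (torus r) \<beta>' 0 x \<le> C\<^sub>0 / norm1 x ^ (CARD('d) - 2) + \<kappa> / K / real r powr (real CARD('d) / 2)"
      if "x \<in> box_points r" for x :: "int ^ 'd"
      using upper[OF \<beta>'_def \<beta>(4) K0 that] unfolding p R_def .
    have bc2: "0 < bc / 2" using bc by simp
    note result = torus_kurtosis_lower[OF dim r(1) l(1) r(2) bc2 \<beta>(1) less_imp_le[OF \<beta>(4)] \<beta>(5)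
        less_imp_le[OF pos_inputs(2)] less_imp_le[OF \<kappa>] \<kappa>K less_imp_le[OF \<rho>] S(1) S(2) up up'
        sum_lower[unfolded R_def] tot]
    show ?thesis unfolding star c\<^sub>g_def using result by (rule conjI)
  qed
  then show ?thesis using cg by blast
qed

end
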